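(* Let $K\ge 2$ be an integer and let $g\in\mathcal{C}^K(\mathbb{R},\mathbb{R})$ be such that $u=0$ and $u=1$ are two consecutive zeros of $g$, $g$ is concave on $[0,1]$, and $g'(1)<0<g'(0)$. Let $(a_k)_{k\ge1}\subset\mathbb{R}$ be a sequence for which there exist $C>0$ and $\rho\in(0,1)$ with $|a_k|\le C\rho^k$ for all $k\ge1$, and such that $\sum_{k=1}^{+\infty}a_k=1$ (the $a_k$ may have any sign). Let $c>2\sqrt{g'(0)}$. Then there exists $h_0>0$ such that for all $h\in(0,h_0)$ there exists a profile $\phi_h\in\mathcal{C}^{K+1}(\mathbb{R},\mathbb{R})$ with $\lim_{x\to-\infty}\phi_h(x)=1$ and $\lim_{x\to+\infty}\phi_h(x)=0$ such that $u_j(t)=\phi_h(jh-ct)$ solves $$\dot u_j(t)=\sum_{k=1}^{+\infty}a_k\frac{u_{j+k}(t)-2u_j(t)+u_{j-k}(t)}{k^2h^2}+g(u_j(t)),\qquad t>0,\ j\in\mathbb{Z}.$$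
   Context: "Consecutive zeros" means $g(0)=g(1)=0$ and $g$ does not vanish on $(0,1)$. *)

theory Defs
  imports "HOL-Analysis.Analysis"
begin

definition C_k :: "nat \<Rightarrow> (real \<Rightarrow> real) \<Rightarrow> bool" where
  "C_k k f \<longleftrightarrow>
     (\<forall>i<k. (deriv ^^ i) f differentiable_on UNIV) \<and> continuous_on UNIV ((deriv ^^ k) f)"

definition consecutive_zeros :: "(real \<Rightarrow> real) \<Rightarrow> real \<Rightarrow> real \<Rightarrow> bool" where
  "consecutive_zeros g p q \<longleftrightarrow>
     p < q \<and> g p = 0 \<and> g q = 0 \<and> (\<forall>x. p < x \<and> x < q \<longrightarrow> g x \<noteq> 0)"

definition coupling_term :: "(nat \<Rightarrow> real) \<Rightarrow> real \<Rightarrow> (int \<Rightarrow> real) \<Rightarrow> int \<Rightarrow> nat \<Rightarrow> real" where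
  "coupling_term a h v j k =
     a k * ((v (j + int k) - 2 * v j + v (j - int k)) / ((real k)\<^sup>2 * h\<^sup>2))"

(* The coupling series runs over k \<ge> 1, hence the shift by Suc; a 0 is never used.
   Summability is required because suminf is total: it is what makes the series meaningful. *)
definition solves_lattice_eq ::
    "(nat \<Rightarrow> real) \<Rightarrow> real \<Rightarrow> (real \<Rightarrow> real) \<Rightarrow> (int \<Rightarrow> real \<Rightarrow> real) \<Rightarrow> bool" where
  "solves_lattice_eq a h g u \<longleftrightarrow>
     (\<forall>t>0. \<forall>j.
        summable (\<lambda>k. coupling_term a h (\<lambda>i. u i t) j (Suc k)) \<and>
        (u j has_real_derivative
           (\<Sum>k. coupling_term a h (\<lambda>i. u i t) j (Suc k)) + g (u j t)) (at t))"

end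

theory Submission
  imports Defs
begin

text \<open>
A travelling wave \<open>u\<^sub>j(t) = \<phi>(jh - ct)\<close> solves the lattice equation iff
\<open>c \<phi>' + D\<^sub>h \<phi> + g(\<phi>) = 0\<close>, where \<open>D\<^sub>h\<close> is the weighted sum of second differences with steps
\<open>kh\<close>. As \<open>h\<close> tends to 0, \<open>D\<^sub>h\<close> tends to the second derivative on fixed smooth functions. The
profile is found near the front \<open>\<phi>\<^sub>0\<close> of the limit equation \<open>\<phi>'' + c \<phi>' + g(\<phi>) = 0\<close>. The weights
\<open>a\<^sub>k\<close> may change sign, so there is no comparison principle for the lattice equation, and \<open>D\<^sub>h\<close> may be
antidissipative at wave lengths comparable to \<open>h\<close>; the argument is an \<open>L\<^sup>2\<close> perturbation
argument.

The continuum front. Writing \<open>\<phi>\<^sub>0' = - g(\<phi>\<^sub>0) \<rho>\<close> turns the second order equation into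
\<open>\<rho>' = g'(\<phi>\<^sub>0) \<rho>\<^sup>2 - c \<rho> + 1\<close>. Since \<open>g'(1) \<le> g'(u) \<le> g'(0)\<close>, this equation has two positive constant
barriers, and between them it is a contraction because \<open>c > 2 sqrt (g'(0))\<close>; this gives a bounded
solution on the whole line (\<open>front_exists\<close>). With \<open>d\<close> for differentiation, the same function factorises the linearisation
\<open>L\<^sub>0 = d\<^sup>2 + c d + g'(\<phi>\<^sub>0) = (d + 1/\<rho>) (d - (1/\<rho> - c))\<close>, and both first order factors have bounded right
inverses on \<open>L\<^sup>2\<close> (\<open>linearised_front_right_inverse\<close>). The kernel of \<open>L\<^sub>0\<close> is spanned by
\<open>\<phi>\<^sub>0'\<close>, so a right inverse is all there can be.

From the continuum to the lattice. The loss of control at high frequencies is repaired by the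
transport term: \<open>D\<^sub>h\<close> is symmetric and commutes with \<open>d\<close>, hence \<open>\<langle>D\<^sub>h u, u'\<rangle> = 0\<close> and
\<open>c |u'| \<le> |D\<^sub>h u + c u' - u|\<close> in \<open>L\<^sup>2\<close>, uniformly in \<open>h\<close> and for any signs of the weights
(\<open>transport_estimate\<close>). With this estimate the continuity method solves \<open>D\<^sub>h u + c u' - u = f\<close> up
to an arbitrarily small error (\<open>almost_invertible_1\<close>). A right inverse of
\<open>L\<^sub>h = D\<^sub>h + c d + g'(\<phi>\<^sub>0)\<close> with small relative error is then glued together in
\<open>approximate_right_inverse\<close>: a given \<open>f\<close> is split at the length scale \<open>\<eta> = sqrt h\<close> as
\<open>f = y + \<eta> y'\<close>. The smooth part \<open>y\<close> is treated by \<open>L\<^sub>0\<close>, at the price of the consistency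
error \<open>h |w'''| \<approx> h / \<eta>\<close>; the rough part \<open>\<eta> y'\<close> is treated by the lattice operator, and being
\<open>\<eta>\<close> times a derivative it costs only \<open>O(\<eta>)\<close>.

Conclusion. A simplified Newton iteration with this approximate inverse starts from \<open>\<phi>\<^sub>0\<close>, whose
residual is \<open>O(h)\<close>, and halves the residual in every step. The iterates converge uniformly,
while their residuals converge only in \<open>L\<^sup>2\<close>; the limit is therefore taken in the integrated
equation (\<open>lattice_front_from_approximate_inverse\<close>).
Smoothness follows because the equation expresses \<open>\<phi>'\<close> by \<open>\<phi>\<close> itself, without loss of
derivatives.
\<close>

section \<open>Continuous square-integrable functions\<close>

definition sq_integrable :: "(real \<Rightarrow> real) \<Rightarrow> bool" where
  "sq_integrable f \<longleftrightarrow> continuous_on UNIV f \<and> integrable lborel (\<lambda>x. (f x)\<^sup>2)"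

definition l2norm :: "(real \<Rightarrow> real) \<Rightarrow> real" where
  "l2norm f = sqrt (LINT x|lborel. (f x)\<^sup>2)"

text \<open>Normalised to vanish at 0 and defined on both sides of it, so that it is differentiable on the whole line.\<close>
definition antideriv :: "(real \<Rightarrow> real) \<Rightarrow> real \<Rightarrow> real" where
  "antideriv f x = (if 0 \<le> x then integral {0..x} f else - integral {x..0} f)"

lemma continuous_on_UNIV_measurable [measurable_dest]:
  fixes f :: "real \<Rightarrow> real"
  assumes "continuous_on UNIV f" shows "f \<in> borel_measurable borel"
  using assms by (rule borel_measurable_continuous_onI)

lemma has_real_derivative_continuous_on:
  fixes f :: "real \<Rightarrow> real"
  assumes "\<And>x. (f has_real_derivative f' x) (at x)" shows "continuous_on S f"
  using assms by (meson DERIV_isCont continuous_at_imp_continuous_on)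

lemma antideriv_deriv:
  assumes c: "continuous_on UNIV f"
  shows "(antideriv f has_real_derivative f x) (at x)"
proof -
  define N where "N = \<bar>x\<bar> + 1"
  have cN: "continuous_on S f" for S using c continuous_on_subset by blast
  have int: "f integrable_on {p..q}" for p q using cN by (rule integrable_continuous_real)
  have eq: "antideriv f u = integral {-N..u} f - integral {-N..0} f" if "u \<in> {-N..N}" for u
  proof (cases "0 \<le> u")
    case True
    then show ?thesis using that Henstock_Kurzweil_Integration.integral_combine[of "-N" 0 u f] int
      by (auto simp: antideriv_def N_def)
  next
    case False
    then show ?thesis using that Henstock_Kurzweil_Integration.integral_combine[of "-N" u 0 f] int
      by (auto simp: antideriv_def N_def)
  qed
  have "((\<lambda>u. integral {-N..u} f) has_vector_derivative f x) (at x within {-N..N})"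
    by (rule integral_has_vector_derivative[OF cN]) (auto simp: N_def)
  then have "((\<lambda>u. integral {-N..u} f) has_real_derivative f x) (at x)"
    by (subst (asm) at_within_interior)
       (auto simp: N_def has_real_derivative_iff_has_vector_derivative)
  then have "((\<lambda>u. integral {-N..u} f - integral {-N..0} f) has_real_derivative f x - 0) (at x)"
    by (intro derivative_intros)
  then have "((\<lambda>u. integral {-N..u} f - integral {-N..0} f) has_real_derivative f x) (at x)" by simp
  moreover have "\<forall>\<^sub>F u in nhds x. integral {-N..u} f - integral {-N..0} f = antideriv f u"
  proof -
    have "\<forall>\<^sub>F u in nhds x. u \<in> {-N<..<N}"
      by (rule eventually_nhds_in_open) (auto simp: N_def)
    then show ?thesis by eventually_elim (use eq in auto)
  qed
  ultimately show ?thesis by (subst (asm) DERIV_cong_ev) auto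
qed

lemma antideriv_0 [simp]: "antideriv f 0 = 0"
  by (simp add: antideriv_def)

lemma sq_integrableD:
  assumes "sq_integrable f"
  shows "continuous_on UNIV f" "integrable lborel (\<lambda>x. (f x)\<^sup>2)" "f \<in> borel_measurable borel"
    "isCont f x"
  using assms continuous_on_UNIV_measurable continuous_on_eq_continuous_at by (auto simp: sq_integrable_def)

lemma l2norm_nonneg [simp]: "0 \<le> l2norm f"
  by (simp add: l2norm_def)

lemma l2norm_sq: "(l2norm f)\<^sup>2 = (LINT x|lborel. (f x)\<^sup>2)"
  by (simp add: l2norm_def)

text \<open>Norm bounds become bounds on nonnegative integrals, the form in which Fatou's lemma and Tonelli's
theorem apply.\<close>
lemma sq_integrable_nn:
  assumes c: "continuous_on UNIV f" and B: "0 \<le> B"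
  shows "sq_integrable f \<and> l2norm f \<le> B \<longleftrightarrow> (\<integral>\<^sup>+x. ennreal ((f x)\<^sup>2) \<partial>lborel) \<le> ennreal (B\<^sup>2)"
proof
  assume a: "sq_integrable f \<and> l2norm f \<le> B"
  then have "(\<integral>\<^sup>+x. ennreal ((f x)\<^sup>2) \<partial>lborel) = ennreal ((l2norm f)\<^sup>2)"
    by (subst nn_integral_eq_integral) (auto simp: sq_integrable_def l2norm_sq)
  also have "\<dots> \<le> ennreal (B\<^sup>2)" using a by (intro ennreal_leI power_mono) auto
  finally show "(\<integral>\<^sup>+x. ennreal ((f x)\<^sup>2) \<partial>lborel) \<le> ennreal (B\<^sup>2)" .
next
  assume a: "(\<integral>\<^sup>+x. ennreal ((f x)\<^sup>2) \<partial>lborel) \<le> ennreal (B\<^sup>2)"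
  have [measurable]: "f \<in> borel_measurable borel" using c by (rule continuous_on_UNIV_measurable)
  have int: "integrable lborel (\<lambda>x. (f x)\<^sup>2)"
    using a by (intro integrableI_nonneg) (auto simp: order_le_less_trans[OF _ ennreal_less_top])
  have "(\<integral>\<^sup>+x. ennreal ((f x)\<^sup>2) \<partial>lborel) = ennreal ((l2norm f)\<^sup>2)"
    using int by (subst nn_integral_eq_integral) (auto simp: l2norm_sq)
  with a have "(l2norm f)\<^sup>2 \<le> B\<^sup>2" by (simp add: ennreal_le_iff)
  then have "l2norm f \<le> B" using B by (rule power2_le_imp_le)
  then show "sq_integrable f \<and> l2norm f \<le> B" using int c by (simp add: sq_integrable_def)
qed

lemma sq_integrable_fatou:
  assumes c: "continuous_on UNIV f" and B: "0 \<le> B"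
    and m: "\<And>n. F n \<in> borel_measurable borel"
    and le: "\<And>n. (\<integral>\<^sup>+x. ennreal ((F n x)\<^sup>2) \<partial>lborel) \<le> ennreal (B\<^sup>2)"
    and lim: "\<And>x. (\<lambda>n. F n x) \<longlonglongrightarrow> f x"
  shows "sq_integrable f" "l2norm f \<le> B"
proof -
  have "(\<integral>\<^sup>+x. ennreal ((f x)\<^sup>2) \<partial>lborel) = (\<integral>\<^sup>+x. liminf (\<lambda>n. ennreal ((F n x)\<^sup>2)) \<partial>lborel)"
  proof (rule nn_integral_cong)
    fix x
    have "(\<lambda>n. ennreal ((F n x)\<^sup>2)) \<longlonglongrightarrow> ennreal ((f x)\<^sup>2)"
      by (intro tendsto_ennrealI tendsto_power lim)
    then show "ennreal ((f x)\<^sup>2) = liminf (\<lambda>n. ennreal ((F n x)\<^sup>2))"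
      by (intro lim_imp_Liminf[symmetric]) auto
  qed
  also have "\<dots> \<le> liminf (\<lambda>n. \<integral>\<^sup>+x. ennreal ((F n x)\<^sup>2) \<partial>lborel)"
    using m by (intro nn_integral_liminf) auto
  also have "\<dots> \<le> ennreal (B\<^sup>2)" by (intro Liminf_le) (auto simp: le)
  finally show "sq_integrable f" "l2norm f \<le> B" using sq_integrable_nn[OF c B] by auto
qed

text \<open>Fatou's lemma. Limits are identified pointwise first, and this controls their norm.\<close>
lemma sq_integrable_limit:
  assumes c: "continuous_on UNIV f" and B: "0 \<le> B"
    and F: "\<And>n. sq_integrable (F n)" "\<And>n. l2norm (F n) \<le> B"
    and lim: "\<And>x. (\<lambda>n. F n x) \<longlonglongrightarrow> f x"
  shows "sq_integrable f" "l2norm f \<le> B"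
proof -
  have "(\<integral>\<^sup>+x. ennreal ((F n x)\<^sup>2) \<partial>lborel) \<le> ennreal (B\<^sup>2)" for n
    using F sq_integrableD(1) sq_integrable_nn[OF _ B] by blast
  then show "sq_integrable f" "l2norm f \<le> B"
    using sq_integrable_fatou[OF c B _ _ lim] sq_integrableD(3)[OF F(1)] by auto
qed

text \<open>Monotone convergence along growing intervals; the integral over an interval is expressed by a
primitive \<open>G\<close> of the square, so that differential inequalities can be used directly.\<close>
lemma sq_integrable_compact:
  assumes c: "continuous_on UNIV f" and B: "0 \<le> B"
    and G: "\<And>x. (G has_real_derivative (f x)\<^sup>2) (at x)"
    and le: "\<And>N::nat. G (real N) - G (- real N) \<le> B\<^sup>2"
  shows "sq_integrable f" "l2norm f \<le> B"
proof -
  have [measurable]: "f \<in> borel_measurable borel" using c by (rule continuous_on_UNIV_measurable)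
  define F where "F n x = f x * indicator {-real n..real n} x" for n :: nat and x
  have "(\<integral>\<^sup>+x. ennreal ((F n x)\<^sup>2) \<partial>lborel) \<le> ennreal (B\<^sup>2)" for n
  proof -
    have "(\<integral>\<^sup>+x. ennreal ((F n x)\<^sup>2) \<partial>lborel) = (\<integral>\<^sup>+x. ennreal ((f x)\<^sup>2) * indicator {-real n..real n} x \<partial>lborel)"
      by (intro nn_integral_cong) (auto simp: F_def indicator_def)
    also have "\<dots> = ennreal (G (real n) - G (- real n))"
      using G by (intro nn_integral_FTC_Icc) auto
    finally show ?thesis using le by (simp add: ennreal_leI)
  qed
  moreover have "(\<lambda>n. F n x) \<longlonglongrightarrow> f x" for x
  proof (rule tendsto_eventually)
    obtain N :: nat where "\<bar>x\<bar> \<le> N" using real_arch_simple by blast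
    then show "\<forall>\<^sub>F n in sequentially. F n x = f x"
      by (intro eventually_sequentiallyI[of N]) (auto simp: F_def indicator_def)
  qed
  moreover have "F n \<in> borel_measurable borel" for n unfolding F_def by measurable
  ultimately show "sq_integrable f" "l2norm f \<le> B"
    using sq_integrable_fatou[OF c B, of F] by auto
qed

lemma sq_integrable_interval_le:
  assumes f: "sq_integrable f" and G: "\<And>x. (G has_real_derivative (f x)\<^sup>2) (at x)" and "p \<le> q"
  shows "G q - G p \<le> (l2norm f)\<^sup>2"
proof -
  have [measurable]: "f \<in> borel_measurable borel" using f by (rule sq_integrableD)
  have "ennreal (G q - G p) = (\<integral>\<^sup>+x. ennreal ((f x)\<^sup>2) * indicator {p..q} x \<partial>lborel)"
    using G \<open>p \<le> q\<close> by (intro nn_integral_FTC_Icc[symmetric]) auto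
  also have "\<dots> \<le> (\<integral>\<^sup>+x. ennreal ((f x)\<^sup>2) \<partial>lborel)"
    by (intro nn_integral_mono) (auto simp: indicator_def)
  also have "\<dots> \<le> ennreal ((l2norm f)\<^sup>2)"
    using sq_integrable_nn[of f "l2norm f"] f sq_integrableD(1)[OF f] by auto
  finally show ?thesis by (simp add: ennreal_le_iff)
qed

lemma sq_integrable_dominated:
  assumes c: "continuous_on UNIV f" and F: "sq_integrable F" and B: "0 \<le> B"
    and le: "\<And>x. \<bar>f x\<bar> \<le> B * \<bar>F x\<bar>"
  shows "sq_integrable f" "l2norm f \<le> B * l2norm F"
proof -
  have [measurable]: "f \<in> borel_measurable borel" "F \<in> borel_measurable borel"
    using c F by (auto intro: continuous_on_UNIV_measurable sq_integrableD)
  have "(\<integral>\<^sup>+x. ennreal ((f x)\<^sup>2) \<partial>lborel) \<le> (\<integral>\<^sup>+x. ennreal (B\<^sup>2) * ennreal ((F x)\<^sup>2) \<partial>lborel)"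
  proof (intro nn_integral_mono)
    fix x
    have "(f x)\<^sup>2 \<le> (B * \<bar>F x\<bar>)\<^sup>2" using le[of x] abs_le_square_iff B by fastforce
    then show "ennreal ((f x)\<^sup>2) \<le> ennreal (B\<^sup>2) * ennreal ((F x)\<^sup>2)"
      by (simp add: ennreal_mult'[symmetric] power_mult_distrib ennreal_leI)
  qed
  also have "\<dots> = ennreal (B\<^sup>2) * (\<integral>\<^sup>+x. ennreal ((F x)\<^sup>2) \<partial>lborel)"
    by (intro nn_integral_cmult) auto
  also have "\<dots> \<le> ennreal (B\<^sup>2) * ennreal ((l2norm F)\<^sup>2)"
    using sq_integrable_nn[of F "l2norm F"] F sq_integrableD(1)[OF F] by (intro mult_left_mono) auto
  also have "\<dots> = ennreal ((B * l2norm F)\<^sup>2)" by (simp add: ennreal_mult'[symmetric] power_mult_distrib)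
  finally show "sq_integrable f" "l2norm f \<le> B * l2norm F"
    using sq_integrable_nn[OF c, of "B * l2norm F"] B by auto
qed

lemma sq_integrable_mult_integrable:
  assumes f: "sq_integrable f" and g: "sq_integrable g"
  shows "integrable lborel (\<lambda>x. f x * g x)"
proof (rule Bochner_Integration.integrable_bound)
  show "integrable lborel (\<lambda>x. (f x)\<^sup>2 + (g x)\<^sup>2)" using f g by (auto simp: sq_integrable_def)
  have [measurable]: "f \<in> borel_measurable borel" "g \<in> borel_measurable borel"
    using f g by (auto intro: sq_integrableD)
  show "(\<lambda>x. f x * g x) \<in> borel_measurable lborel" by measurable
  show "AE x in lborel. norm (f x * g x) \<le> norm ((f x)\<^sup>2 + (g x)\<^sup>2)"
  proof (rule AE_I2)
    fix x
    have "2 * (\<bar>f x\<bar> * \<bar>g x\<bar>) \<le> (f x)\<^sup>2 + (g x)\<^sup>2"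
      using zero_le_power2[of "\<bar>f x\<bar> - \<bar>g x\<bar>"] by (simp add: power2_diff)
    moreover have "0 \<le> \<bar>f x\<bar> * \<bar>g x\<bar>" by simp
    ultimately show "norm (f x * g x) \<le> norm ((f x)\<^sup>2 + (g x)\<^sup>2)"
      unfolding real_norm_def abs_mult by linarith
  qed
qed

lemma l2norm_Cauchy_Schwarz:
  assumes f: "sq_integrable f" and g: "sq_integrable g"
  shows "(LINT x|lborel. \<bar>f x * g x\<bar>) \<le> l2norm f * l2norm g"
    and "\<bar>LINT x|lborel. f x * g x\<bar> \<le> l2norm f * l2norm g"
proof -
  have [measurable]: "f \<in> borel_measurable borel" "g \<in> borel_measurable borel"
    using f g by (auto intro: sq_integrableD)
  have i: "integrable lborel (\<lambda>x. \<bar>f x * g x\<bar>)"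
    using sq_integrable_mult_integrable[OF f g] by auto
  have nf: "(\<integral>\<^sup>+x. ennreal ((f x)\<^sup>2) \<partial>lborel) = ennreal ((l2norm f)\<^sup>2)"
    using f by (subst nn_integral_eq_integral) (auto simp: sq_integrable_def l2norm_sq)
  have ng: "(\<integral>\<^sup>+x. ennreal ((g x)\<^sup>2) \<partial>lborel) = ennreal ((l2norm g)\<^sup>2)"
    using g by (subst nn_integral_eq_integral) (auto simp: sq_integrable_def l2norm_sq)
  have "(\<integral>\<^sup>+x. ennreal \<bar>f x\<bar> * ennreal \<bar>g x\<bar> \<partial>lborel)\<^sup>2
      \<le> (\<integral>\<^sup>+x. (ennreal \<bar>f x\<bar>)\<^sup>2 \<partial>lborel) * (\<integral>\<^sup>+x. (ennreal \<bar>g x\<bar>)\<^sup>2 \<partial>lborel)"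
    by (intro Cauchy_Schwarz_nn_integral) auto
  also have "\<dots> = ennreal ((l2norm f * l2norm g)\<^sup>2)"
    by (simp add: ennreal_power nf ng ennreal_mult'[symmetric] power_mult_distrib)
  also have "(\<integral>\<^sup>+x. ennreal \<bar>f x\<bar> * ennreal \<bar>g x\<bar> \<partial>lborel) = (\<integral>\<^sup>+x. ennreal \<bar>f x * g x\<bar> \<partial>lborel)"
    by (intro nn_integral_cong) (simp add: ennreal_mult'[symmetric] abs_mult)
  also have "\<dots> = ennreal (LINT x|lborel. \<bar>f x * g x\<bar>)"
    using i by (intro nn_integral_eq_integral) auto
  finally have "(LINT x|lborel. \<bar>f x * g x\<bar>)\<^sup>2 \<le> (l2norm f * l2norm g)\<^sup>2"
    by (simp add: ennreal_power ennreal_le_iff)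
  then show *: "(LINT x|lborel. \<bar>f x * g x\<bar>) \<le> l2norm f * l2norm g"
    by (rule power2_le_imp_le) simp
  have "\<bar>LINT x|lborel. f x * g x\<bar> \<le> (LINT x|lborel. \<bar>f x * g x\<bar>)" by (rule integral_abs_bound)
  with * show "\<bar>LINT x|lborel. f x * g x\<bar> \<le> l2norm f * l2norm g" by linarith
qed

lemma sq_integrable_add:
  assumes f: "sq_integrable f" and g: "sq_integrable g"
  shows "sq_integrable (\<lambda>x. f x + g x)" "l2norm (\<lambda>x. f x + g x) \<le> l2norm f + l2norm g"
proof -
  have i: "integrable lborel (\<lambda>x. (f x)\<^sup>2)" "integrable lborel (\<lambda>x. (g x)\<^sup>2)"
    "integrable lborel (\<lambda>x. f x * g x)"
    using f g sq_integrable_mult_integrable by (auto simp: sq_integrable_def)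
  have eq: "(f x + g x)\<^sup>2 = (f x)\<^sup>2 + 2 * (f x * g x) + (g x)\<^sup>2" for x
    by (simp add: power2_sum)
  show "sq_integrable (\<lambda>x. f x + g x)" unfolding sq_integrable_def eq
    using f g i by (auto intro!: continuous_intros simp: sq_integrable_def)
  have "(l2norm (\<lambda>x. f x + g x))\<^sup>2 = (l2norm f)\<^sup>2 + 2 * (LINT x|lborel. f x * g x) + (l2norm g)\<^sup>2"
    unfolding l2norm_sq eq using i by simp
  also have "\<dots> \<le> (l2norm f)\<^sup>2 + 2 * (l2norm f * l2norm g) + (l2norm g)\<^sup>2"
    using l2norm_Cauchy_Schwarz(2)[OF f g] by linarith
  also have "\<dots> = (l2norm f + l2norm g)\<^sup>2" by (simp add: power2_sum)
  finally show "l2norm (\<lambda>x. f x + g x) \<le> l2norm f + l2norm g"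
    by (rule power2_le_imp_le) simp
qed

lemma sq_integrable_cmult:
  assumes f: "sq_integrable f"
  shows "sq_integrable (\<lambda>x. r * f x)" "l2norm (\<lambda>x. r * f x) = \<bar>r\<bar> * l2norm f"
  using f by (auto simp: sq_integrable_def l2norm_def power_mult_distrib real_sqrt_mult intro!: continuous_intros)

lemma sq_integrable_diff:
  assumes f: "sq_integrable f" and g: "sq_integrable g"
  shows "sq_integrable (\<lambda>x. f x - g x)" "l2norm (\<lambda>x. f x - g x) \<le> l2norm f + l2norm g"
  using sq_integrable_add[OF f sq_integrable_cmult(1)[OF g, of "-1"]] sq_integrable_cmult(2)[OF g, of "-1"]
  by auto

lemma sq_integrable_mult_bounded:
  assumes c: "continuous_on UNIV b" and f: "sq_integrable f" and B: "\<And>x. \<bar>b x\<bar> \<le> B"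
  shows "sq_integrable (\<lambda>x. b x * f x)" "l2norm (\<lambda>x. b x * f x) \<le> B * l2norm f"
proof -
  have "0 \<le> B" using B[of 0] by linarith
  moreover have "continuous_on UNIV (\<lambda>x. b x * f x)"
    using c f by (auto intro!: continuous_intros simp: sq_integrable_def)
  moreover have "\<bar>b x * f x\<bar> \<le> B * \<bar>f x\<bar>" for x
    using B[of x] by (auto simp: abs_mult intro: mult_right_mono)
  ultimately show "sq_integrable (\<lambda>x. b x * f x)" "l2norm (\<lambda>x. b x * f x) \<le> B * l2norm f"
    using sq_integrable_dominated[OF _ f] by auto
qed

lemma sq_integrable_zero [simp]: "sq_integrable (\<lambda>x. 0)" "l2norm (\<lambda>x. 0) = 0"
  by (auto simp: sq_integrable_def l2norm_def)

lemma sq_integrable_affine: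
  assumes f: "sq_integrable f" and r: "\<bar>r\<bar> = 1"
  shows "sq_integrable (\<lambda>x. f (s + r * x))" "l2norm (\<lambda>x. f (s + r * x)) = l2norm f"
proof -
  have r0: "r \<noteq> 0" using r by auto
  have "continuous_on UNIV (\<lambda>x. f (s + r * x))"
    by (rule continuous_on_compose2[OF sq_integrableD(1)[OF f]]) (auto intro!: continuous_intros)
  then show "sq_integrable (\<lambda>x. f (s + r * x))"
    using lborel_integrable_real_affine[of "\<lambda>x. (f x)\<^sup>2" r s] r0 f by (simp add: sq_integrable_def)
  show "l2norm (\<lambda>x. f (s + r * x)) = l2norm f"
    unfolding l2norm_def using lborel_integral_real_affine[OF r0, of "\<lambda>x. (f x)\<^sup>2" s] r by simp
qed

lemma sq_integrable_shift:
  assumes f: "sq_integrable f"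
  shows "sq_integrable (\<lambda>x. f (x + s))" "l2norm (\<lambda>x. f (x + s)) = l2norm f"
    "sq_integrable (\<lambda>x. f (x - s))" "l2norm (\<lambda>x. f (x - s)) = l2norm f"
  using sq_integrable_affine[OF f, of 1 s] sq_integrable_affine[OF f, of 1 "-s"] by (auto simp: add.commute)

lemma sq_integrable_reflect:
  assumes f: "sq_integrable f"
  shows "sq_integrable (\<lambda>x. f (- x))" "l2norm (\<lambda>x. f (- x)) = l2norm f"
  using sq_integrable_affine[OF f, of "-1" 0] by auto

text \<open>The derivative of \<open>G - 2 m F + m\<^sup>2 x\<close> is \<open>(f - m)\<^sup>2\<close>; the choice of the mean value of \<open>f\<close> for
\<open>m\<close> gives the claim.\<close>
lemma interval_Cauchy_Schwarz:
  assumes F: "\<And>x. (F has_real_derivative f x) (at x)"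
    and G: "\<And>x. (G has_real_derivative (f x)\<^sup>2) (at x)" and pq: "p \<le> q"
  shows "(F q - F p)\<^sup>2 \<le> (q - p) * (G q - G p)"
proof (cases "p = q")
  case False
  with pq have pq: "p < q" by simp
  define m where "m = (F q - F p) / (q - p)"
  define H where "H x = G x - 2 * m * F x + m\<^sup>2 * x" for x
  have "(H has_real_derivative (f x - m)\<^sup>2) (at x)" for x
    unfolding H_def by (rule derivative_eq_intros F G refl)+ (simp add: power2_diff)
  then have "H p \<le> H q" using pq
    by (intro DERIV_nonneg_imp_nondecreasing[of p q H]) (auto intro: zero_le_power2)
  then have "2 * m * (F q - F p) - m\<^sup>2 * (q - p) \<le> G q - G p"
    by (simp add: H_def algebra_simps)
  moreover have "2 * m * (F q - F p) - m\<^sup>2 * (q - p) = (F q - F p)\<^sup>2 / (q - p)"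
  proof -
    have "2 * (D / e) * D - (D / e)\<^sup>2 * e = D\<^sup>2 / e" if "e > 0" for D e :: real
      using that by (simp add: power2_eq_square)
    then show ?thesis using pq unfolding m_def by (metis diff_gt_0_iff_gt)
  qed
  ultimately show ?thesis using pq by (simp add: divide_le_eq mult.commute)
qed simp

lemma antideriv_sq_increment_le:
  assumes f: "sq_integrable f" and F: "\<And>x. (F has_real_derivative f x) (at x)"
  shows "\<bar>F q - F p\<bar> \<le> sqrt \<bar>q - p\<bar> * l2norm f"
proof -
  define G where "G = antideriv (\<lambda>x. (f x)\<^sup>2)"
  have G: "(G has_real_derivative (f x)\<^sup>2) (at x)" for x
    unfolding G_def using sq_integrableD(1)[OF f] by (intro antideriv_deriv continuous_intros) auto
  have "\<bar>F b - F a\<bar> \<le> sqrt \<bar>b - a\<bar> * l2norm f" if "a \<le> b" for a b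
  proof -
    have "(F b - F a)\<^sup>2 \<le> (b - a) * (G b - G a)"
      by (rule interval_Cauchy_Schwarz[OF F G that])
    also have "\<dots> \<le> (b - a) * (l2norm f)\<^sup>2"
      using that by (intro mult_left_mono sq_integrable_interval_le[OF f G]) auto
    also have "\<dots> = (sqrt \<bar>b - a\<bar> * l2norm f)\<^sup>2" using that by (simp add: power_mult_distrib)
    finally show ?thesis by (simp add: abs_le_square_iff[symmetric])
  qed
  from this[of p q] this[of q p] show ?thesis by (cases "p \<le> q") (auto simp: abs_minus_commute)
qed

text \<open>Minkowski's integral inequality for a parameter in a bounded interval: the Cauchy--Schwarz inequality
in \<open>s\<close>, then Tonelli. It turns Taylor remainders in integral form into \<open>L\<^sup>2\<close> bounds.\<close>
lemma l2norm_integral_le: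
  assumes f: "continuous_on UNIV (\<lambda>z. f (fst z) (snd z))"
    and \<Phi>: "\<And>x s. (\<Phi> x has_real_derivative f x s) (at s)"
    and c: "continuous_on UNIV (\<lambda>x. \<Phi> x y - \<Phi> x 0)"
    and y: "0 \<le> y" and B: "0 \<le> B"
    and sq: "\<And>s. 0 \<le> s \<Longrightarrow> s \<le> y \<Longrightarrow> sq_integrable (\<lambda>x. f x s)"
    and le: "\<And>s. 0 \<le> s \<Longrightarrow> s \<le> y \<Longrightarrow> l2norm (\<lambda>x. f x s) \<le> B"
  shows "sq_integrable (\<lambda>x. \<Phi> x y - \<Phi> x 0)" "l2norm (\<lambda>x. \<Phi> x y - \<Phi> x 0) \<le> y * B"
proof -
  have fm[measurable]: "(\<lambda>z. f (fst z) (snd z)) \<in> borel_measurable (borel \<Otimes>\<^sub>M borel)"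
    unfolding borel_prod using f by (intro borel_measurable_continuous_onI)
  have cs: "continuous_on UNIV (f x)" for x
  proof -
    have "continuous_on UNIV (\<lambda>s. f (fst (x, s)) (snd (x, s)))"
      by (rule continuous_on_compose2[OF f]) (auto intro: continuous_on_Pair continuous_on_const continuous_on_id)
    then show ?thesis by simp
  qed
  define \<Gamma> where "\<Gamma> x = antideriv (\<lambda>s. (f x s)\<^sup>2)" for x
  have \<Gamma>: "(\<Gamma> x has_real_derivative (f x s)\<^sup>2) (at s)" for x s
    unfolding \<Gamma>_def using cs by (intro antideriv_deriv continuous_intros)
  have [measurable]: "f x \<in> borel_measurable borel" for x using cs by (rule continuous_on_UNIV_measurable)
  have pt: "ennreal ((\<Phi> x y - \<Phi> x 0)\<^sup>2) \<le> ennreal y * (\<integral>\<^sup>+s. ennreal ((f x s)\<^sup>2) * indicator {0..y} s \<partial>lborel)" for x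
  proof -
    have "(\<Phi> x y - \<Phi> x 0)\<^sup>2 \<le> y * (\<Gamma> x y - \<Gamma> x 0)"
      using interval_Cauchy_Schwarz[OF \<Phi> \<Gamma> y] by simp
    then have "ennreal ((\<Phi> x y - \<Phi> x 0)\<^sup>2) \<le> ennreal y * ennreal (\<Gamma> x y - \<Gamma> x 0)"
      using y by (simp add: ennreal_mult'[symmetric] ennreal_leI)
    also have "ennreal (\<Gamma> x y - \<Gamma> x 0) = (\<integral>\<^sup>+s. ennreal ((f x s)\<^sup>2) * indicator {0..y} s \<partial>lborel)"
      using y by (intro nn_integral_FTC_Icc[symmetric]) (auto intro: \<Gamma>)
    finally show ?thesis .
  qed
  have "(\<integral>\<^sup>+x. ennreal ((\<Phi> x y - \<Phi> x 0)\<^sup>2) \<partial>lborel)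
     \<le> (\<integral>\<^sup>+x. ennreal y * (\<integral>\<^sup>+s. ennreal ((f x s)\<^sup>2) * indicator {0..y} s \<partial>lborel) \<partial>lborel)"
    by (intro nn_integral_mono pt)
  also have "\<dots> = ennreal y * (\<integral>\<^sup>+x. (\<integral>\<^sup>+s. ennreal ((f x s)\<^sup>2) * indicator {0..y} s \<partial>lborel) \<partial>lborel)"
    by (intro nn_integral_cmult) measurable
  also have "(\<integral>\<^sup>+x. (\<integral>\<^sup>+s. ennreal ((f x s)\<^sup>2) * indicator {0..y} s \<partial>lborel) \<partial>lborel)
     = (\<integral>\<^sup>+s. (\<integral>\<^sup>+x. ennreal ((f x s)\<^sup>2) * indicator {0..y} s \<partial>lborel) \<partial>lborel)"
    by (rule lborel_pair.Fubini'[symmetric]) (simp add: case_prod_unfold; measurable)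
  also have "\<dots> \<le> (\<integral>\<^sup>+s. ennreal (B\<^sup>2) * indicator {0..y} s \<partial>lborel)"
  proof (rule nn_integral_mono)
    fix s
    show "(\<integral>\<^sup>+x. ennreal ((f x s)\<^sup>2) * indicator {0..y} s \<partial>lborel) \<le> ennreal (B\<^sup>2) * indicator {0..y} s"
    proof (cases "s \<in> {0..y}")
      case True
      then show ?thesis using sq_integrable_nn[of "\<lambda>x. f x s" B] sq[of s] le[of s] B
        by (auto dest: sq_integrableD(1))
    qed simp
  qed
  also have "\<dots> = ennreal (B\<^sup>2) * ennreal y" using y by (subst nn_integral_cmult_indicator) auto
  also have "ennreal y * (ennreal (B\<^sup>2) * ennreal y) = ennreal ((y * B)\<^sup>2)"
    using y by (simp add: ennreal_mult'[symmetric] power2_eq_square mult_ac)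
  finally have "(\<integral>\<^sup>+x. ennreal ((\<Phi> x y - \<Phi> x 0)\<^sup>2) \<partial>lborel) \<le> ennreal ((y * B)\<^sup>2)"
    by (simp add: mult_left_mono)
  then show "sq_integrable (\<lambda>x. \<Phi> x y - \<Phi> x 0)" "l2norm (\<lambda>x. \<Phi> x y - \<Phi> x 0) \<le> y * B"
    using sq_integrable_nn[OF c, of "y * B"] y B by auto
qed

lemma sq_integrable_small_far:
  assumes f: "sq_integrable f" and e: "0 < e"
  shows "\<exists>z>X. (f z)\<^sup>2 < e"
proof (rule ccontr)
  assume "\<not> ?thesis"
  then have ge: "e \<le> (f z)\<^sup>2" if "z > X" for z using that by force
  define G where "G = antideriv (\<lambda>x. (f x)\<^sup>2)"
  have G: "(G has_real_derivative (f x)\<^sup>2) (at x)" for x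
    unfolding G_def using sq_integrableD(1)[OF f] by (intro antideriv_deriv continuous_intros) auto
  have "G (X + 1 + r) - G (X + 1) \<ge> e * r" if "r \<ge> 0" for r
  proof -
    have "G (X + 1) - e * (X + 1) \<le> G (X + 1 + r) - e * (X + 1 + r)" using that
    proof (intro DERIV_nonneg_imp_nondecreasing[of "X + 1" "X + 1 + r" "\<lambda>x. G x - e * x"])
      fix x assume "X + 1 \<le> x"
      have "((\<lambda>x. G x - e * x) has_real_derivative (f x)\<^sup>2 - e) (at x)"
        by (rule derivative_eq_intros G refl)+ simp
      then show "\<exists>y. ((\<lambda>x. G x - e * x) has_real_derivative y) (at x) \<and> 0 \<le> y"
        using ge[of x] \<open>X + 1 \<le> x\<close> by (intro exI[of _ "(f x)\<^sup>2 - e"]) auto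
    qed auto
    then show ?thesis by (simp add: algebra_simps)
  qed
  from this[of "((l2norm f)\<^sup>2 + 1) / e"] sq_integrable_interval_le[OF f G, of "X+1" "X + 1 + ((l2norm f)\<^sup>2 + 1) / e"] e
  show False by simp
qed

text \<open>The square of \<open>u\<close> varies between two points by at most the integral of \<open>2 |u u'|\<close>, and it takes
arbitrarily small values arbitrarily far to the right.\<close>
lemma sq_integrable_tendsto_0_at_top:
  assumes u: "sq_integrable u" and u': "sq_integrable u'"
    and d: "\<And>x. (u has_real_derivative u' x) (at x)"
  shows "(u \<longlongrightarrow> 0) at_top" and "\<And>x. (u x)\<^sup>2 \<le> 2 * l2norm u * l2norm u'"
proof -
  have [measurable]: "u \<in> borel_measurable borel" "u' \<in> borel_measurable borel"
    using u u' by (auto intro: sq_integrableD)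
  define h where "h x = 2 * \<bar>u x * u' x\<bar>" for x
  have h0: "0 \<le> h x" for x by (simp add: h_def)
  have hc: "continuous_on UNIV h"
    unfolding h_def by (intro continuous_intros sq_integrableD(1)[OF u] sq_integrableD(1)[OF u'])
  have hm[measurable]: "h \<in> borel_measurable borel" using hc by (rule continuous_on_UNIV_measurable)
  have hi: "integrable lborel h"
    unfolding h_def using sq_integrable_mult_integrable[OF u u'] by auto
  have hint: "(LINT x|lborel. h x) \<le> 2 * l2norm u * l2norm u'"
    unfolding h_def using l2norm_Cauchy_Schwarz(1)[OF u u'] by simp
  define H where "H = antideriv h"
  have H: "(H has_real_derivative h x) (at x)" for x
    unfolding H_def using hc by (rule antideriv_deriv)
  have Hle: "H q - H p \<le> 2 * l2norm u * l2norm u'" if "p \<le> q" for p q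
  proof -
    have "(LINT x|lborel. h x * indicator {p..q} x) = H q - H p"
      using integral_FTC_Icc_nonneg[OF hm H h0 that] .
    moreover have "(LINT x|lborel. h x * indicator {p..q} x) \<le> (LINT x|lborel. h x)"
      by (intro integral_mono hi integrable_FTC_Icc_nonneg[OF hm H h0 that]) (auto simp: h0 indicator_def)
    ultimately show ?thesis using hint by linarith
  qed
  have Hmono: "H p \<le> H q" if "p \<le> q" for p q
    using that by (intro DERIV_nonneg_imp_nondecreasing[of p q H]) (use H h0 in blast)+
  have diff: "(u p)\<^sup>2 \<le> (u q)\<^sup>2 + (H q - H p)" if "p \<le> q" for p q
  proof -
    have "(u p)\<^sup>2 + H p \<le> (u q)\<^sup>2 + H q" using that
    proof (intro DERIV_nonneg_imp_nondecreasing[of p q "\<lambda>x. (u x)\<^sup>2 + H x"])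
      fix x
      have "((\<lambda>x. (u x)\<^sup>2 + H x) has_real_derivative 2 * (u x * u' x) + h x) (at x)"
        by (rule derivative_eq_intros d H refl)+ simp
      moreover have "0 \<le> 2 * (u x * u' x) + h x" unfolding h_def by linarith
      ultimately show "\<exists>y. ((\<lambda>x. (u x)\<^sup>2 + H x) has_real_derivative y) (at x) \<and> 0 \<le> y" by blast
    qed auto
    then show ?thesis by linarith
  qed
  show "(u x)\<^sup>2 \<le> 2 * l2norm u * l2norm u'" for x
  proof (rule field_le_epsilon)
    fix e :: real assume "0 < e"
    then obtain z where "z > x" "(u z)\<^sup>2 < e" using sq_integrable_small_far[OF u] by blast
    then show "(u x)\<^sup>2 \<le> 2 * l2norm u * l2norm u' + e"
      using diff[of x z] Hle[of x z] by linarith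
  qed
  show "(u \<longlongrightarrow> 0) at_top"
  proof -
    have "bdd_above (range H)"
    proof (rule bdd_aboveI2)
      fix x show "H x \<le> 2 * l2norm u * l2norm u' + \<bar>H 0\<bar>"
      proof -
        have "0 \<le> 2 * l2norm u * l2norm u'" by simp
        then show ?thesis using Hle[of 0 x] Hmono[of x 0] by (cases "0 \<le> x") linarith+
      qed
    qed
    have sq0: "((\<lambda>x. (u x)\<^sup>2) \<longlongrightarrow> 0) at_top"
    proof (rule order_tendstoI)
      fix e :: real assume e: "0 < e"
      obtain X where X: "Sup (range H) - e / 2 < H X"
        using less_cSup_iff[of "range H" "Sup (range H) - e/2"] e \<open>bdd_above (range H)\<close> by auto
      have "(u x)\<^sup>2 < e" if "x \<ge> X" for x
      proof -
        obtain z where z: "z > x" "(u z)\<^sup>2 < e/2" using sq_integrable_small_far[OF u, of "e/2"] e by auto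
        have "H z \<le> Sup (range H)" using \<open>bdd_above (range H)\<close> by (intro cSup_upper) auto
        then show ?thesis using diff[of x z] z Hmono[OF that] X by linarith
      qed
      then show "\<forall>\<^sub>F x in at_top. (u x)\<^sup>2 < e" by (auto simp: eventually_at_top_linorder)
    next
      fix e :: real assume e: "e < 0"
      have "e < (u x)\<^sup>2" for x using e zero_le_power2[of "u x"] by linarith
      then show "\<forall>\<^sub>F x in at_top. e < (u x)\<^sup>2" by simp
    qed
    have "((\<lambda>x. sqrt ((u x)\<^sup>2)) \<longlongrightarrow> sqrt 0) at_top" by (intro tendsto_real_sqrt sq0)
    then show ?thesis by (simp add: tendsto_rabs_zero_iff)
  qed
qed

lemma sq_integrable_H1_sup:
  assumes u: "sq_integrable u" and u': "sq_integrable u'"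
    and d: "\<And>x. (u has_real_derivative u' x) (at x)"
  shows "\<bar>u x\<bar> \<le> l2norm u + l2norm u'"
proof -
  have "(u x)\<^sup>2 \<le> 2 * l2norm u * l2norm u'" by (rule sq_integrable_tendsto_0_at_top(2)[OF u u' d])
  also have "\<dots> \<le> (l2norm u + l2norm u')\<^sup>2" by (simp add: power2_sum)
  finally show ?thesis by (metis abs_le_square_iff abs_of_nonneg add_nonneg_nonneg l2norm_nonneg)
qed

lemma sq_integrable_tendsto_0_at_bot:
  assumes u: "sq_integrable u" and u': "sq_integrable u'"
    and d: "\<And>x. (u has_real_derivative u' x) (at x)"
  shows "(u \<longlongrightarrow> 0) at_bot"
proof -
  have "((\<lambda>x. u (- x)) has_real_derivative - u' (- x)) (at x)" for x
    using DERIV_chain2[OF d DERIV_minus[OF DERIV_ident]] by simp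
  then have "((\<lambda>x. u (- x)) \<longlongrightarrow> 0) at_top"
    using sq_integrable_tendsto_0_at_top(1)[of "\<lambda>x. u (- x)" "\<lambda>x. - u' (- x)"]
      sq_integrable_reflect(1)[OF u] sq_integrable_cmult(1)[OF sq_integrable_reflect(1)[OF u'], of "-1"] by auto
  then show ?thesis by (simp add: filterlim_at_bot_mirror)
qed

lemma integral_by_parts_sq_integrable:
  assumes u: "sq_integrable u" and u': "sq_integrable u'"
    and v: "sq_integrable v" and v': "sq_integrable v'"
    and du: "\<And>x. (u has_real_derivative u' x) (at x)" and dv: "\<And>x. (v has_real_derivative v' x) (at x)"
  shows "(LINT x|lborel. u' x * v x) + (LINT x|lborel. u x * v' x) = 0"
proof -
  define w where "w x = u' x * v x + u x * v' x" for x
  have iw: "integrable lborel w" unfolding w_def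
    using sq_integrable_mult_integrable[OF u' v] sq_integrable_mult_integrable[OF u v'] by auto
  have wc: "isCont w x" for x
    unfolding w_def using u u' v v' by (intro continuous_intros sq_integrableD)
  have dw: "((\<lambda>x. u x * v x) has_vector_derivative w x) (at x)" for x
    unfolding w_def has_real_derivative_iff_has_vector_derivative[symmetric]
    by (rule derivative_eq_intros du dv refl)+ simp
  have "(LBINT x=-\<infinity>..\<infinity>. w x) = 0 - 0"
  proof (rule interval_integral_FTC_integrable[where F="\<lambda>x. u x * v x"])
    show "set_integrable lborel (einterval (-\<infinity>) \<infinity>) w"
      using iw by (simp add: set_integrable_def)
    have "((\<lambda>x. u x * v x) \<longlongrightarrow> 0 * 0) at_bot"
      by (intro tendsto_mult sq_integrable_tendsto_0_at_bot[OF u u' du] sq_integrable_tendsto_0_at_bot[OF v v' dv])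
    then show "(((\<lambda>x. u x * v x) \<circ> real_of_ereal) \<longlongrightarrow> 0) (at_right (-\<infinity>))"
      by (simp add: at_right_MInf filterlim_filtermap o_def ereal_tendsto_simps)
    have "((\<lambda>x. u x * v x) \<longlongrightarrow> 0 * 0) at_top"
      by (intro tendsto_mult sq_integrable_tendsto_0_at_top(1)[OF u u' du] sq_integrable_tendsto_0_at_top(1)[OF v v' dv])
    then show "(((\<lambda>x. u x * v x) \<circ> real_of_ereal) \<longlongrightarrow> 0) (at_left \<infinity>)"
      by (simp add: at_left_PInf filterlim_filtermap o_def ereal_tendsto_simps)
  qed (use dw wc in auto)
  then have "(LINT x|lborel. w x) = 0"
    by (simp add: interval_lebesgue_integral_def set_lebesgue_integral_def)
  then show ?thesis unfolding w_def
    using sq_integrable_mult_integrable[OF u' v] sq_integrable_mult_integrable[OF u v'] by simp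
qed

section \<open>First order equations on the line\<close>

text \<open>The derivative of \<open>S - \<delta> z\<^sup>2 - \<delta>\<^sup>2 Z\<close> is \<open>(f - \<delta> z)\<^sup>2 + 2 \<delta> (b - \<delta>) z\<^sup>2\<close>.\<close>
lemma linear_ode_energy:
  fixes z :: "real \<Rightarrow> real"
  assumes "p \<le> q" and \<delta>: "0 < \<delta>" and z0: "z p = 0"
    and z: "\<And>x. p \<le> x \<Longrightarrow> x \<le> q \<Longrightarrow> (z has_real_derivative - b x * z x + f x) (at x)"
    and b: "\<And>x. p \<le> x \<Longrightarrow> x \<le> q \<Longrightarrow> \<delta> \<le> b x"
    and Z: "\<And>x. (Z has_real_derivative (z x)\<^sup>2) (at x)"
    and S: "\<And>x. (S has_real_derivative (f x)\<^sup>2) (at x)"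
  shows "\<delta> * (z q)\<^sup>2 + \<delta>\<^sup>2 * (Z q - Z p) \<le> S q - S p"
proof -
  define H where "H x = S x - \<delta> * (z x)\<^sup>2 - \<delta>\<^sup>2 * Z x" for x
  have "H p \<le> H q" using \<open>p \<le> q\<close>
  proof (rule DERIV_nonneg_imp_nondecreasing)
    fix x assume x: "p \<le> x" "x \<le> q"
    define d where "d = (f x)\<^sup>2 - \<delta> * (2 * (z x * (- b x * z x + f x))) - \<delta>\<^sup>2 * (z x)\<^sup>2"
    have "(H has_real_derivative d) (at x)"
      unfolding H_def d_def by (rule derivative_eq_intros z[OF x] Z S refl)+ simp
    moreover have "0 \<le> d"
    proof -
      have "0 \<le> (f x - \<delta> * z x)\<^sup>2 + 2 * \<delta> * ((b x - \<delta>) * (z x)\<^sup>2)"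
        using \<delta> b[OF x] by (intro add_nonneg_nonneg mult_nonneg_nonneg) auto
      also have "\<dots> = d" unfolding d_def by (simp add: power2_eq_square algebra_simps)
      finally show ?thesis .
    qed
    ultimately show "\<exists>y. (H has_real_derivative y) (at x) \<and> 0 \<le> y" by blast
  qed
  then show ?thesis by (simp add: H_def z0 algebra_simps)
qed

text \<open>The solution that starts at \<open>-\<infinity>\<close>, as the limit of the solutions that vanish at \<open>-n\<close>. Their
differences are multiples of \<open>1/E\<close>, so the uniform bound \<open>K\<close> and the decay of \<open>E\<close> at
\<open>-\<infinity>\<close> make them a Cauchy sequence at every point.\<close>
lemma linear_ode_line:
  fixes b f :: "real \<Rightarrow> real"
  defines "E \<equiv> \<lambda>x. exp (antideriv b x)"
  defines "\<Phi> \<equiv> antideriv (\<lambda>x. E x * f x)"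
  assumes b: "continuous_on UNIV b" and f: "continuous_on UNIV f"
    and \<delta>: "0 < \<delta>" "\<And>x. \<delta> \<le> b x"
    and K: "\<And>p x. p \<le> x \<Longrightarrow> \<bar>\<Phi> x - \<Phi> p\<bar> \<le> K * E x"
  obtains y where "\<And>x. (y has_real_derivative - b x * y x + f x) (at x)"
    "\<And>x. \<bar>y x\<bar> \<le> K" "\<And>x. (\<lambda>n. (\<Phi> x - \<Phi> (- real n)) / E x) \<longlonglongrightarrow> y x"
proof -
  have E: "(E has_real_derivative E x * b x) (at x)" for x
    unfolding E_def by (rule derivative_eq_intros antideriv_deriv[OF b] refl)+
  have Epos: "0 < E x" for x by (simp add: E_def)
  have \<Phi>: "(\<Phi> has_real_derivative E x * f x) (at x)" for x
    unfolding \<Phi>_def using has_real_derivative_continuous_on[OF E] f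
    by (intro antideriv_deriv continuous_intros)
  have K0: "0 \<le> K"
  proof -
    have "0 \<le> K * E 0" using K[of 0 0] by simp
    then show ?thesis using Epos[of 0] by (simp add: zero_le_mult_iff)
  qed
  have Ele: "E (- r) \<le> exp (- \<delta> * r)" if "0 \<le> r" for r
  proof -
    have "antideriv b (-r) - \<delta> * (-r) \<le> antideriv b 0 - \<delta> * 0"
    proof (rule DERIV_nonneg_imp_nondecreasing[of "-r" 0 "\<lambda>x. antideriv b x - \<delta> * x"])
      fix x
      have "((\<lambda>x. antideriv b x - \<delta> * x) has_real_derivative b x - \<delta>) (at x)"
        by (rule derivative_eq_intros antideriv_deriv[OF b] refl)+ simp
      then show "\<exists>y. ((\<lambda>x. antideriv b x - \<delta> * x) has_real_derivative y) (at x) \<and> 0 \<le> y"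
        using \<delta>(2)[of x] by (intro exI[of _ "b x - \<delta>"]) auto
    qed (use that in auto)
    then show ?thesis by (simp add: E_def)
  qed
  have "Cauchy (\<lambda>n. \<Phi> (- real n))"
  proof (rule CauchyI')
    fix e :: real assume e: "0 < e"
    have "(\<lambda>n. K * exp (- \<delta> * real n)) \<longlonglongrightarrow> K * 0"
    proof (intro tendsto_intros)
      have "(\<lambda>n. exp (- \<delta>) ^ n) \<longlonglongrightarrow> 0" using \<delta>(1) by (intro LIMSEQ_realpow_zero) auto
      then show "(\<lambda>n. exp (- \<delta> * real n)) \<longlonglongrightarrow> 0" by (simp add: exp_of_nat_mult[symmetric] mult.commute)
    qed
    then have "\<forall>\<^sub>F n in sequentially. K * exp (- \<delta> * real n) < e" using e by (auto dest: order_tendstoD(2))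
    then obtain M where M: "\<And>n. n \<ge> M \<Longrightarrow> K * exp (- \<delta> * real n) < e"
      by (auto simp: eventually_sequentially)
    show "\<exists>M. \<forall>m\<ge>M. \<forall>n>m. dist (\<Phi> (- real m)) (\<Phi> (- real n)) < e"
    proof (intro exI allI impI)
      fix m n assume mn: "M \<le> m" "m < n"
      have "dist (\<Phi> (- real m)) (\<Phi> (- real n)) \<le> K * E (- real m)"
        using K[of "- real n" "- real m"] mn by (simp add: dist_real_def)
      also have "\<dots> \<le> K * exp (- \<delta> * real m)" using Ele[of "real m"] K0 by (intro mult_left_mono) auto
      also have "\<dots> < e" using M mn by simp
      finally show "dist (\<Phi> (- real m)) (\<Phi> (- real n)) < e" .
    qed
  qed
  then obtain l where l: "(\<lambda>n. \<Phi> (- real n)) \<longlonglongrightarrow> l" by (auto simp: Cauchy_convergent_iff convergent_def)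
  define y where "y x = (\<Phi> x - l) / E x" for x
  have lim: "(\<lambda>n. (\<Phi> x - \<Phi> (- real n)) / E x) \<longlonglongrightarrow> y x" for x
    unfolding y_def using Epos[of x] by (intro tendsto_intros l) auto
  show thesis
  proof (rule that[OF _ _ lim])
    fix x
    show "(y has_real_derivative - b x * y x + f x) (at x)"
      unfolding y_def using Epos[of x]
      by (auto intro!: derivative_eq_intros E \<Phi> simp: field_simps power2_eq_square)
    show "\<bar>y x\<bar> \<le> K"
    proof (rule LIMSEQ_le_const2[OF tendsto_rabs[OF lim]], intro exI allI impI)
      fix n assume n: "n \<ge> nat \<lceil>\<bar>x\<bar>\<rceil>"
      then have "- real n \<le> x" by linarith
      then show "\<bar>(\<Phi> x - \<Phi> (- real n)) / E x\<bar> \<le> K"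
        using K Epos[of x] by (simp add: abs_divide divide_le_eq)
    qed
  qed
qed

lemma linear_ode_partial:
  fixes b f :: "real \<Rightarrow> real"
  defines "E \<equiv> \<lambda>x. exp (antideriv b x)"
  defines "\<Phi> \<equiv> antideriv (\<lambda>x. E x * f x)"
  assumes b: "continuous_on UNIV b" and f: "continuous_on UNIV f"
  shows "((\<lambda>x. (\<Phi> x - \<Phi> p) / E x) has_real_derivative - b x * ((\<Phi> x - \<Phi> p) / E x) + f x) (at x)"
    "((\<lambda>x. E x) has_real_derivative E x * b x) (at x)" "(\<Phi> has_real_derivative E x * f x) (at x)"
proof -
  show E: "((\<lambda>x. E x) has_real_derivative E x * b x) (at x)" for x
    unfolding E_def by (rule derivative_eq_intros antideriv_deriv[OF b] refl)+
  show \<Phi>: "(\<Phi> has_real_derivative E x * f x) (at x)" for x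
    unfolding \<Phi>_def using has_real_derivative_continuous_on[OF E] f
    by (intro antideriv_deriv continuous_intros)
  have "0 < E x" by (simp add: E_def)
  then show "((\<lambda>x. (\<Phi> x - \<Phi> p) / E x) has_real_derivative - b x * ((\<Phi> x - \<Phi> p) / E x) + f x) (at x)"
    by (auto intro!: derivative_eq_intros E \<Phi> simp: field_simps power2_eq_square)
qed

lemma linear_ode_L2:
  fixes b f :: "real \<Rightarrow> real"
  assumes b: "continuous_on UNIV b" and f: "sq_integrable f"
    and \<delta>: "0 < \<delta>" "\<And>x. \<delta> \<le> b x"
  obtains y where "\<And>x. (y has_real_derivative - b x * y x + f x) (at x)"
    "sq_integrable y" "l2norm y \<le> l2norm f / \<delta>"
proof -
  define E where "E = (\<lambda>x. exp (antideriv b x))"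
  define \<Phi> where "\<Phi> = antideriv (\<lambda>x. E x * f x)"
  define z where "z p x = (\<Phi> x - \<Phi> p) / E x" for p x
  note fc = sq_integrableD(1)[OF f]
  have z: "(z p has_real_derivative - b x * z p x + f x) (at x)" for p x
    unfolding z_def \<Phi>_def E_def by (rule linear_ode_partial(1)[OF b fc])
  have zc: "continuous_on UNIV (z p)" for p by (rule has_real_derivative_continuous_on[OF z])
  define Z where "Z p = antideriv (\<lambda>x. (z p x)\<^sup>2)" for p
  have Z: "(Z p has_real_derivative (z p x)\<^sup>2) (at x)" for p x
    unfolding Z_def by (intro antideriv_deriv continuous_intros zc)
  define S where "S = antideriv (\<lambda>x. (f x)\<^sup>2)"
  have S: "(S has_real_derivative (f x)\<^sup>2) (at x)" for x
    unfolding S_def by (intro antideriv_deriv continuous_intros fc)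
  have en: "\<delta> * (z p q)\<^sup>2 + \<delta>\<^sup>2 * (Z p q - Z p p) \<le> (l2norm f)\<^sup>2" if "p \<le> q" for p q
    using linear_ode_energy[of p q \<delta> "z p" b f "Z p" S] that \<delta> z Z S
      sq_integrable_interval_le[OF f S that] by (fastforce simp: z_def)
  have Zmono: "Z p p \<le> Z p q" if "p \<le> q" for p q
    using that by (intro DERIV_nonneg_imp_nondecreasing[of p q "Z p"]) (use Z zero_le_power2 in blast)+
  have K: "\<bar>\<Phi> x - \<Phi> p\<bar> \<le> (l2norm f / sqrt \<delta>) * E x" if "p \<le> x" for p x
  proof -
    have "\<delta> * (z p x)\<^sup>2 \<le> (l2norm f)\<^sup>2"
      using en[OF that] Zmono[OF that] \<delta>(1)
      by (smt (verit) mult_nonneg_nonneg zero_le_power2)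
    then have "(z p x)\<^sup>2 \<le> (l2norm f / sqrt \<delta>)\<^sup>2"
      using \<delta>(1) by (simp add: power_divide le_divide_eq mult.commute)
    moreover have "0 \<le> l2norm f / sqrt \<delta>" using \<delta>(1) by simp
    ultimately have "\<bar>z p x\<bar> \<le> l2norm f / sqrt \<delta>"
      by (metis abs_le_square_iff abs_of_nonneg)
    moreover have "0 < E x" by (simp add: E_def)
    ultimately show ?thesis by (simp add: z_def abs_divide divide_le_eq)
  qed
  obtain y where y: "\<And>x. (y has_real_derivative - b x * y x + f x) (at x)"
    and "\<And>x. \<bar>y x\<bar> \<le> l2norm f / sqrt \<delta>"
    and lim: "\<And>x. (\<lambda>n. (\<Phi> x - \<Phi> (- real n)) / E x) \<longlonglongrightarrow> y x"
    unfolding \<Phi>_def E_def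
  proof (rule linear_ode_line[OF b fc \<delta> K[unfolded \<Phi>_def E_def]], goal_cases)
    case (2 y)
    show thesis by (rule 2(1)) (rule 2(2-4))+
  qed
  define F where "F n x = z (- real n) x * indicator {- real n..real n} x" for n :: nat and x
  have yc: "continuous_on UNIV y" by (rule has_real_derivative_continuous_on[OF y])
  have [measurable]: "z p \<in> borel_measurable borel" for p by (rule continuous_on_UNIV_measurable[OF zc])
  have le: "(\<integral>\<^sup>+x. ennreal ((F n x)\<^sup>2) \<partial>lborel) \<le> ennreal ((l2norm f / \<delta>)\<^sup>2)" for n
  proof -
    have "(\<integral>\<^sup>+x. ennreal ((F n x)\<^sup>2) \<partial>lborel)
        = (\<integral>\<^sup>+x. ennreal ((z (- real n) x)\<^sup>2) * indicator {- real n..real n} x \<partial>lborel)"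
      by (intro nn_integral_cong) (auto simp: F_def indicator_def)
    also have "\<dots> = ennreal (Z (- real n) (real n) - Z (- real n) (- real n))"
      by (intro nn_integral_FTC_Icc) (auto intro: Z)
    also have "\<dots> \<le> ennreal ((l2norm f / \<delta>)\<^sup>2)"
    proof (intro ennreal_leI)
      have "\<delta>\<^sup>2 * (Z (- real n) (real n) - Z (- real n) (- real n)) \<le> (l2norm f)\<^sup>2"
        using en[of "- real n" "real n"] \<delta>(1) by (smt (verit) mult_nonneg_nonneg of_nat_0_le_iff zero_le_power2)
      then show "Z (- real n) (real n) - Z (- real n) (- real n) \<le> (l2norm f / \<delta>)\<^sup>2"
        using \<delta>(1) by (simp add: power_divide le_divide_eq mult.commute)
    qed
    finally show ?thesis .
  qed
  have Flim: "(\<lambda>n. F n x) \<longlonglongrightarrow> y x" for x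
  proof (rule Lim_transform_eventually[OF lim])
    obtain N :: nat where "\<bar>x\<bar> \<le> N" using real_arch_simple by blast
    then show "\<forall>\<^sub>F n in sequentially. (\<Phi> x - \<Phi> (- real n)) / E x = F n x"
      by (intro eventually_sequentiallyI[of N]) (auto simp: F_def z_def indicator_def)
  qed
  have Fm: "F n \<in> borel_measurable borel" for n unfolding F_def by measurable
  have "0 \<le> l2norm f / \<delta>" using \<delta>(1) by simp
  from sq_integrable_fatou[OF yc this Fm le Flim] show thesis by (intro that[of y] y)
qed

lemma linear_ode_bounded:
  fixes b f :: "real \<Rightarrow> real"
  assumes b: "continuous_on UNIV b" and f: "continuous_on UNIV f"
    and \<delta>: "0 < \<delta>" "\<And>x. \<delta> \<le> b x" and B: "\<And>x. \<bar>f x\<bar> \<le> B"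
  obtains y where "\<And>x. (y has_real_derivative - b x * y x + f x) (at x)" "\<And>x. \<bar>y x\<bar> \<le> B / \<delta>"
proof -
  define E where "E = (\<lambda>x. exp (antideriv b x))"
  define \<Phi> where "\<Phi> = antideriv (\<lambda>x. E x * f x)"
  have E: "(E has_real_derivative E x * b x) (at x)" for x
    using linear_ode_partial(2)[OF b f] unfolding E_def by simp
  have \<Phi>: "(\<Phi> has_real_derivative E x * f x) (at x)" for x
    using linear_ode_partial(3)[OF b f] unfolding \<Phi>_def E_def by simp
  have Epos: "0 < E x" for x by (simp add: E_def)
  have B0: "0 \<le> B" using B[of 0] by linarith
  have mono: "B / \<delta> * E p + s * \<Phi> p \<le> B / \<delta> * E x + s * \<Phi> x" if "p \<le> x" "\<bar>s\<bar> = 1" for p x s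
    using \<open>p \<le> x\<close>
  proof (rule DERIV_nonneg_imp_nondecreasing)
    fix x
    have "((\<lambda>x. B / \<delta> * E x + s * \<Phi> x) has_real_derivative (B / \<delta> * b x + s * f x) * E x) (at x)"
      by (rule derivative_eq_intros E \<Phi> refl)+ (simp add: algebra_simps)
    moreover have "B \<le> B / \<delta> * b x"
      using \<delta>(1) mult_left_mono[OF \<delta>(2)[of x] B0] by (simp add: field_simps)
    moreover have "\<bar>s * f x\<bar> \<le> B" using B[of x] that by (simp add: abs_mult)
    ultimately show "\<exists>y. ((\<lambda>x. B / \<delta> * E x + s * \<Phi> x) has_real_derivative y) (at x) \<and> 0 \<le> y"
      using Epos[of x] by (intro exI[of _ "(B / \<delta> * b x + s * f x) * E x"]) auto
  qed
  have K: "\<bar>\<Phi> x - \<Phi> p\<bar> \<le> (B / \<delta>) * E x" if "p \<le> x" for p x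
  proof -
    have "0 \<le> B / \<delta> * E p" using B0 \<delta>(1) Epos[of p] by simp
    then show ?thesis using mono[OF that, of 1] mono[OF that, of "-1"] by simp
  qed
  show thesis
  proof (rule linear_ode_line[OF b f \<delta> K[unfolded \<Phi>_def E_def]])
    fix y :: "real \<Rightarrow> real"
    assume "\<And>x. (y has_real_derivative - b x * y x + f x) (at x)" "\<And>x. \<bar>y x\<bar> \<le> B / \<delta>"
    then show thesis by (rule that)
  qed
qed

text \<open>A positive value of \<open>D\<close> would grow exponentially backwards in \<open>x\<close>. This is the comparison principle
for bounded solutions on the whole line; no initial value is available there.\<close>
lemma bounded_subsolution_nonpos:
  fixes D :: "real \<Rightarrow> real"
  assumes D: "\<And>x. (D has_real_derivative D' x) (at x)" and le: "\<And>x. D' x \<le> - m * D x"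
    and m: "0 < m" and B: "\<And>x. \<bar>D x\<bar> \<le> B"
  shows "D x \<le> 0"
proof -
  have dec: "exp (m * (q - p)) * D q \<le> D p" if "p \<le> q" for p q
  proof -
    have "exp (m * q) * D q \<le> exp (m * p) * D p" using that
    proof (rule DERIV_nonpos_imp_nonincreasing)
      fix x
      have "((\<lambda>x. exp (m * x) * D x) has_real_derivative exp (m * x) * (D' x + m * D x)) (at x)"
        by (rule derivative_eq_intros D refl)+ (simp add: algebra_simps)
      moreover have "exp (m * x) * (D' x + m * D x) \<le> 0" using le[of x] by (simp add: mult_le_0_iff)
      ultimately show "\<exists>y. ((\<lambda>x. exp (m * x) * D x) has_real_derivative y) (at x) \<and> y \<le> 0" by blast
    qed
    then have "exp (m * q) * D q * exp (- m * p) \<le> exp (m * p) * D p * exp (- m * p)"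
      by (intro mult_right_mono) auto
    then show ?thesis by (simp add: exp_diff exp_minus field_simps)
  qed
  show ?thesis
  proof (rule ccontr)
    assume "\<not> D x \<le> 0"
    then have pos: "0 < D x" by simp
    (* At distance r to the left the exponential growth has already exceeded the bound B. *)
    define r where "r = B / (m * D x)"
    have B0: "0 \<le> B" using B[of 0] by linarith
    have "exp (m * r) * D x \<le> D (x - r)" using dec[of "x - r" x] B0 pos m by (simp add: r_def)
    also have "\<dots> \<le> B" using B[of "x - r"] by linarith
    finally have "exp (m * r) * D x \<le> B" .
    moreover have "(1 + m * r) * D x \<le> exp (m * r) * D x" using pos by (intro mult_right_mono) (auto simp: exp_ge_add_one_self)
    moreover have "(1 + m * r) * D x = D x + B" using pos m by (simp add: r_def field_simps)
    ultimately show False using pos by linarith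
  qed
qed

text \<open>Solving the linear equation \<open>y' = - m y + F(x, u(x))\<close> for its bounded solution \<open>y\<close> maps the bounded
continuous functions \<open>u\<close> to themselves, with Lipschitz constant \<open>L / m < 1\<close>.\<close>
lemma bounded_solution_semilinear:
  fixes F :: "real \<Rightarrow> real \<Rightarrow> real"
  assumes F: "continuous_on UNIV (\<lambda>z. F (fst z) (snd z))" and B: "\<And>x v. \<bar>F x v\<bar> \<le> B"
    and L: "0 \<le> L" "L < m" and lip: "\<And>x v w. \<bar>F x v - F x w\<bar> \<le> L * \<bar>v - w\<bar>"
  obtains y where "\<And>x. (y has_real_derivative - m * y x + F x (y x)) (at x)" "\<And>x. \<bar>y x\<bar> \<le> B / m"
proof -
  have m: "0 < m" using L by simp
  define P where "P u v \<longleftrightarrow> (\<forall>x. (v has_real_derivative - m * v x + F x (apply_bcontfun u x)) (at x)) \<and> (\<forall>x. \<bar>v x\<bar> \<le> B / m)"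
    for u :: "real \<Rightarrow>\<^sub>C real" and v
  have ex: "\<exists>v. P u v" for u
  proof -
    have "continuous_on UNIV (\<lambda>x. F (fst (x, apply_bcontfun u x)) (snd (x, apply_bcontfun u x)))"
      by (rule continuous_on_compose2[OF F]) (auto intro!: continuous_on_Pair continuous_on_id)
    then have c: "continuous_on UNIV (\<lambda>x. F x (apply_bcontfun u x))" by simp
    show ?thesis
    proof (rule linear_ode_bounded[OF _ c m order_refl B])
      fix v :: "real \<Rightarrow> real"
      assume "\<And>x. (v has_real_derivative - m * v x + F x (apply_bcontfun u x)) (at x)" "\<And>x. \<bar>v x\<bar> \<le> B / m"
      then show ?thesis unfolding P_def by blast
    qed simp
  qed
  define V where "V u = (SOME v. P u v)" for u
  have V: "P u (V u)" for u unfolding V_def using ex by (rule someI_ex)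
  define T where "T u = Bcontfun (V u)" for u
  have bc: "V u \<in> bcontfun" for u
    using V[of u] unfolding P_def
    by (intro bcontfun_normI[of _ "B / m"] has_real_derivative_continuous_on) auto
  have T: "apply_bcontfun (T u) = V u" for u unfolding T_def using bc by (rule Bcontfun_inverse)
  have one: "V u x - V w x \<le> L / m * dist u w" for u w x
  proof -
    define D where "D x = V u x - V w x - L / m * dist u w" for x
    have "D x \<le> 0"
    proof (rule bounded_subsolution_nonpos[where D = D and m = m and B = "B / m + B / m + L / m * dist u w"
          and D' = "\<lambda>x. (- m * V u x + F x (apply_bcontfun u x)) - (- m * V w x + F x (apply_bcontfun w x)) - 0"])
      fix x
      have "((\<lambda>x. V u x - V w x - L / m * dist u w) has_real_derivative
          (- m * V u x + F x (apply_bcontfun u x)) - (- m * V w x + F x (apply_bcontfun w x)) - 0) (at x)"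
        using V unfolding P_def by (intro DERIV_diff DERIV_const) auto
      then show "(D has_real_derivative (- m * V u x + F x (apply_bcontfun u x)) - (- m * V w x + F x (apply_bcontfun w x)) - 0) (at x)"
        by (simp add: D_def[abs_def])
      have "F x (apply_bcontfun u x) - F x (apply_bcontfun w x) \<le> L * \<bar>apply_bcontfun u x - apply_bcontfun w x\<bar>"
        using lip[of x "apply_bcontfun u x" "apply_bcontfun w x"] by linarith
      also have "\<dots> \<le> L * dist u w"
        using dist_bounded[of u x w] L by (intro mult_left_mono) (auto simp: dist_real_def)
      finally show "(- m * V u x + F x (apply_bcontfun u x)) - (- m * V w x + F x (apply_bcontfun w x)) - 0 \<le> - m * D x"
        using m by (simp add: D_def algebra_simps)
      have "\<bar>V u x\<bar> \<le> B / m" "\<bar>V w x\<bar> \<le> B / m" using V unfolding P_def by auto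
      moreover have "0 \<le> L / m * dist u w" using L m by simp
      ultimately show "\<bar>D x\<bar> \<le> B / m + B / m + L / m * dist u w" unfolding D_def by linarith
    qed (rule m)
    then show ?thesis by (simp add: D_def)
  qed
  have "\<exists>!u. T u = u"
  proof (rule banach_fix_type[of "L / m"])
    show "\<forall>x y. dist (T x) (T y) \<le> L / m * dist x y"
    proof (intro allI dist_bound)
      fix u w x
      show "dist (apply_bcontfun (T u) x) (apply_bcontfun (T w) x) \<le> L / m * dist u w"
        using one[of u x w] one[of w x u] by (simp add: T dist_real_def abs_le_iff dist_commute)
    qed
  qed (use L m in auto)
  then obtain u where "T u = u" by blast
  then have "apply_bcontfun u = V u" using T[of u] by simp
  then show thesis using V[of u] that[of "V u"] unfolding P_def by simp
qed

text \<open>Separation of variables; the bounds on \<open>G\<close> make the inverse function global.\<close>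
lemma autonomous_flow:
  fixes G :: "real \<Rightarrow> real"
  assumes G: "continuous_on UNIV G" and \<mu>: "0 < \<mu>" "\<And>x. \<mu> \<le> G x" and M: "\<And>x. G x \<le> M"
  obtains \<xi> where "\<xi> 0 = 0" "\<And>x. (\<xi> has_real_derivative G (\<xi> x)) (at x)"
proof -
  define X where "X = antideriv (\<lambda>x. 1 / G x)"
  have Gpos: "0 < G x" for x using \<mu>(1) \<mu>(2)[of x] by linarith
  then have G0: "G x \<noteq> 0" for x by (metis less_irrefl)
  have M0: "0 < M" using Gpos[of 0] M[of 0] by linarith
  have X: "(X has_real_derivative 1 / G x) (at x)" for x
    unfolding X_def using G0 by (intro antideriv_deriv continuous_intros G) auto
  have Xc: "continuous_on UNIV X" by (rule has_real_derivative_continuous_on[OF X])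
  have inc: "(q - p) / M \<le> X q - X p" if "p \<le> q" for p q
  proof -
    have "X p - p / M \<le> X q - q / M" using that
    proof (rule DERIV_nonneg_imp_nondecreasing)
      fix x
      have "((\<lambda>x. X x - x / M) has_real_derivative 1 / G x - 1 / M) (at x)"
        by (rule DERIV_diff[OF X DERIV_cdivide[OF DERIV_ident]])
      moreover have "0 \<le> 1 / G x - 1 / M" using M[of x] Gpos[of x] by (simp add: frac_le)
      ultimately show "\<exists>y. ((\<lambda>x. X x - x / M) has_real_derivative y) (at x) \<and> 0 \<le> y" by blast
    qed
    then show ?thesis by (simp add: diff_divide_distrib)
  qed
  have inj: "inj X"
  proof (rule linorder_injI)
    fix p q :: real assume "p < q"
    then show "X p \<noteq> X q" using inc[of p q] M0 by (smt (verit) divide_pos_pos)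
  qed
  have surj: "surj X"
  proof -
    have "\<exists>x. X x = t" for t
    proof -
      have "X (- M * \<bar>t\<bar>) \<le> t" using inc[of "- M * \<bar>t\<bar>" 0] M0 by (simp add: X_def)
      moreover have "t \<le> X (M * \<bar>t\<bar>)" using inc[of 0 "M * \<bar>t\<bar>"] M0 by (simp add: X_def)
      moreover have "- M * \<bar>t\<bar> \<le> M * \<bar>t\<bar>" using M0 by simp
      ultimately show ?thesis using IVT'[of X "- M * \<bar>t\<bar>" t "M * \<bar>t\<bar>"] Xc
        by (meson continuous_on_subset subset_UNIV)
    qed
    then show ?thesis by (metis surjI)
  qed
  define \<xi> where "\<xi> = inv X"
  have \<xi>X: "\<xi> (X x) = x" for x unfolding \<xi>_def using inj by simp
  have X\<xi>: "X (\<xi> x) = x" for x unfolding \<xi>_def using surj by (rule surj_f_inv_f)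
  show thesis
  proof (rule that[of \<xi>])
    show "\<xi> 0 = 0" using \<xi>X[of 0] by (simp add: X_def)
    fix x
    have "isCont \<xi> (X (\<xi> x))"
      by (rule isCont_inverse_function[of 1]) (auto simp: \<xi>X DERIV_isCont[OF X])
    then have "(\<xi> has_real_derivative inverse (1 / G (\<xi> x))) (at x)"
      by (intro DERIV_inverse_function[where f = X and a = "x - 1" and b = "x + 1"] X) (auto simp: X\<xi> G0)
    then show "(\<xi> has_real_derivative G (\<xi> x)) (at x)" by simp
  qed
qed

text \<open>The kernel \<open>p(x) / p(s)\<close> of \<open>y \<mapsto> p Y\<close> is dominated by \<open>\<omega>(x) / \<omega>(s)\<close>, which decays
exponentially for \<open>0 \<le> s \<le> x\<close>. The kernel \<open>\<omega>(x) / \<omega>(s)\<close> belongs to a stable linear equation, to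
which the energy estimate applies.\<close>
lemma weighted_antideriv_half_line:
  fixes p \<omega> y Y S Q \<beta> :: "real \<Rightarrow> real"
  assumes \<omega>: "\<And>x. (\<omega> has_real_derivative - \<beta> x * \<omega> x) (at x)" "\<And>x. 0 < \<omega> x"
    and \<delta>: "0 < \<delta>" "\<And>x. 0 \<le> x \<Longrightarrow> \<delta> \<le> \<beta> x"
    and k: "0 < k1" "\<And>x. 0 \<le> x \<Longrightarrow> k1 * \<omega> x \<le> p x" "\<And>x. 0 \<le> x \<Longrightarrow> p x \<le> k2 * \<omega> x"
    and y: "continuous_on UNIV y"
    and Y: "Y 0 = 0" "\<And>x. (Y has_real_derivative y x / p x) (at x)"
    and S: "\<And>x. (S has_real_derivative (y x)\<^sup>2) (at x)"
    and Q: "\<And>x. (Q has_real_derivative (p x * Y x)\<^sup>2) (at x)"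
    and N: "0 \<le> N"
  shows "Q N - Q 0 \<le> (k2 / (k1 * \<delta>))\<^sup>2 * (S N - S 0)"
proof -
  have \<omega>c: "continuous_on UNIV \<omega>" by (rule has_real_derivative_continuous_on[OF \<omega>(1)])
  have \<omega>0: "\<omega> x \<noteq> 0" for x using \<omega>(2)[of x] by simp
  define V where "V = antideriv (\<lambda>x. \<bar>y x\<bar> / \<omega> x)"
  have V: "(V has_real_derivative \<bar>y x\<bar> / \<omega> x) (at x)" for x
    unfolding V_def using \<omega>0 by (intro antideriv_deriv continuous_intros y \<omega>c) auto
  define z where "z x = \<omega> x * V x" for x
  have z: "(z has_real_derivative - \<beta> x * z x + \<bar>y x\<bar>) (at x)" for x
    unfolding z_def by (rule derivative_eq_intros \<omega>(1) V refl)+ (use \<omega>0 in \<open>simp add: field_simps\<close>)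
  define Z where "Z = antideriv (\<lambda>x. (z x)\<^sup>2)"
  have Z: "(Z has_real_derivative (z x)\<^sup>2) (at x)" for x
    unfolding Z_def by (intro antideriv_deriv continuous_intros has_real_derivative_continuous_on[OF z])
  have en: "\<delta> * (z N)\<^sup>2 + \<delta>\<^sup>2 * (Z N - Z 0) \<le> S N - S 0"
    by (rule linear_ode_energy[OF N \<delta>(1) _ z \<delta>(2) Z]) (auto simp: z_def V_def S)
  have mono: "0 \<le> V x / k1 + s * Y x" if "0 \<le> x" "\<bar>s\<bar> = 1" for x s
  proof -
    have "V 0 / k1 + s * Y 0 \<le> V x / k1 + s * Y x" using \<open>0 \<le> x\<close>
    proof (rule DERIV_nonneg_imp_nondecreasing)
      fix x :: real assume x: "0 \<le> x"
      have "((\<lambda>x. V x / k1 + s * Y x) has_real_derivative \<bar>y x\<bar> / \<omega> x / k1 + s * (y x / p x)) (at x)"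
        by (rule DERIV_add[OF DERIV_cdivide[OF V] DERIV_cmult[OF Y(2)]])
      moreover have "0 \<le> \<bar>y x\<bar> / \<omega> x / k1 + s * (y x / p x)"
      proof -
        have pos: "0 < k1 * \<omega> x" using k \<omega>(2) by simp
        then have "\<bar>s * (y x / p x)\<bar> = \<bar>y x\<bar> / p x" using that k(2)[OF x] by (simp add: abs_mult)
        also have "\<dots> \<le> \<bar>y x\<bar> / (k1 * \<omega> x)" using pos k(2)[OF x] by (intro frac_le) auto
        also have "\<dots> = \<bar>y x\<bar> / \<omega> x / k1" by (simp add: mult.commute)
        finally have "\<bar>s * (y x / p x)\<bar> \<le> \<bar>y x\<bar> / \<omega> x / k1" .
        from abs_le_D2[OF this] show ?thesis by linarith
      qed
      ultimately show "\<exists>d. ((\<lambda>x. V x / k1 + s * Y x) has_real_derivative d) (at x) \<and> 0 \<le> d" by blast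
    qed
    then show ?thesis by (simp add: V_def Y(1))
  qed
  define K where "K = k2 / k1"
  have pw: "(p x * Y x)\<^sup>2 \<le> K\<^sup>2 * (z x)\<^sup>2" if x: "0 \<le> x" for x
  proof -
    have pos: "0 < k1 * \<omega> x" using k(1) \<omega>(2) by simp
    have "\<bar>Y x\<bar> \<le> V x / k1" using mono[OF x, of 1] mono[OF x, of "-1"] by (simp add: abs_le_iff)
    then have "\<bar>p x\<bar> * \<bar>Y x\<bar> \<le> (k2 * \<omega> x) * (V x / k1)"
      using k(2,3)[OF x] pos by (intro mult_mono) auto
    also have "(k2 * \<omega> x) * (V x / k1) = K * z x" by (simp add: K_def z_def)
    also have "\<dots> \<le> \<bar>K * z x\<bar>" by simp
    finally have "\<bar>p x * Y x\<bar> \<le> \<bar>K * z x\<bar>" by (simp add: abs_mult)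
    then show ?thesis by (simp add: abs_le_square_iff power_mult_distrib)
  qed
  have "K\<^sup>2 * Z 0 - Q 0 \<le> K\<^sup>2 * Z N - Q N" using N
  proof (rule DERIV_nonneg_imp_nondecreasing)
    fix x :: real assume x: "0 \<le> x"
    have "((\<lambda>x. K\<^sup>2 * Z x - Q x) has_real_derivative K\<^sup>2 * (z x)\<^sup>2 - (p x * Y x)\<^sup>2) (at x)"
      by (rule derivative_eq_intros Z Q refl)+ simp
    then show "\<exists>d. ((\<lambda>x. K\<^sup>2 * Z x - Q x) has_real_derivative d) (at x) \<and> 0 \<le> d"
      using pw[OF x] by (intro exI[of _ "K\<^sup>2 * (z x)\<^sup>2 - (p x * Y x)\<^sup>2"]) simp
  qed
  then have "Q N - Q 0 \<le> K\<^sup>2 * (Z N - Z 0)" by (simp add: algebra_simps)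
  also have "\<dots> \<le> K\<^sup>2 * ((S N - S 0) / \<delta>\<^sup>2)"
  proof (rule mult_left_mono)
    have "\<delta>\<^sup>2 * (Z N - Z 0) \<le> S N - S 0" using en \<delta>(1) by (smt (verit) mult_nonneg_nonneg zero_le_power2)
    then show "Z N - Z 0 \<le> (S N - S 0) / \<delta>\<^sup>2" using \<delta>(1) by (simp add: le_divide_eq mult.commute)
  qed simp
  also have "\<dots> = (k2 / (k1 * \<delta>))\<^sup>2 * (S N - S 0)" by (simp add: K_def power_divide power_mult_distrib)
  finally show ?thesis .
qed

text \<open>The half-line estimate on both sides of 0, with the comparison function \<open>\<omega>\<close> on the right and
\<open>\<psi>\<close> on the left. For the front, \<open>p\<close> decays like \<open>\<phi>\<close> at \<open>\<infinity>\<close> and like \<open>1 - \<phi>\<close> at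
\<open>-\<infinity>\<close>; integration starts at 0 because \<open>p\<close> decays on both sides.\<close>
lemma weighted_antideriv_L2:
  fixes p \<omega> \<psi> y Y \<beta> \<gamma> :: "real \<Rightarrow> real"
  assumes p: "continuous_on UNIV p"
    and \<omega>: "\<And>x. (\<omega> has_real_derivative - \<beta> x * \<omega> x) (at x)" "\<And>x. 0 < \<omega> x"
    and \<psi>: "\<And>x. (\<psi> has_real_derivative \<gamma> x * \<psi> x) (at x)" "\<And>x. 0 < \<psi> x"
    and \<delta>: "0 < \<delta>" "\<And>x. 0 \<le> x \<Longrightarrow> \<delta> \<le> \<beta> x" "\<And>x. x \<le> 0 \<Longrightarrow> \<delta> \<le> \<gamma> x"
    and k: "0 < k1" "0 \<le> k2"
      "\<And>x. 0 \<le> x \<Longrightarrow> k1 * \<omega> x \<le> p x" "\<And>x. 0 \<le> x \<Longrightarrow> p x \<le> k2 * \<omega> x"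
      "\<And>x. x \<le> 0 \<Longrightarrow> k1 * \<psi> x \<le> p x" "\<And>x. x \<le> 0 \<Longrightarrow> p x \<le> k2 * \<psi> x"
    and y: "sq_integrable y"
    and Y: "Y 0 = 0" "\<And>x. (Y has_real_derivative y x / p x) (at x)"
  shows "sq_integrable (\<lambda>x. p x * Y x)" "l2norm (\<lambda>x. p x * Y x) \<le> k2 / (k1 * \<delta>) * l2norm y"
proof -
  have pYc: "continuous_on UNIV (\<lambda>x. p x * Y x)"
    by (intro continuous_intros p has_real_derivative_continuous_on[OF Y(2)])
  define Q where "Q = antideriv (\<lambda>x. (p x * Y x)\<^sup>2)"
  have Q: "(Q has_real_derivative (p x * Y x)\<^sup>2) (at x)" for x
    unfolding Q_def by (rule antideriv_deriv) (intro continuous_on_power pYc)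
  define S where "S = antideriv (\<lambda>x. (y x)\<^sup>2)"
  have S: "(S has_real_derivative (y x)\<^sup>2) (at x)" for x
    unfolding S_def by (intro antideriv_deriv continuous_intros sq_integrableD(1)[OF y])
  have refl_deriv: "((\<lambda>x. f (- x)) has_real_derivative - d) (at x)"
    if "(f has_real_derivative d) (at (- x))" for f d x
    using DERIV_chain2[OF that DERIV_minus[OF DERIV_ident]] by simp
  have yr: "continuous_on UNIV (\<lambda>x. y (- x))"
    by (rule sq_integrableD(1)[OF sq_integrable_reflect(1)[OF y]])
  define C where "C = k2 / (k1 * \<delta>)"
  have C0: "0 \<le> C" unfolding C_def using k \<delta>(1) by simp
  have "Q (real N) - Q (- real N) \<le> (C * l2norm y)\<^sup>2" for N :: nat
  proof -
    have right: "Q N - Q 0 \<le> C\<^sup>2 * (S N - S 0)" unfolding C_def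
      by (rule weighted_antideriv_half_line[OF \<omega> \<delta>(1,2) k(1,3,4) sq_integrableD(1)[OF y] Y S Q]) auto
    have "(- Q (- real N)) - (- Q (- 0)) \<le> C\<^sup>2 * ((- S (- real N)) - (- S (- 0)))" unfolding C_def
    proof (rule weighted_antideriv_half_line[where \<omega> = "\<lambda>x. \<psi> (- x)" and \<beta> = "\<lambda>x. \<gamma> (- x)"
          and p = "\<lambda>x. p (- x)" and y = "\<lambda>x. y (- x)" and Y = "\<lambda>x. - Y (- x)"])
      fix x
      show "((\<lambda>x. \<psi> (- x)) has_real_derivative - \<gamma> (- x) * \<psi> (- x)) (at x)"
        using refl_deriv[OF \<psi>(1), of x] by simp
      show "((\<lambda>x. - Y (- x)) has_real_derivative y (- x) / p (- x)) (at x)"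
        using DERIV_minus[OF refl_deriv[OF Y(2), of x]] by simp
      show "0 < \<psi> (- x)" by (rule \<psi>(2))
      show "\<delta> \<le> \<gamma> (- x)" if "0 \<le> x" using that by (intro \<delta>(3)) simp
      show "k1 * \<psi> (- x) \<le> p (- x)" if "0 \<le> x" using that by (intro k(5)) simp
      show "p (- x) \<le> k2 * \<psi> (- x)" if "0 \<le> x" using that by (intro k(6)) simp
      show "- Y (- 0) = 0" using Y(1) by simp
      show "((\<lambda>x. - S (- x)) has_real_derivative (y (- x))\<^sup>2) (at x)"
        using DERIV_minus[OF refl_deriv[OF S, of x]] by simp
      show "((\<lambda>x. - Q (- x)) has_real_derivative (p (- x) * - Y (- x))\<^sup>2) (at x)"
        using DERIV_minus[OF refl_deriv[OF Q, of x]] by simp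
    qed (rule \<delta>(1) k(1) yr of_nat_0_le_iff)+
    then have "Q 0 - Q (- real N) \<le> C\<^sup>2 * (S 0 - S (- real N))" by simp
    with right have "Q (real N) - Q (- real N) \<le> C\<^sup>2 * (S (real N) - S (- real N))"
      by (simp add: algebra_simps)
    also have "\<dots> \<le> C\<^sup>2 * (l2norm y)\<^sup>2"
      by (intro mult_left_mono sq_integrable_interval_le[OF y S]) auto
    finally show ?thesis by (simp add: power_mult_distrib)
  qed
  from sq_integrable_compact[OF pYc mult_nonneg_nonneg[OF C0 l2norm_nonneg] Q this]
  show "sq_integrable (\<lambda>x. p x * Y x)" "l2norm (\<lambda>x. p x * Y x) \<le> k2 / (k1 * \<delta>) * l2norm y"
    by (auto simp: C_def)
qed

section \<open>The continuum front\<close>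

text \<open>Decreasing, as the front is, and used as the coordinate on the interval between the two zeros of \<open>g\<close>:
it turns a flow on the open interval into a flow on the line with a speed bounded above and below.\<close>
definition logistic :: "real \<Rightarrow> real" where
  "logistic x = 1 / (1 + exp x)"

lemma logistic_bounds: "0 < logistic x" "logistic x < 1"
  by (auto simp: logistic_def add_pos_pos)

lemma logistic_deriv:
  "(logistic has_real_derivative - (logistic x * (1 - logistic x))) (at x)"
proof -
  have "1 + exp x \<noteq> 0" by (metis add_pos_pos exp_gt_zero less_irrefl zero_less_one)
  then show ?thesis unfolding logistic_def[abs_def]
    by (auto intro!: derivative_eq_intros simp: field_simps power2_eq_square)
qed

lemma logistic_limits: "(logistic \<longlongrightarrow> 0) at_top" "(logistic \<longlongrightarrow> 1) at_bot"
proof -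
  show "(logistic \<longlongrightarrow> 0) at_top" unfolding logistic_def[abs_def]
    by (intro tendsto_divide_0[OF tendsto_const] filterlim_at_top_imp_at_infinity
        filterlim_tendsto_add_at_top[OF tendsto_const] exp_at_top)
  have "((\<lambda>x. 1 / (1 + exp x)) \<longlongrightarrow> 1 / (1 + (0::real))) at_bot"
    by (intro tendsto_intros exp_at_bot) auto
  then show "(logistic \<longlongrightarrow> 1) at_bot" unfolding logistic_def[abs_def] by simp
qed

text \<open>The trajectory is parametrised by the logistic coordinate \<open>\<xi>\<close> with \<open>\<phi> = s(\<xi>)\<close>, which decouples the
system. If \<open>\<xi>' = G(\<xi>) R(\<xi>)\<close> along the front, with \<open>G = g(s) / (s (1 - s))\<close>, then
\<open>\<phi>'' + c \<phi>' + g(\<phi>) = 0\<close> becomes the scalar equation \<open>dR/d\<xi> = (g'(s) R - c + 1/R) / G\<close>. A constant \<open>R = \<kappa>\<close>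
with \<open>g'(1) \<kappa>\<^sup>2 - c \<kappa> + 1 = 0\<close> is a lower barrier, and \<open>R = 1/l\<close>, where \<open>l\<close> is the larger root of
\<open>l\<^sup>2 - c l + g'(0) = 0\<close>, is an upper one. The derivative of \<open>g'(s) R + 1/R\<close> in \<open>R\<close> is at most
\<open>g'(0) - l\<^sup>2 < 0\<close> below the upper barrier, so a bounded solution is obtained by contraction and it
stays between the barriers by comparison. This is the place where the speed must exceed
\<open>2 sqrt (g'(0))\<close>.\<close>
lemma front_exists:
  fixes g g' :: "real \<Rightarrow> real" and c \<mu> \<Lambda> :: real
  assumes g: "continuous_on UNIV g" and g': "continuous_on UNIV g'"
    and mono: "\<And>u. 0 \<le> u \<Longrightarrow> u \<le> 1 \<Longrightarrow> g' 1 \<le> g' u" "\<And>u. 0 \<le> u \<Longrightarrow> u \<le> 1 \<Longrightarrow> g' u \<le> g' 0"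
    and \<mu>: "0 < \<mu>" "\<And>u. 0 \<le> u \<Longrightarrow> u \<le> 1 \<Longrightarrow> \<mu> * (u * (1 - u)) \<le> g u"
    and \<Lambda>: "\<And>u. 0 \<le> u \<Longrightarrow> u \<le> 1 \<Longrightarrow> g u \<le> \<Lambda> * (u * (1 - u))"
    and g1: "g' 1 < 0" and g0: "0 < g' 0" and c: "2 * sqrt (g' 0) < c"
  obtains \<phi> \<rho> \<kappa> R where
    "0 < \<kappa>" "\<And>x. \<kappa> \<le> \<rho> x" "\<And>x. \<rho> x \<le> R"
    "\<And>x. 0 < \<phi> x" "\<And>x. \<phi> x < 1" "\<phi> 0 = 1 / 2"
    "\<And>x. (\<phi> has_real_derivative - (g (\<phi> x) * \<rho> x)) (at x)"
    "\<And>x. (\<rho> has_real_derivative g' (\<phi> x) * (\<rho> x)\<^sup>2 - c * \<rho> x + 1) (at x)"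
    "(\<phi> \<longlongrightarrow> 1) at_bot" "(\<phi> \<longlongrightarrow> 0) at_top"
proof -
  have c0: "0 < c" using c g0 by (smt (verit) real_sqrt_gt_zero)
  define e where "e = g' 0"
  define d where "d = - g' 1"
  have e: "0 < e" and d: "0 < d" using g0 g1 by (auto simp: e_def d_def)
  have ce: "4 * e < c\<^sup>2"
  proof -
    have "(2 * sqrt e)\<^sup>2 < c\<^sup>2" using c e by (intro power_strict_mono) (auto simp: e_def)
    then show ?thesis using e by (simp add: power_mult_distrib)
  qed
  (* The two constant barriers. *)
  define \<kappa> where "\<kappa> = (sqrt (c\<^sup>2 + 4 * d) - c) / (2 * d)"
  have \<kappa>eq: "d * \<kappa>\<^sup>2 + c * \<kappa> = 1"
  proof -
    have "2 * d * \<kappa> + c = sqrt (c\<^sup>2 + 4 * d)" using d by (simp add: \<kappa>_def)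
    then have "(2 * d * \<kappa> + c)\<^sup>2 = c\<^sup>2 + 4 * d" using d by simp
    then have "4 * d * (d * \<kappa>\<^sup>2 + c * \<kappa>) = 4 * d * 1" by (simp add: power2_eq_square algebra_simps)
    then show ?thesis using d by (subst (asm) mult_cancel_left) auto
  qed
  have \<kappa>0: "0 < \<kappa>"
  proof -
    have "c < sqrt (c\<^sup>2 + 4 * d)" using d c0 by (intro real_less_rsqrt) auto
    then show ?thesis using d by (simp add: \<kappa>_def)
  qed
  define l where "l = (c + sqrt (c\<^sup>2 - 4 * e)) / 2"
  have leq: "l\<^sup>2 - c * l + e = 0"
  proof -
    have "2 * l - c = sqrt (c\<^sup>2 - 4 * e)"
    proof -
      have "2 * ((c + r) / 2) - c = r" for r :: real by (simp add: field_simps)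
      then show ?thesis unfolding l_def .
    qed
    then have "(2 * l - c)\<^sup>2 = c\<^sup>2 - 4 * e" using ce by simp
    then show ?thesis by (simp add: power2_eq_square algebra_simps)
  qed
  have lc: "c / 2 < l" using ce by (simp add: l_def)
  have l0: "0 < l" using lc c0 by simp
  have le: "e < l\<^sup>2"
  proof -
    have "(c / 2)\<^sup>2 < l\<^sup>2" using lc c0 by (intro power_strict_mono) auto
    then show ?thesis using ce by (simp add: power_divide)
  qed
  define R where "R = 1 / l"
  have R0: "0 < R" using l0 by (simp add: R_def)
  have Req: "e * R\<^sup>2 - c * R + 1 = 0"
  proof -
    have "e * R\<^sup>2 - c * R + 1 = (l\<^sup>2 - c * l + e) / l\<^sup>2"
      using l0 by (simp add: R_def power2_eq_square field_simps)
    then show ?thesis using leq by simp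
  qed
  define \<gamma> where "\<gamma> = 1 / R\<^sup>2 - e"
  have \<gamma>: "0 < \<gamma>" using le by (simp add: \<gamma>_def R_def power_divide)
  (* The barriers lie on the two sides of 1/c. *)
  have \<kappa>R: "\<kappa> < R"
  proof -
    have "c * \<kappa> < 1" using \<kappa>eq \<kappa>0 d by (smt (verit) mult_pos_pos zero_less_power)
    moreover have "1 < c * R" using Req R0 e by (smt (verit) mult_pos_pos zero_less_power)
    ultimately have "c * \<kappa> < c * R" by linarith
    then show ?thesis using c0 by simp
  qed
  define s where "s = logistic"
  have s01: "0 < s \<xi>" "s \<xi> < 1" "0 \<le> s \<xi>" "s \<xi> \<le> 1" "0 < s \<xi> * (1 - s \<xi>)" for \<xi>
    using logistic_bounds[of \<xi>] by (auto simp: s_def)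
  have s': "(s has_real_derivative - (s \<xi> * (1 - s \<xi>))) (at \<xi>)" for \<xi>
    unfolding s_def by (rule logistic_deriv)
  have sc: "continuous_on UNIV s" by (rule has_real_derivative_continuous_on[OF s'])
  have gs: "continuous_on UNIV (\<lambda>\<xi>. g (s \<xi>))" "continuous_on UNIV (\<lambda>\<xi>. g' (s \<xi>))"
    by (rule continuous_on_compose2[OF g sc] continuous_on_compose2[OF g' sc]; simp)+
  define G where "G \<xi> = g (s \<xi>) / (s \<xi> * (1 - s \<xi>))" for \<xi>
  have sne: "s \<xi> * (1 - s \<xi>) \<noteq> 0" for \<xi> using s01(5)[of \<xi>] by linarith
  have Gc: "continuous_on UNIV G"
    unfolding G_def using sne by (intro continuous_intros gs sc) blast
  have G\<mu>: "\<mu> \<le> G \<xi>" for \<xi> unfolding G_def using \<mu>(2)[of "s \<xi>"] s01[of \<xi>] by (simp add: le_divide_eq)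
  have G\<Lambda>: "G \<xi> \<le> \<Lambda>" for \<xi> unfolding G_def using \<Lambda>[of "s \<xi>"] s01[of \<xi>] by (simp add: divide_le_eq)
  have G0: "0 < G \<xi>" for \<xi> using G\<mu>[of \<xi>] \<mu>(1) by linarith
  have \<Lambda>0: "0 < \<Lambda>" using G0[of 0] G\<Lambda>[of 0] by linarith
  (* Adding m times the unknown to both sides makes the right-hand side increasing between the barriers. *)
  define m where "m = (d + 1 / \<kappa>\<^sup>2) / \<mu> + \<gamma> / \<Lambda>"
  define \<psi> where "\<psi> \<xi> w = m * w + (g' (s \<xi>) * w - c + 1 / w) / G \<xi>" for \<xi> w
  (* Truncation to the barriers makes the right-hand side globally Lipschitz; it is inactive a posteriori. *)
  define cl where "cl v = max \<kappa> (min R v)" for v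
  define F where "F \<xi> v = \<psi> \<xi> (cl v)" for \<xi> v
  have cl: "\<kappa> \<le> cl v" "cl v \<le> R" "0 < cl v" for v using \<kappa>R \<kappa>0 by (auto simp: cl_def)
  have \<psi>diff: "\<psi> \<xi> v - \<psi> \<xi> w = (v - w) * (m + (g' (s \<xi>) - 1 / (v * w)) / G \<xi>)"
    if "0 < v" "0 < w" for \<xi> v w
    using that G0[of \<xi>] by (simp add: \<psi>_def field_simps)
  have factor: "0 \<le> m + (g' (s \<xi>) - 1 / (v * w)) / G \<xi>" "m + (g' (s \<xi>) - 1 / (v * w)) / G \<xi> \<le> m - \<gamma> / \<Lambda>"
    if vw: "\<kappa> \<le> v" "v \<le> R" "\<kappa> \<le> w" "w \<le> R" for \<xi> v w
  proof -
    have pos: "0 < v" "0 < w" using vw \<kappa>0 by auto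
    have 1: "\<kappa>\<^sup>2 \<le> v * w" "v * w \<le> R\<^sup>2"
      unfolding power2_eq_square using vw pos \<kappa>0 by (auto intro!: mult_mono)
    have "1 / (v * w) \<le> 1 / \<kappa>\<^sup>2" "1 / R\<^sup>2 \<le> 1 / (v * w)"
      using 1 pos \<kappa>0 R0 by (auto intro!: divide_left_mono mult_pos_pos)
    moreover have "- d \<le> g' (s \<xi>)" "g' (s \<xi>) \<le> e" using mono s01 by (auto simp: d_def e_def)
    ultimately have 2: "- (d + 1 / \<kappa>\<^sup>2) \<le> g' (s \<xi>) - 1 / (v * w)" "g' (s \<xi>) - 1 / (v * w) \<le> - \<gamma>"
      by (auto simp: \<gamma>_def)
    have "(d + 1 / \<kappa>\<^sup>2) / G \<xi> \<le> (d + 1 / \<kappa>\<^sup>2) / \<mu>"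
      using G\<mu>[of \<xi>] \<mu>(1) d by (intro frac_le) auto
    then have "- ((d + 1 / \<kappa>\<^sup>2) / \<mu>) \<le> - (d + 1 / \<kappa>\<^sup>2) / G \<xi>"
      unfolding minus_divide_left[symmetric] by (rule le_imp_neg_le)
    also have "\<dots> \<le> (g' (s \<xi>) - 1 / (v * w)) / G \<xi>" using 2 G0[of \<xi>] by (intro divide_right_mono) auto
    finally show "0 \<le> m + (g' (s \<xi>) - 1 / (v * w)) / G \<xi>"
      unfolding m_def using \<gamma> \<Lambda>0 by (smt (verit) divide_pos_pos)
    have "(g' (s \<xi>) - 1 / (v * w)) / G \<xi> \<le> - \<gamma> / G \<xi>" using 2 G0[of \<xi>] by (intro divide_right_mono) auto
    also have "\<dots> \<le> - (\<gamma> / \<Lambda>)" using G\<Lambda>[of \<xi>] G0[of \<xi>] \<gamma> by (auto intro!: frac_le)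
    finally show "m + (g' (s \<xi>) - 1 / (v * w)) / G \<xi> \<le> m - \<gamma> / \<Lambda>" by linarith
  qed
  have \<psi>\<kappa>: "m * \<kappa> \<le> \<psi> \<xi> \<kappa>" for \<xi>
  proof -
    have "0 = (1 - c * \<kappa> - d * \<kappa>\<^sup>2) / \<kappa>" using \<kappa>eq by simp
    also have "\<dots> = - d * \<kappa> - c + 1 / \<kappa>" using \<kappa>0 by (simp add: field_simps power2_eq_square)
    also have "\<dots> \<le> g' (s \<xi>) * \<kappa> - c + 1 / \<kappa>"
      using mono(1)[of "s \<xi>"] s01[of \<xi>] \<kappa>0 by (simp add: d_def)
    finally show ?thesis unfolding \<psi>_def using G0[of \<xi>] by simp
  qed
  have \<psi>R: "\<psi> \<xi> R \<le> m * R" for \<xi>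
  proof -
    have "g' (s \<xi>) * R - c + 1 / R \<le> e * R - c + 1 / R"
      using mono(2)[of "s \<xi>"] s01[of \<xi>] R0 by (simp add: e_def)
    also have "\<dots> = (e * R\<^sup>2 - c * R + 1) / R" using R0 by (simp add: field_simps power2_eq_square)
    also have "\<dots> = 0" using Req by simp
    finally show ?thesis unfolding \<psi>_def using G0[of \<xi>] by (simp add: divide_le_0_iff)
  qed
  have F\<kappa>: "m * \<kappa> \<le> F \<xi> v" for \<xi> v
  proof -
    have "0 \<le> \<psi> \<xi> (cl v) - \<psi> \<xi> \<kappa>"
      unfolding \<psi>diff[OF cl(3) \<kappa>0] using factor(1)[of "cl v" \<kappa> \<xi>] cl \<kappa>R by (intro mult_nonneg_nonneg) auto
    then show ?thesis using \<psi>\<kappa>[of \<xi>] by (simp add: F_def)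
  qed
  have FR: "F \<xi> v \<le> m * R" for \<xi> v
  proof -
    have "0 \<le> \<psi> \<xi> R - \<psi> \<xi> (cl v)"
      unfolding \<psi>diff[OF R0 cl(3)] using factor(1)[of R "cl v" \<xi>] cl \<kappa>R by (intro mult_nonneg_nonneg) auto
    then show ?thesis using \<psi>R[of \<xi>] by (simp add: F_def)
  qed
  have m0: "0 < m"
  proof -
    have "0 < (d + 1 / \<kappa>\<^sup>2) / \<mu>" using d \<mu>(1) \<kappa>0 by (intro divide_pos_pos add_pos_pos) auto
    moreover have "0 < \<gamma> / \<Lambda>" using \<gamma> \<Lambda>0 by simp
    ultimately show ?thesis unfolding m_def by linarith
  qed
  obtain y where y: "\<And>x. (y has_real_derivative - m * y x + F x (y x)) (at x)"
    and yb: "\<And>x. \<bar>y x\<bar> \<le> m * R / m"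
  proof -
    have "continuous_on UNIV (\<lambda>z. \<psi> (fst z) (cl (snd z)))"
      unfolding \<psi>_def cl_def
    proof (intro continuous_intros continuous_on_compose2[OF gs(2)] continuous_on_compose2[OF Gc])
      show "\<forall>z\<in>UNIV. max \<kappa> (min R (snd z)) \<noteq> 0" using cl(3) unfolding cl_def by (metis less_irrefl)
      show "\<forall>z\<in>UNIV. G (fst z) \<noteq> 0" using G0 by (metis less_irrefl)
    qed auto
    then have Fc: "continuous_on UNIV (\<lambda>z. F (fst z) (snd z))" by (simp add: F_def)
    have Fb: "\<bar>F x v\<bar> \<le> m * R" for x v
      using F\<kappa>[of x v] FR[of x v] mult_pos_pos[OF m0 \<kappa>0] by linarith
    have L0: "0 \<le> m - \<gamma> / \<Lambda>" unfolding m_def using d \<mu>(1) by simp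
    have Lm: "m - \<gamma> / \<Lambda> < m" using \<gamma> \<Lambda>0 by simp
    have Fl: "\<bar>F x v - F x w\<bar> \<le> (m - \<gamma> / \<Lambda>) * \<bar>v - w\<bar>" for x v w
    proof -
      have "\<bar>F x v - F x w\<bar> = \<bar>cl v - cl w\<bar> * (m + (g' (s x) - 1 / (cl v * cl w)) / G x)"
        unfolding F_def \<psi>diff[OF cl(3) cl(3)] abs_mult
        using factor(1)[OF cl(1,2) cl(1,2), where \<xi> = x] by simp
      also have "\<dots> \<le> \<bar>v - w\<bar> * (m - \<gamma> / \<Lambda>)"
        using factor[OF cl(1,2) cl(1,2), where \<xi> = x] by (intro mult_mono) (auto simp: cl_def)
      finally show ?thesis by (simp add: mult.commute)
    qed
    show thesis
      by (rule bounded_solution_semilinear[OF Fc Fb L0 Lm Fl]) (rule that)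
  qed
  have y\<kappa>: "\<kappa> \<le> y x" for x
  proof -
    have "\<kappa> - y x \<le> 0"
    proof (rule bounded_subsolution_nonpos[where m = m and B = "\<kappa> + R" and D = "\<lambda>x. \<kappa> - y x"
          and D' = "\<lambda>x. 0 - (- m * y x + F x (y x))"])
      show "((\<lambda>x. \<kappa> - y x) has_real_derivative 0 - (- m * y x + F x (y x))) (at x)" for x
        by (intro DERIV_diff DERIV_const y)
      show "0 - (- m * y x + F x (y x)) \<le> - m * (\<kappa> - y x)" for x
        using F\<kappa>[of x "y x"] by (simp add: algebra_simps)
      show "\<bar>\<kappa> - y x\<bar> \<le> \<kappa> + R" for x using yb[of x] \<kappa>0 m0 by (simp add: abs_le_iff)
    qed (rule m0)
    then show ?thesis by simp
  qed
  have yR: "y x \<le> R" for x using yb[of x] m0 by simp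
  have y': "(y has_real_derivative (g' (s x) * y x - c + 1 / y x) / G x) (at x)" for x
  proof -
    have "cl (y x) = y x" using y\<kappa> yR by (simp add: cl_def)
    then have "- m * y x + F x (y x) = (g' (s x) * y x - c + 1 / y x) / G x" by (simp add: F_def \<psi>_def)
    then show ?thesis using y[of x] by simp
  qed
  have yc: "continuous_on UNIV y" by (rule has_real_derivative_continuous_on[OF y])
  have y0: "0 < y x" for x using y\<kappa>[of x] \<kappa>0 by linarith
  have Gy: "\<mu> * \<kappa> \<le> G x * y x" "G x * y x \<le> \<Lambda> * R" for x
    using G\<mu>[of x] G\<Lambda>[of x] y\<kappa>[of x] yR[of x] \<mu>(1) \<kappa>0 \<Lambda>0 G0[of x] y0[of x] by (auto intro!: mult_mono)
  obtain \<Xi> where \<Xi>0: "\<Xi> 0 = 0" and \<Xi>: "\<And>x. (\<Xi> has_real_derivative G (\<Xi> x) * y (\<Xi> x)) (at x)"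
    using autonomous_flow[of "\<lambda>x. G x * y x" "\<mu> * \<kappa>" "\<Lambda> * R"] Gy \<mu>(1) \<kappa>0
    by (auto intro!: continuous_intros Gc yc)
  have \<Xi>grow: "\<mu> * \<kappa> * (q - p) \<le> \<Xi> q - \<Xi> p" if "p \<le> q" for p q
  proof -
    have "\<Xi> p - \<mu> * \<kappa> * p \<le> \<Xi> q - \<mu> * \<kappa> * q"
    proof (rule DERIV_nonneg_imp_nondecreasing[of p q "\<lambda>x. \<Xi> x - \<mu> * \<kappa> * x"])
      fix x
      have "((\<lambda>x. \<Xi> x - \<mu> * \<kappa> * x) has_real_derivative G (\<Xi> x) * y (\<Xi> x) - \<mu> * \<kappa> * 1) (at x)"
        by (intro DERIV_diff \<Xi> DERIV_cmult DERIV_ident)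
      then show "\<exists>d. ((\<lambda>x. \<Xi> x - \<mu> * \<kappa> * x) has_real_derivative d) (at x) \<and> 0 \<le> d"
        using Gy(1)[of "\<Xi> x"] by (intro exI[of _ "G (\<Xi> x) * y (\<Xi> x) - \<mu> * \<kappa> * 1"]) auto
    qed (use that in auto)
    then show ?thesis by (simp add: algebra_simps)
  qed
  have \<mu>\<kappa>: "0 < \<mu> * \<kappa>" using \<mu>(1) \<kappa>0 by simp
  have \<Xi>top: "filterlim \<Xi> at_top at_top"
  proof (rule filterlim_at_top_mono)
    show "filterlim (\<lambda>x. \<mu> * \<kappa> * x) at_top at_top"
      using \<mu>\<kappa> by (intro filterlim_tendsto_pos_mult_at_top[OF tendsto_const] filterlim_ident)
    show "\<forall>\<^sub>F x in at_top. \<mu> * \<kappa> * x \<le> \<Xi> x"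
      using eventually_ge_at_top[of 0] by eventually_elim (use \<Xi>grow[of 0] \<Xi>0 in auto)
  qed
  have \<Xi>bot: "filterlim \<Xi> at_bot at_bot"
  proof -
    have "filterlim (\<lambda>x. - \<Xi> (- x)) at_top at_top"
    proof (rule filterlim_at_top_mono)
      show "filterlim (\<lambda>x. \<mu> * \<kappa> * x) at_top at_top"
        using \<mu>\<kappa> by (intro filterlim_tendsto_pos_mult_at_top[OF tendsto_const] filterlim_ident)
      show "\<forall>\<^sub>F x in at_top. \<mu> * \<kappa> * x \<le> - \<Xi> (- x)"
        using eventually_ge_at_top[of 0]
      proof eventually_elim
        case (elim x)
        then show ?case using \<Xi>grow[of "- x" 0] \<Xi>0 by simp
      qed
    qed
    then show ?thesis by (simp add: filterlim_at_bot_mirror filterlim_uminus_at_top)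
  qed
  show thesis
  proof (rule that[of \<kappa> "\<lambda>x. y (\<Xi> x)" R "\<lambda>x. s (\<Xi> x)"])
    show "s (\<Xi> 0) = 1 / 2" by (simp add: \<Xi>0 s_def logistic_def)
    fix x
    have "((\<lambda>x. s (\<Xi> x)) has_real_derivative - (s (\<Xi> x) * (1 - s (\<Xi> x))) * (G (\<Xi> x) * y (\<Xi> x))) (at x)"
      by (rule DERIV_chain2[OF s' \<Xi>])
    moreover have "- (s (\<Xi> x) * (1 - s (\<Xi> x))) * (G (\<Xi> x) * y (\<Xi> x)) = - (g (s (\<Xi> x)) * y (\<Xi> x))"
      using sne[of "\<Xi> x"] by (simp add: G_def)
    ultimately show "((\<lambda>x. s (\<Xi> x)) has_real_derivative - (g (s (\<Xi> x)) * y (\<Xi> x))) (at x)"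
      by (rule DERIV_cong)
    have "((\<lambda>x. y (\<Xi> x)) has_real_derivative (g' (s (\<Xi> x)) * y (\<Xi> x) - c + 1 / y (\<Xi> x)) / G (\<Xi> x) * (G (\<Xi> x) * y (\<Xi> x))) (at x)"
      by (rule DERIV_chain2[OF y' \<Xi>])
    moreover have "(g' (s (\<Xi> x)) * y (\<Xi> x) - c + 1 / y (\<Xi> x)) / G (\<Xi> x) * (G (\<Xi> x) * y (\<Xi> x))
        = g' (s (\<Xi> x)) * (y (\<Xi> x))\<^sup>2 - c * y (\<Xi> x) + 1"
      using G0[of "\<Xi> x"] y0[of "\<Xi> x"] by (simp add: power2_eq_square field_simps)
    ultimately show "((\<lambda>x. y (\<Xi> x)) has_real_derivative g' (s (\<Xi> x)) * (y (\<Xi> x))\<^sup>2 - c * y (\<Xi> x) + 1) (at x)"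
      by (rule DERIV_cong)
    show "((\<lambda>x. s (\<Xi> x)) \<longlongrightarrow> 1) at_bot" "((\<lambda>x. s (\<Xi> x)) \<longlongrightarrow> 0) at_top"
      unfolding s_def by (rule filterlim_compose[OF logistic_limits(2) \<Xi>bot] filterlim_compose[OF logistic_limits(1) \<Xi>top])+
  qed (use \<kappa>0 y\<kappa> yR s01 in auto)
qed

text \<open>The consequences of concavity that the construction uses: the slopes lie between those at the
endpoints, and \<open>g\<close> is comparable to \<open>u (1 - u)\<close>. The lower bound comes from the chords to the
midpoint, the upper bound from the tangents at the endpoints.\<close>
lemma concave_unit_interval_bounds:
  fixes g g' :: "real \<Rightarrow> real"
  assumes dg: "\<And>x. (g has_real_derivative g' x) (at x)" and g'c: "continuous_on UNIV g'"
    and conc: "concave_on {0..1} g" and z: "g 0 = 0" "g 1 = 0"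
    and nz: "\<And>x. 0 < x \<Longrightarrow> x < 1 \<Longrightarrow> g x \<noteq> 0" and g0: "0 < g' 0"
  shows "\<And>u. 0 \<le> u \<Longrightarrow> u \<le> 1 \<Longrightarrow> g' 1 \<le> g' u" "\<And>u. 0 \<le> u \<Longrightarrow> u \<le> 1 \<Longrightarrow> g' u \<le> g' 0"
    "0 < g (1/2)" "\<And>u. 0 \<le> u \<Longrightarrow> u \<le> 1 \<Longrightarrow> 2 * g (1/2) * (u * (1 - u)) \<le> g u"
    "\<And>u. 0 \<le> u \<Longrightarrow> u \<le> 1 \<Longrightarrow> g u \<le> 2 * max (g' 0) (- g' 1) * (u * (1 - u))"
proof -
  have cv: "convex_on {0..1} (\<lambda>x. - g x)" using conc by (simp add: concave_on_def)
  have tang: "g y \<le> g x + g' x * (y - x)" if "0 < x" "x < 1" "0 \<le> y" "y \<le> 1" for x y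
  proof -
    have "((\<lambda>x. - g x) has_real_derivative - g' x) (at x within {0..1})"
      using dg[of x] by (intro DERIV_minus) (rule has_field_derivative_at_within)
    then have "(- g y) - (- g x) \<ge> - g' x * (y - x)"
      using that by (intro convex_on_imp_above_tangent[OF cv]) auto
    then show ?thesis by (simp add: algebra_simps)
  qed
  have anti: "g' y \<le> g' x" if "0 < x" "x < y" "y < 1" for x y
  proof -
    have "(g' y - g' x) * (y - x) \<le> 0"
      using tang[of x y] tang[of y x] that by (simp add: algebra_simps)
    then show ?thesis using that by (simp add: mult_le_0_iff)
  qed
  have g'at: "(g' \<longlongrightarrow> g' x) (at x within S)" for x S
    using g'c by (meson UNIV_I continuous_on_def continuous_on_subset continuous_within subset_UNIV
        continuous_on_eq_continuous_within tendsto_within_subset)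
  have hi: "g' u \<le> g' 0" if "0 < u" "u < 1" for u
  proof (rule tendsto_lowerbound[OF g'at[of 0 "{0<..}"]])
    show "\<forall>\<^sub>F x in at_right 0. g' u \<le> g' x"
      using that anti by (intro eventually_at_rightI[of 0 u]) (auto intro: anti)
  qed simp
  have lo: "g' 1 \<le> g' u" if "0 < u" "u < 1" for u
  proof (rule tendsto_upperbound[OF g'at[of 1 "{..<1}"]])
    show "\<forall>\<^sub>F x in at_left 1. g' x \<le> g' u"
      using that anti by (intro eventually_at_leftI[of u 1]) (auto intro: anti)
  qed simp
  have "g' 1 \<le> g' 0" using hi[of "1/2"] lo[of "1/2"] by simp
  then show lo': "g' 1 \<le> g' u" if "0 \<le> u" "u \<le> 1" for u
    using that lo[of u] by (cases "u = 0"; cases "u = 1") auto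
  show hi': "g' u \<le> g' 0" if "0 \<le> u" "u \<le> 1" for u
    using that hi[of u] \<open>g' 1 \<le> g' 0\<close> by (cases "u = 0"; cases "u = 1") auto
  have up0: "g u \<le> g' 0 * u" if "0 \<le> u" "u \<le> 1" for u
  proof -
    have "g u - g' 0 * u \<le> g 0 - g' 0 * 0"
    proof (rule DERIV_nonpos_imp_nonincreasing[of 0 u "\<lambda>u. g u - g' 0 * u"])
      fix x assume x: "0 \<le> x" "x \<le> u"
      have "((\<lambda>u. g u - g' 0 * u) has_real_derivative g' x - g' 0 * 1) (at x)"
        by (intro DERIV_diff dg DERIV_cmult DERIV_ident)
      then show "\<exists>d. ((\<lambda>u. g u - g' 0 * u) has_real_derivative d) (at x) \<and> d \<le> 0"
        using hi'[of x] x that by (intro exI[of _ "g' x - g' 0 * 1"]) auto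
    qed (use that in auto)
    then show ?thesis using z by simp
  qed
  have up1: "g u \<le> - g' 1 * (1 - u)" if "0 \<le> u" "u \<le> 1" for u
  proof -
    have "g u - g' 1 * u \<le> g 1 - g' 1 * 1"
    proof (rule DERIV_nonneg_imp_nondecreasing[of u 1 "\<lambda>u. g u - g' 1 * u"])
      fix x assume x: "u \<le> x" "x \<le> 1"
      have "((\<lambda>u. g u - g' 1 * u) has_real_derivative g' x - g' 1 * 1) (at x)"
        by (intro DERIV_diff dg DERIV_cmult DERIV_ident)
      then show "\<exists>d. ((\<lambda>u. g u - g' 1 * u) has_real_derivative d) (at x) \<and> 0 \<le> d"
        using lo'[of x] x that by (intro exI[of _ "g' x - g' 1 * 1"]) auto
    qed (use that in auto)
    then show ?thesis using z by (simp add: algebra_simps)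
  qed
  have nonneg: "0 \<le> g u" if "0 \<le> u" "u \<le> 1" for u
  proof -
    have "- g ((1 - u) *\<^sub>R 0 + u *\<^sub>R 1) \<le> (1 - u) * - g 0 + u * - g 1"
      using that by (intro convex_onD[OF cv]) auto
    then show ?thesis using z by simp
  qed
  then show half: "0 < g (1/2)" using nz[of "1/2"] by (simp add: order_less_le)
  show "2 * g (1/2) * (u * (1 - u)) \<le> g u" if u: "0 \<le> u" "u \<le> 1" for u
  proof (cases "u \<le> 1/2")
    case True
    have "- g ((1 - 2 * u) *\<^sub>R 0 + (2 * u) *\<^sub>R (1/2)) \<le> (1 - 2 * u) * - g 0 + (2 * u) * - g (1/2)"
      using u True by (intro convex_onD[OF cv]) auto
    then have "2 * g (1/2) * u \<le> g u" using z by (simp add: mult_ac)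
    moreover have "2 * g (1/2) * (u * (1 - u)) \<le> 2 * g (1/2) * u"
      using u half by (intro mult_left_mono) (auto simp: mult_left_le)
    ultimately show ?thesis by linarith
  next
    case False
    have "- g ((1 - 2 * (1 - u)) *\<^sub>R 1 + (2 * (1 - u)) *\<^sub>R (1/2)) \<le> (1 - 2 * (1 - u)) * - g 1 + (2 * (1 - u)) * - g (1/2)"
      using u False by (intro convex_onD[OF cv]) auto
    moreover have "(1 - 2 * (1 - u)) *\<^sub>R 1 + (2 * (1 - u)) *\<^sub>R (1/2) = u"
      by (simp add: field_simps)
    ultimately have "2 * g (1/2) * (1 - u) \<le> g u" using z by (simp add: algebra_simps)
    moreover have "2 * g (1/2) * (u * (1 - u)) \<le> 2 * g (1/2) * (1 - u)"
      using u half by (intro mult_left_mono) (auto simp: mult_left_le_one_le)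
    ultimately show ?thesis by linarith
  qed
  show "g u \<le> 2 * max (g' 0) (- g' 1) * (u * (1 - u))" if u: "0 \<le> u" "u \<le> 1" for u
  proof -
    define M where "M = max (g' 0) (- g' 1)"
    have M: "0 \<le> M" "g' 0 \<le> M" "- g' 1 \<le> M" using g0 by (auto simp: M_def)
    show ?thesis unfolding M_def[symmetric]
    proof (cases "u \<le> 1/2")
      case True
      have "g u \<le> M * u" using up0[OF u] M u by (meson mult_right_mono order_trans)
      also have "\<dots> \<le> M * (2 * (u * (1 - u)))"
        using True u M by (intro mult_left_mono) (auto simp: mult_left_le algebra_simps mult_right_mono
            intro: order_trans[OF _ mult_left_mono[of 1 "2 * (1-u)" u]])
      finally show "g u \<le> 2 * M * (u * (1 - u))" by simp
    next
      case False
      have "g u \<le> M * (1 - u)" using up1[OF u] M u by (smt (verit) mult_right_mono)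
      also have "\<dots> \<le> M * (2 * (u * (1 - u)))"
      proof (intro mult_left_mono)
        have "1 * (1 - u) \<le> (2 * u) * (1 - u)" using False u by (intro mult_right_mono) auto
        then show "1 - u \<le> 2 * (u * (1 - u))" by simp
      qed (use M in auto)
      finally show "g u \<le> 2 * M * (u * (1 - u))" by simp
    qed
  qed
qed

section \<open>The linearisation at the front\<close>

text \<open>With \<open>p = g(\<phi>) \<rho>\<close>, so that \<open>\<phi>' = - p\<close>, this is the second order equation of the front in the form
\<open>p' = g(\<phi>) - c p\<close>.\<close>
lemma front_slope_deriv:
  fixes g g' \<phi> \<rho> :: "real \<Rightarrow> real"
  assumes dg: "\<And>x. (g has_real_derivative g' x) (at x)"
    and \<phi>: "\<And>x. (\<phi> has_real_derivative - (g (\<phi> x) * \<rho> x)) (at x)"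
    and \<rho>: "\<And>x. (\<rho> has_real_derivative g' (\<phi> x) * (\<rho> x)\<^sup>2 - c * \<rho> x + 1) (at x)"
  shows "((\<lambda>x. g (\<phi> x) * \<rho> x) has_real_derivative g (\<phi> x) - c * (g (\<phi> x) * \<rho> x)) (at x)"
proof -
  have "((\<lambda>x. g (\<phi> x) * \<rho> x) has_real_derivative g' (\<phi> x) * - (g (\<phi> x) * \<rho> x) * \<rho> x +
      (g' (\<phi> x) * (\<rho> x)\<^sup>2 - c * \<rho> x + 1) * g (\<phi> x)) (at x)"
    by (rule DERIV_mult[OF DERIV_chain2[OF dg \<phi>] \<rho>])
  moreover have "g' (\<phi> x) * - (g (\<phi> x) * \<rho> x) * \<rho> x + (g' (\<phi> x) * (\<rho> x)\<^sup>2 - c * \<rho> x + 1) * g (\<phi> x)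
      = g (\<phi> x) - c * (g (\<phi> x) * \<rho> x)"
    by (simp add: power2_eq_square algebra_simps)
  ultimately show ?thesis by (rule DERIV_cong)
qed

text \<open>The slope is bounded and its integral is the total variation of \<open>\<phi>\<close>, which is at most 1.\<close>
lemma front_slope_sq_integrable:
  fixes \<phi> p :: "real \<Rightarrow> real"
  assumes \<phi>: "\<And>x. (\<phi> has_real_derivative - p x) (at x)" and p: "continuous_on UNIV p"
    and b: "\<And>x. 0 < \<phi> x" "\<And>x. \<phi> x < 1" and pb: "\<And>x. 0 \<le> p x" "\<And>x. p x \<le> B"
  shows "sq_integrable p"
proof -
  have B0: "0 \<le> B" using pb[of 0] by linarith
  define G where "G = antideriv (\<lambda>x. (p x)\<^sup>2)"
  have G: "(G has_real_derivative (p x)\<^sup>2) (at x)" for x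
    unfolding G_def by (intro antideriv_deriv continuous_intros p)
  have "G (real N) - G (- real N) \<le> (sqrt B)\<^sup>2" for N :: nat
  proof -
    have "- B * \<phi> (- real N) - G (- real N) \<le> - B * \<phi> (real N) - G (real N)"
    proof (rule DERIV_nonneg_imp_nondecreasing[of "- real N" "real N" "\<lambda>x. - B * \<phi> x - G x"])
      fix x
      have "((\<lambda>x. - B * \<phi> x - G x) has_real_derivative - B * - p x - (p x)\<^sup>2) (at x)"
        by (intro DERIV_diff DERIV_cmult \<phi> G)
      moreover have "0 \<le> - B * - p x - (p x)\<^sup>2"
        using mult_right_mono[OF pb(2) pb(1), of x x] by (simp add: power2_eq_square)
      ultimately show "\<exists>d. ((\<lambda>x. - B * \<phi> x - G x) has_real_derivative d) (at x) \<and> 0 \<le> d" by blast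
    qed simp
    then have "G (real N) - G (- real N) \<le> B * (\<phi> (- real N) - \<phi> (real N))" by (simp add: algebra_simps)
    also have "\<dots> \<le> B * 1" using b(1)[of "real N"] b(2)[of "- real N"] B0 by (intro mult_left_mono) linarith+
    finally show ?thesis using B0 by simp
  qed
  from sq_integrable_compact(1)[OF p _ G this] show ?thesis using B0 by simp
qed

text \<open>For the operator \<open>d\<^sup>2 + c d + V\<close>, with a bound from \<open>L\<^sup>2\<close> to \<open>H\<^sup>1\<close>.\<close>
definition L2_right_inverse :: "real \<Rightarrow> (real \<Rightarrow> real) \<Rightarrow> real \<Rightarrow> bool" where
  "L2_right_inverse c V C \<longleftrightarrow> (\<forall>f. sq_integrable f \<longrightarrow> (\<exists>w w1 w2.
     (\<forall>x. (w has_real_derivative w1 x) (at x)) \<and> (\<forall>x. (w1 has_real_derivative w2 x) (at x)) \<and>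
     (\<forall>x. w2 x + c * w1 x + V x * w x = f x) \<and>
     sq_integrable w \<and> sq_integrable w1 \<and> l2norm w \<le> C * l2norm f \<and> l2norm w1 \<le> C * l2norm f))"

text \<open>Put \<open>p = g(\<phi>) \<rho> = - \<phi>'\<close>. Then \<open>p' / p = 1/\<rho> - c\<close>, and since \<open>p\<close> lies in the kernel of the linearisation,
the latter factorises as \<open>(d + 1/\<rho>) (d - p'/p)\<close>. The first factor is uniformly stable and is inverted from
\<open>-\<infinity>\<close>; the second is inverted by \<open>y \<mapsto> p \<integral>\<^sub>0 y/p\<close>, which is bounded because \<open>p\<close> is
comparable to \<open>\<phi>\<close> on the right half-line and to \<open>1 - \<phi>\<close> on the left one, and these decay
exponentially.\<close>
lemma linearised_front_right_inverse:
  fixes g g' \<phi> \<rho> :: "real \<Rightarrow> real"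
  assumes dg: "\<And>x. (g has_real_derivative g' x) (at x)"
    and \<mu>: "0 < \<mu>" "\<And>u. 0 \<le> u \<Longrightarrow> u \<le> 1 \<Longrightarrow> \<mu> * (u * (1 - u)) \<le> g u"
    and \<Lambda>: "\<And>u. 0 \<le> u \<Longrightarrow> u \<le> 1 \<Longrightarrow> g u \<le> \<Lambda> * (u * (1 - u))"
    and \<kappa>: "0 < \<kappa>" "\<And>x. \<kappa> \<le> \<rho> x" and R: "\<And>x. \<rho> x \<le> R"
    and b: "\<And>x. 0 < \<phi> x" "\<And>x. \<phi> x < 1" and half: "\<phi> 0 = 1 / 2"
    and \<phi>: "\<And>x. (\<phi> has_real_derivative - (g (\<phi> x) * \<rho> x)) (at x)"
    and \<rho>: "\<And>x. (\<rho> has_real_derivative g' (\<phi> x) * (\<rho> x)\<^sup>2 - c * \<rho> x + 1) (at x)"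
  obtains C where "0 < C" "L2_right_inverse c (\<lambda>x. g' (\<phi> x)) C"
proof -
  have \<rho>0: "0 < \<rho> x" for x using \<kappa>(1) \<kappa>(2)[of x] by linarith
  have \<rho>ne: "\<rho> x \<noteq> 0" for x using \<rho>0[of x] by simp
  have R0: "0 < R" using \<rho>0[of 0] R[of 0] by linarith
  have \<rho>c: "continuous_on UNIV \<rho>" by (rule has_real_derivative_continuous_on[OF \<rho>])
  define p where "p x = g (\<phi> x) * \<rho> x" for x
  have p: "(p has_real_derivative g (\<phi> x) - c * p x) (at x)" for x
    unfolding p_def[abs_def] by (rule front_slope_deriv[OF dg \<phi> \<rho>])
  have pc: "continuous_on UNIV p" by (rule has_real_derivative_continuous_on[OF p])
  have gpos: "0 < g (\<phi> x)" for x
  proof -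
    have "0 < \<mu> * (\<phi> x * (1 - \<phi> x))" using \<mu>(1) b[of x] by simp
    then show ?thesis using \<mu>(2)[of "\<phi> x"] b[of x] by linarith
  qed
  have ppos: "0 < p x" for x using gpos \<rho>0 by (simp add: p_def)
  have \<Lambda>0: "0 < \<Lambda>"
  proof -
    have "\<mu> * (1/2 * (1 - 1/2)) \<le> \<Lambda> * (1/2 * (1 - 1/2))" using \<mu>(2)[of "1/2"] \<Lambda>[of "1/2"] by linarith
    then show ?thesis using \<mu>(1) by simp
  qed
  have \<phi>mono: "\<phi> t \<le> \<phi> s" if "s \<le> t" for s t
  proof (rule DERIV_nonpos_imp_nonincreasing[OF that])
    fix x show "\<exists>d. (\<phi> has_real_derivative d) (at x) \<and> d \<le> 0"
      using \<phi>[of x] gpos[of x] \<rho>0[of x] by (intro exI[of _ "- (g (\<phi> x) * \<rho> x)"]) simp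
  qed
  define \<delta> where "\<delta> = \<mu> * \<kappa> / 2"
  have \<delta>: "0 < \<delta>" using \<mu> \<kappa> by (simp add: \<delta>_def)
  have plow: "\<mu> * (\<phi> x * (1 - \<phi> x)) * \<kappa> \<le> p x" for x
    unfolding p_def using \<mu> \<kappa> b[of x] gpos[of x] by (intro mult_mono) auto
  have pup: "p x \<le> \<Lambda> * (\<phi> x * (1 - \<phi> x)) * R" for x
    unfolding p_def using \<Lambda>[of "\<phi> x"] R[of x] b[of x] \<rho>0[of x] \<Lambda>0 by (intro mult_mono) auto
  have plow0: "\<delta> * \<phi> x \<le> p x" if "0 \<le> x" for x
  proof -
    have "\<phi> x \<le> 1/2" using \<phi>mono[OF that] half by simp
    then have "\<mu> * (\<phi> x * (1/2)) * \<kappa> \<le> \<mu> * (\<phi> x * (1 - \<phi> x)) * \<kappa>"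
      using \<mu>(1) \<kappa>(1) b(1)[of x] by (intro mult_right_mono mult_left_mono) auto
    with plow[of x] have "\<mu> * (\<phi> x * (1/2)) * \<kappa> \<le> p x" by linarith
    then show ?thesis by (simp add: \<delta>_def mult_ac)
  qed
  have plow1: "\<delta> * (1 - \<phi> x) \<le> p x" if "x \<le> 0" for x
  proof -
    have "1/2 \<le> \<phi> x" using \<phi>mono[OF that] half by simp
    then have "\<mu> * (1/2 * (1 - \<phi> x)) * \<kappa> \<le> \<mu> * (\<phi> x * (1 - \<phi> x)) * \<kappa>"
      using \<mu>(1) \<kappa>(1) b(2)[of x] by (intro mult_right_mono mult_left_mono) auto
    with plow[of x] have "\<mu> * (1/2 * (1 - \<phi> x)) * \<kappa> \<le> p x" by linarith
    then show ?thesis by (simp add: \<delta>_def mult_ac)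
  qed
  have pup0: "p x \<le> \<Lambda> * R * \<phi> x" "p x \<le> \<Lambda> * R * (1 - \<phi> x)" for x
  proof -
    have "\<Lambda> * (\<phi> x * (1 - \<phi> x)) * R \<le> \<Lambda> * (\<phi> x * 1) * R"
      using b[of x] \<Lambda>0 R0 by (intro mult_right_mono mult_left_mono) auto
    then show "p x \<le> \<Lambda> * R * \<phi> x" using pup[of x] by (simp add: mult_ac)
    have "\<Lambda> * (\<phi> x * (1 - \<phi> x)) * R \<le> \<Lambda> * (1 * (1 - \<phi> x)) * R"
      using b[of x] \<Lambda>0 R0 by (intro mult_right_mono mult_left_mono) auto
    then show "p x \<le> \<Lambda> * R * (1 - \<phi> x)" using pup[of x] by (simp add: mult_ac)
  qed
  define q where "q x = 1 / \<rho> x - c" for x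
  define Q where "Q = 1 / \<kappa> + \<bar>c\<bar>"
  have qc: "continuous_on UNIV q" unfolding q_def using \<rho>ne by (intro continuous_intros \<rho>c) auto
  have qQ: "\<bar>q x\<bar> \<le> Q" for x
  proof -
    have "0 < 1 / \<rho> x" "1 / \<rho> x \<le> 1 / \<kappa>" using \<rho>0[of x] \<kappa> by (auto intro!: frac_le)
    then show ?thesis unfolding q_def Q_def by linarith
  qed
  have Q0: "0 \<le> Q" using qQ[of 0] by linarith
  define A where "A = \<Lambda> * R / (\<delta> * \<delta>)"
  have A0: "0 \<le> A" unfolding A_def using \<Lambda>0 R0 \<delta> by simp
  define C where "C = A * R + Q * (A * R) + R + 1"
  have "0 \<le> A * R" "0 \<le> Q * (A * R)" using A0 R0 Q0 by auto
  then have C: "0 < C" "A * R \<le> C" "Q * (A * R) + R \<le> C" using R0 unfolding C_def by linarith+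
  show thesis
  proof (rule that[OF C(1)], unfold L2_right_inverse_def, intro allI impI)
    fix f assume f: "sq_integrable f"
    have e: "1 / R \<le> 1 / \<rho> x" for x using R[of x] \<rho>0[of x] by (simp add: frac_le)
    have ec: "continuous_on UNIV (\<lambda>x. 1 / \<rho> x)" using \<rho>ne by (intro continuous_intros \<rho>c) auto
    obtain y where y: "\<And>x. (y has_real_derivative - (1 / \<rho> x) * y x + f x) (at x)"
      and ysq: "sq_integrable y" and yn: "l2norm y \<le> l2norm f / (1 / R)"
      using linear_ode_L2[OF ec f _ e] R0 by auto
    have yn: "l2norm y \<le> R * l2norm f" using yn by (simp add: mult.commute)
    define Y where "Y = antideriv (\<lambda>x. y x / p x)"
    have pne: "p x \<noteq> 0" for x using ppos[of x] by simp
    have Y: "(Y has_real_derivative y x / p x) (at x)" for x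
      unfolding Y_def using pne by (intro antideriv_deriv continuous_intros pc sq_integrableD(1)[OF ysq]) auto
    define w where "w x = p x * Y x" for x
    define w1 where "w1 x = q x * w x + y x" for x
    have n: "\<phi> x \<noteq> 0" "1 - \<phi> x \<noteq> 0" for x using b[of x] by auto
    have d\<phi>: "(\<phi> has_real_derivative - (p x / \<phi> x) * \<phi> x) (at x)" for x
      using \<phi>[of x] n[of x] by (simp add: p_def)
    have d\<psi>: "((\<lambda>x. 1 - \<phi> x) has_real_derivative (p x / (1 - \<phi> x)) * (1 - \<phi> x)) (at x)" for x
    proof -
      have "((\<lambda>x. 1 - \<phi> x) has_real_derivative 0 - - (g (\<phi> x) * \<rho> x)) (at x)"
        by (intro DERIV_diff DERIV_const \<phi>)
      then show ?thesis using n[of x] by (simp add: p_def)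
    qed
    have \<psi>pos: "0 < 1 - \<phi> x" for x using b(2)[of x] by simp
    have rates: "0 \<le> x \<Longrightarrow> \<delta> \<le> p x / \<phi> x" "x \<le> 0 \<Longrightarrow> \<delta> \<le> p x / (1 - \<phi> x)" for x
      using plow0[of x] plow1[of x] b[of x] by (simp_all add: le_divide_eq)
    have \<Lambda>R: "0 \<le> \<Lambda> * R" using \<Lambda>0 R0 by simp
    have Y0: "Y 0 = 0" by (simp add: Y_def)
    have pY: "sq_integrable w" "l2norm w \<le> \<Lambda> * R / (\<delta> * \<delta>) * l2norm y" unfolding w_def[abs_def]
      by (rule weighted_antideriv_L2[OF pc d\<phi> b(1) d\<psi> \<psi>pos \<delta> rates \<delta> \<Lambda>R plow0 pup0(1) plow1 pup0(2) ysq Y0 Y];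
          assumption)+
    have "l2norm w \<le> A * l2norm y" using pY(2) by (simp add: A_def)
    also have "\<dots> \<le> A * (R * l2norm f)" using yn A0 by (intro mult_left_mono) auto
    finally have wn: "l2norm w \<le> A * R * l2norm f" by simp
    have w: "(w has_real_derivative w1 x) (at x)" for x
    proof -
      have "(w has_real_derivative (g (\<phi> x) - c * p x) * Y x + y x / p x * p x) (at x)"
        unfolding w_def[abs_def] by (rule DERIV_mult[OF p Y])
      moreover have "(g (\<phi> x) - c * p x) * Y x + y x / p x * p x = w1 x"
        using \<rho>ne[of x] pne[of x] by (simp add: w1_def w_def q_def p_def field_simps)
      ultimately show ?thesis by simp
    qed
    have w1sq: "sq_integrable w1" "l2norm w1 \<le> Q * l2norm w + l2norm y"
      unfolding w1_def[abs_def]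
      using sq_integrable_add[OF sq_integrable_mult_bounded(1)[OF qc pY(1) qQ] ysq]
        sq_integrable_mult_bounded(2)[OF qc pY(1) qQ] by auto
    have "Q * l2norm w \<le> Q * (A * R * l2norm f)" using wn Q0 by (intro mult_left_mono) auto
    then have w1n: "l2norm w1 \<le> (Q * (A * R) + R) * l2norm f"
      using w1sq(2) yn by (simp add: algebra_simps)
    define r where "r x = g' (\<phi> x) * (\<rho> x)\<^sup>2 - c * \<rho> x + 1" for x
    define w2 where "w2 x = - (r x / (\<rho> x)\<^sup>2) * w x + w1 x * q x + (- (1 / \<rho> x) * y x + f x)" for x
    have w2: "(w1 has_real_derivative w2 x) (at x)" for x
    proof -
      have "(q has_real_derivative - (r x / (\<rho> x)\<^sup>2)) (at x)"
        unfolding q_def[abs_def] r_def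
        using \<rho>ne[of x] by (auto intro!: derivative_eq_intros \<rho> simp: power2_eq_square field_simps)
      then show ?thesis unfolding w1_def[abs_def] w2_def by (intro DERIV_add DERIV_mult w[unfolded w1_def[abs_def]] y | simp add: w1_def)+
    qed
    have eq: "w2 x + c * w1 x + g' (\<phi> x) * w x = f x" for x
      unfolding w2_def w1_def r_def q_def using \<rho>ne[of x] by (simp add: field_simps power2_eq_square)
    have "l2norm w \<le> C * l2norm f" "l2norm w1 \<le> C * l2norm f"
      using wn w1n C mult_right_mono[OF C(2), of "l2norm f"] mult_right_mono[OF C(3), of "l2norm f"] by auto
    then show "\<exists>w w1 w2.
     (\<forall>x. (w has_real_derivative w1 x) (at x)) \<and> (\<forall>x. (w1 has_real_derivative w2 x) (at x)) \<and>
     (\<forall>x. w2 x + c * w1 x + g' (\<phi> x) * w x = f x) \<and>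
     sq_integrable w \<and> sq_integrable w1 \<and> l2norm w \<le> C * l2norm f \<and> l2norm w1 \<le> C * l2norm f"
      using w w2 eq pY(1) w1sq(1) by blast
  qed
qed

section \<open>Finite differences\<close>

definition H1_pair :: "(real \<Rightarrow> real) \<Rightarrow> (real \<Rightarrow> real) \<Rightarrow> bool" where
  "H1_pair f f' \<longleftrightarrow> sq_integrable f \<and> sq_integrable f' \<and> (\<forall>x. (f has_real_derivative f' x) (at x))"

lemma H1_pairD:
  assumes "H1_pair f f'"
  shows "sq_integrable f" "sq_integrable f'" "(f has_real_derivative f' x) (at x)"
    "continuous_on UNIV f" "continuous_on UNIV f'"
  using assms sq_integrableD(1) by (auto simp: H1_pair_def)

lemma H1_pair_sup: "H1_pair f f' \<Longrightarrow> \<bar>f x\<bar> \<le> l2norm f + l2norm f'"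
  unfolding H1_pair_def by (intro sq_integrable_H1_sup) auto

lemma H1_pair_add: "H1_pair f f' \<Longrightarrow> H1_pair g g' \<Longrightarrow> H1_pair (\<lambda>x. f x + g x) (\<lambda>x. f' x + g' x)"
  and H1_pair_diff: "H1_pair f f' \<Longrightarrow> H1_pair g g' \<Longrightarrow> H1_pair (\<lambda>x. f x - g x) (\<lambda>x. f' x - g' x)"
  and H1_pair_cmult: "H1_pair f f' \<Longrightarrow> H1_pair (\<lambda>x. r * f x) (\<lambda>x. r * f' x)"
  unfolding H1_pair_def
  by (auto intro: sq_integrable_add sq_integrable_diff sq_integrable_cmult DERIV_add DERIV_diff DERIV_cmult)

lemma sq_integrable_sums:
  assumes f: "\<And>k. sq_integrable (f k)" "\<And>k. l2norm (f k) \<le> b k" and b: "summable b"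
    and F: "continuous_on UNIV F" "\<And>x. (\<lambda>k. f k x) sums F x"
  shows "sq_integrable F" "l2norm F \<le> suminf b"
proof -
  have b0: "0 \<le> b k" for k using f(2)[of k] l2norm_nonneg[of "f k"] by linarith
  have part: "sq_integrable (\<lambda>x. \<Sum>k<n. f k x) \<and> l2norm (\<lambda>x. \<Sum>k<n. f k x) \<le> (\<Sum>k<n. b k)" for n
  proof (induction n)
    case (Suc n)
    then show ?case
      using sq_integrable_add[of "\<lambda>x. \<Sum>k<n. f k x" "f n"] f(1)[of n] f(2)[of n] by force
  qed simp
  have le: "(\<Sum>k<n. b k) \<le> suminf b" for n using b b0 by (intro sum_le_suminf) auto
  have "0 \<le> suminf b" using b b0 by (intro suminf_nonneg)
  moreover have "l2norm (\<lambda>x. \<Sum>k<n. f k x) \<le> suminf b" for n using part[of n] le[of n] by linarith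
  moreover have "(\<lambda>n. \<Sum>k<n. f k x) \<longlonglongrightarrow> F x" for x using F(2) by (simp add: sums_def)
  ultimately show "sq_integrable F" "l2norm F \<le> suminf b"
    using sq_integrable_limit[OF F(1), of "suminf b" "\<lambda>n x. \<Sum>k<n. f k x"] part by auto
qed

lemma continuous_on_shift:
  fixes f :: "real \<Rightarrow> real"
  assumes "continuous_on UNIV f"
  shows "continuous_on UNIV (\<lambda>x. f (x + y))" "continuous_on UNIV (\<lambda>x. f (x - y))"
    "continuous_on UNIV (\<lambda>z. f (fst z + snd z))" "continuous_on UNIV (\<lambda>z. f (fst z - snd z))"
    "continuous_on UNIV (\<lambda>z. f (fst z))"
  by (rule continuous_on_compose2[OF assms]; auto intro!: continuous_intros)+

lemma deriv_shift:
  fixes f :: "real \<Rightarrow> real"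
  assumes "\<And>x. (f has_real_derivative f' x) (at x)"
  shows "((\<lambda>s. f (x + s)) has_real_derivative f' (x + s)) (at s)"
    "((\<lambda>s. f (x - s)) has_real_derivative - f' (x - s)) (at s)"
    "((\<lambda>x. f (x + s)) has_real_derivative f' (x + s)) (at x)"
    "((\<lambda>x. f (x - s)) has_real_derivative f' (x - s)) (at x)"
  using DERIV_chain2[OF assms DERIV_add[OF DERIV_const DERIV_ident], of x s]
    DERIV_chain2[OF assms DERIV_diff[OF DERIV_const DERIV_ident], of x s]
    DERIV_chain2[OF assms DERIV_add[OF DERIV_ident DERIV_const], of s x]
    DERIV_chain2[OF assms DERIV_diff[OF DERIV_ident DERIV_const], of s x]
  by simp_all

lemma first_difference_L2:
  assumes v: "\<And>x. (v has_real_derivative v1 x) (at x)" and v1: "sq_integrable v1" and y: "0 \<le> y"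
  shows "sq_integrable (\<lambda>x. v (x + y) - v x)" "l2norm (\<lambda>x. v (x + y) - v x) \<le> y * l2norm v1"
proof -
  have vc: "continuous_on UNIV v" by (rule has_real_derivative_continuous_on[OF v])
  have c: "continuous_on UNIV (\<lambda>x. v (x + y) - v (x + 0))"
    by (intro continuous_intros continuous_on_shift vc)
  have "sq_integrable (\<lambda>x. v (x + y) - v (x + 0)) \<and> l2norm (\<lambda>x. v (x + y) - v (x + 0)) \<le> y * l2norm v1"
    using l2norm_integral_le[of "\<lambda>x s. v1 (x + s)" "\<lambda>x s. v (x + s)" y "l2norm v1",
        OF continuous_on_shift(3)[OF sq_integrableD(1)[OF v1]] deriv_shift(1)[OF v] c y]
      sq_integrable_shift[OF v1] by simp
  then show "sq_integrable (\<lambda>x. v (x + y) - v x)" "l2norm (\<lambda>x. v (x + y) - v x) \<le> y * l2norm v1"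
    by simp_all
qed

lemma first_order_Taylor_L2:
  assumes v: "\<And>x. (v has_real_derivative v1 x) (at x)" and v1: "\<And>x. (v1 has_real_derivative v2 x) (at x)"
    and v2: "sq_integrable v2" and y: "0 \<le> y"
  shows "sq_integrable (\<lambda>x. v (x + y) - v x - y * v1 x)"
    "l2norm (\<lambda>x. v (x + y) - v x - y * v1 x) \<le> y\<^sup>2 * l2norm v2"
proof -
  have vc: "continuous_on UNIV v" by (rule has_real_derivative_continuous_on[OF v])
  have v1c: "continuous_on UNIV v1" by (rule has_real_derivative_continuous_on[OF v1])
  define \<Phi> where "\<Phi> x s = v (x + s) - s * v1 x" for x s
  have eq: "\<Phi> x y - \<Phi> x 0 = v (x + y) - v x - y * v1 x" for x by (simp add: \<Phi>_def)
  have c: "continuous_on UNIV (\<lambda>x. \<Phi> x y - \<Phi> x 0)"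
    unfolding \<Phi>_def by (intro continuous_intros continuous_on_shift vc v1c)
  have d: "(\<Phi> x has_real_derivative v1 (x + s) - v1 x) (at s)" for x s
  proof -
    have "((\<lambda>s. v (x + s) - s * v1 x) has_real_derivative v1 (x + s) - 1 * v1 x) (at s)"
      by (intro DERIV_diff deriv_shift(1)[OF v] DERIV_cmult_right DERIV_ident)
    then show ?thesis by (simp add: \<Phi>_def[abs_def])
  qed
  have fc: "continuous_on UNIV (\<lambda>z. v1 (fst z + snd z) - v1 (fst z))"
    by (intro continuous_intros continuous_on_shift v1c)
  have "sq_integrable (\<lambda>x. \<Phi> x y - \<Phi> x 0)" "l2norm (\<lambda>x. \<Phi> x y - \<Phi> x 0) \<le> y * (y * l2norm v2)"
  proof (rule_tac [!] l2norm_integral_le[OF fc d c y])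
    fix s assume s: "0 \<le> s" "s \<le> y"
    have "l2norm (\<lambda>x. v1 (x + s) - v1 x) \<le> s * l2norm v2"
      by (rule first_difference_L2[OF v1 v2 s(1)])
    also have "\<dots> \<le> y * l2norm v2" using s by (intro mult_right_mono) auto
    finally have t: "l2norm (\<lambda>x. v1 (x + s) - v1 x) \<le> y * l2norm v2" .
    show "l2norm (\<lambda>x. v1 (x + s) - v1 x) \<le> y * l2norm v2" 
      "l2norm (\<lambda>x. v1 (x + s) - v1 x) \<le> y * l2norm v2" by (rule t)+
  qed (use y first_difference_L2[OF v1 v2] in auto)
  then show "sq_integrable (\<lambda>x. v (x + y) - v x - y * v1 x)"
    "l2norm (\<lambda>x. v (x + y) - v x - y * v1 x) \<le> y\<^sup>2 * l2norm v2"
    unfolding eq by (simp_all add: power2_eq_square)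
qed

text \<open>The remainder is the integral over \<open>0 \<le> s \<le> y\<close> of the difference of the two first order Taylor
remainders of \<open>w'\<close> at \<open>x\<close> with increments \<open>s\<close> and \<open>-s\<close>. The bound involves no derivative beyond \<open>w'''\<close>,
because the solutions of the linearised front equation to which it is applied have no fourth one.\<close>
lemma second_difference_consistency:
  assumes w: "\<And>x. (w has_real_derivative w1 x) (at x)" and w1: "\<And>x. (w1 has_real_derivative w2 x) (at x)"
    and w2: "\<And>x. (w2 has_real_derivative w3 x) (at x)" and w3: "sq_integrable w3" and y: "0 \<le> y"
  shows "sq_integrable (\<lambda>x. w (x + y) - 2 * w x + w (x - y) - y\<^sup>2 * w2 x)"
    "l2norm (\<lambda>x. w (x + y) - 2 * w x + w (x - y) - y\<^sup>2 * w2 x) \<le> 2 * y ^ 3 * l2norm w3"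
proof -
  have wc: "continuous_on UNIV w" by (rule has_real_derivative_continuous_on[OF w])
  have w1c: "continuous_on UNIV w1" by (rule has_real_derivative_continuous_on[OF w1])
  have w2c: "continuous_on UNIV w2" by (rule has_real_derivative_continuous_on[OF w2])
  define \<Phi> where "\<Phi> x s = w (x + s) + w (x - s) - s\<^sup>2 * w2 x" for x s
  define f where "f x s = w1 (x + s) - w1 (x - s) - 2 * s * w2 x" for x s
  have eq: "\<Phi> x y - \<Phi> x 0 = w (x + y) - 2 * w x + w (x - y) - y\<^sup>2 * w2 x" for x by (simp add: \<Phi>_def)
  have c: "continuous_on UNIV (\<lambda>x. \<Phi> x y - \<Phi> x 0)"
    unfolding \<Phi>_def by (intro continuous_intros continuous_on_shift wc w2c)
  have d: "(\<Phi> x has_real_derivative f x s) (at s)" for x s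
  proof -
    have "((\<lambda>s. w (x + s) + w (x - s) - s\<^sup>2 * w2 x) has_real_derivative w1 (x + s) + - w1 (x - s) - (2 * s) * w2 x) (at s)"
      using DERIV_pow[of 2 s UNIV]
      by (intro DERIV_diff DERIV_add deriv_shift(1,2)[OF w] DERIV_cmult_right) (simp add: mult.commute)
    then show ?thesis by (simp add: \<Phi>_def[abs_def] f_def)
  qed
  have fc: "continuous_on UNIV (\<lambda>z. f (fst z) (snd z))"
    unfolding f_def by (intro continuous_intros continuous_on_shift w1c w2c)
  have main: "sq_integrable (\<lambda>x. f x s) \<and> l2norm (\<lambda>x. f x s) \<le> 2 * y\<^sup>2 * l2norm w3" if s: "0 \<le> s" "s \<le> y" for s
  proof -
    have 1: "sq_integrable (\<lambda>x. w1 (x + s) - w1 x - s * w2 x)"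
      "l2norm (\<lambda>x. w1 (x + s) - w1 x - s * w2 x) \<le> s\<^sup>2 * l2norm w3"
      using first_order_Taylor_L2[OF w1 w2 w3 s(1)] by auto
    have r1: "((\<lambda>x. w1 (- x)) has_real_derivative - w2 (- x)) (at x)" for x
      using DERIV_chain2[OF w1 DERIV_minus[OF DERIV_ident]] by simp
    have r2: "((\<lambda>x. - w2 (- x)) has_real_derivative w3 (- x)) (at x)" for x
      using DERIV_minus[OF DERIV_chain2[OF w2 DERIV_minus[OF DERIV_ident]]] by simp
    have 2: "sq_integrable (\<lambda>x. w1 (- (x + s)) - w1 (- x) - s * - w2 (- x))"
      "l2norm (\<lambda>x. w1 (- (x + s)) - w1 (- x) - s * - w2 (- x)) \<le> s\<^sup>2 * l2norm w3"
      using first_order_Taylor_L2[OF r1 r2 sq_integrable_reflect(1)[OF w3] s(1)] sq_integrable_reflect(2)[OF w3]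
      by auto
    have 3: "sq_integrable (\<lambda>x. w1 (x - s) - w1 x + s * w2 x)"
      "l2norm (\<lambda>x. w1 (x - s) - w1 x + s * w2 x) \<le> s\<^sup>2 * l2norm w3"
      using sq_integrable_reflect[OF 2(1)] 2(2) by simp_all
    have eqf: "f x s = (w1 (x + s) - w1 x - s * w2 x) - (w1 (x - s) - w1 x + s * w2 x)" for x
      by (simp add: f_def)
    have "s\<^sup>2 * l2norm w3 \<le> y\<^sup>2 * l2norm w3" using s by (intro mult_right_mono power_mono) auto
    then show ?thesis unfolding eqf
      using sq_integrable_diff[OF 1(1) 3(1)] 1(2) 3(2) by auto
  qed
  have "sq_integrable (\<lambda>x. \<Phi> x y - \<Phi> x 0)" "l2norm (\<lambda>x. \<Phi> x y - \<Phi> x 0) \<le> y * (2 * y\<^sup>2 * l2norm w3)"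
    using l2norm_integral_le[OF fc d c y, of "2 * y\<^sup>2 * l2norm w3"] main by auto
  then show "sq_integrable (\<lambda>x. w (x + y) - 2 * w x + w (x - y) - y\<^sup>2 * w2 x)"
    "l2norm (\<lambda>x. w (x + y) - 2 * w x + w (x - y) - y\<^sup>2 * w2 x) \<le> 2 * y ^ 3 * l2norm w3"
    unfolding eq by (simp_all add: power2_eq_square power3_eq_cube mult_ac)
qed

section \<open>The lattice operator\<close>

definition lattice_term :: "(nat \<Rightarrow> real) \<Rightarrow> real \<Rightarrow> (real \<Rightarrow> real) \<Rightarrow> nat \<Rightarrow> real \<Rightarrow> real" where
  "lattice_term a h u k x = a (Suc k) *
     ((u (x + real (Suc k) * h) - 2 * u x + u (x - real (Suc k) * h)) / ((real (Suc k))\<^sup>2 * h\<^sup>2))"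

lemma lattice_term_eq:
  "y = real (Suc k) * h \<Longrightarrow> lattice_term a h u k x = (a (Suc k) / y\<^sup>2) * (u (x + y) - 2 * u x + u (x - y))"
  by (simp add: lattice_term_def power_mult_distrib del: of_nat_Suc)

definition lattice_lap :: "(nat \<Rightarrow> real) \<Rightarrow> real \<Rightarrow> (real \<Rightarrow> real) \<Rightarrow> real \<Rightarrow> real" where
  "lattice_lap a h u x = (\<Sum>k. lattice_term a h u k x)"

lemma summable_weights:
  fixes a :: "nat \<Rightarrow> real"
  assumes "summable (\<lambda>k. \<bar>a (Suc k)\<bar> * real (Suc k))"
  shows "summable (\<lambda>k. \<bar>a (Suc k)\<bar>)"
  by (rule summable_comparison_test'[OF assms]) (simp add: mult_le_cancel_left1)

lemma lattice_term_bound: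
  assumes u: "\<And>x. \<bar>u x\<bar> \<le> B" and h: "0 < h"
  shows "\<bar>lattice_term a h u k x\<bar> \<le> \<bar>a (Suc k)\<bar> * (4 * B / h\<^sup>2)"
proof -
  have B0: "0 \<le> B" using u[of 0] by linarith
  let ?y = "real (Suc k)"
  have n: "\<bar>u (x + ?y * h) - 2 * u x + u (x - ?y * h)\<bar> \<le> 4 * B"
    using u[of "x + ?y * h"] u[of x] u[of "x - ?y * h"] by linarith
  have "h\<^sup>2 * 1 \<le> h\<^sup>2 * ?y\<^sup>2" by (intro mult_left_mono) auto
  then have y: "h\<^sup>2 \<le> ?y\<^sup>2 * h\<^sup>2" by (simp add: mult.commute)
  have "\<bar>(u (x + ?y * h) - 2 * u x + u (x - ?y * h)) / (?y\<^sup>2 * h\<^sup>2)\<bar>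
      = \<bar>u (x + ?y * h) - 2 * u x + u (x - ?y * h)\<bar> / (?y\<^sup>2 * h\<^sup>2)"
    by (simp add: abs_divide abs_mult)
  also have "\<dots> \<le> 4 * B / h\<^sup>2" using n y h by (intro frac_le) auto
  finally show ?thesis unfolding lattice_term_def abs_mult by (intro mult_left_mono) auto
qed

context
  fixes a :: "nat \<Rightarrow> real" and h :: real
  assumes sa: "summable (\<lambda>k. \<bar>a (Suc k)\<bar> * real (Suc k))" and h: "0 < h"
begin

lemma lattice_lap_majorant: "summable (\<lambda>k. \<bar>a (Suc k)\<bar> * C)"
  by (intro summable_mult2 summable_weights sa)

lemma lattice_lap_summable:
  assumes u: "\<And>x. \<bar>u x\<bar> \<le> B"
  shows "summable (\<lambda>k. lattice_term a h u k x)" "summable (\<lambda>k. \<bar>lattice_term a h u k x\<bar>)"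
    "\<bar>lattice_lap a h u x\<bar> \<le> (\<Sum>k. \<bar>a (Suc k)\<bar>) * (4 * B / h\<^sup>2)"
proof -
  have s: "summable (\<lambda>k. \<bar>a (Suc k)\<bar> * (4 * B / h\<^sup>2))" by (intro summable_mult2 summable_weights sa)
  show 1: "summable (\<lambda>k. \<bar>lattice_term a h u k x\<bar>)"
    by (rule summable_comparison_test'[OF s, of 0]) (use lattice_term_bound[OF u h] in simp)
  then show "summable (\<lambda>k. lattice_term a h u k x)" by (rule summable_rabs_cancel)
  have "\<bar>lattice_lap a h u x\<bar> \<le> (\<Sum>k. \<bar>lattice_term a h u k x\<bar>)" unfolding lattice_lap_def by (rule summable_rabs[OF 1])
  also have "\<dots> \<le> (\<Sum>k. \<bar>a (Suc k)\<bar> * (4 * B / h\<^sup>2))"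
    by (intro suminf_le lattice_term_bound[OF u h] 1 s)
  also have "\<dots> = (\<Sum>k. \<bar>a (Suc k)\<bar>) * (4 * B / h\<^sup>2)"
    by (rule suminf_mult2[OF summable_weights[OF sa], symmetric])
  finally show "\<bar>lattice_lap a h u x\<bar> \<le> (\<Sum>k. \<bar>a (Suc k)\<bar>) * (4 * B / h\<^sup>2)" .
qed

lemma lattice_lap_sums: "(\<And>x. \<bar>u x\<bar> \<le> B) \<Longrightarrow> (\<lambda>k. lattice_term a h u k x) sums lattice_lap a h u x"
  unfolding lattice_lap_def by (intro summable_sums lattice_lap_summable(1))

lemma lattice_lap_continuous:
  assumes u: "\<And>x. \<bar>u x\<bar> \<le> B" and c: "continuous_on UNIV u"
  shows "continuous_on UNIV (lattice_lap a h u)"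
proof (rule uniform_limit_theorem)
  show "uniform_limit UNIV (\<lambda>n x. \<Sum>k<n. lattice_term a h u k x) (lattice_lap a h u) sequentially"
    unfolding lattice_lap_def[abs_def]
    by (rule Weierstrass_m_test[OF _ lattice_lap_majorant])
       (unfold real_norm_def, rule lattice_term_bound[OF u h])
  show "\<forall>\<^sub>F n in sequentially. continuous_on UNIV (\<lambda>x. \<Sum>k<n. lattice_term a h u k x)"
    unfolding lattice_term_def
    by (intro always_eventually allI continuous_intros continuous_on_shift c) (use h in auto)
qed simp

lemma lattice_lap_add:
  assumes "\<And>x. \<bar>u x\<bar> \<le> B" "\<And>x. \<bar>v x\<bar> \<le> B'"
  shows "lattice_lap a h (\<lambda>x. u x + v x) x = lattice_lap a h u x + lattice_lap a h v x"
proof -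
  have "lattice_term a h (\<lambda>x. u x + v x) k x = lattice_term a h u k x + lattice_term a h v k x" for k
    by (simp add: lattice_term_def algebra_simps add_divide_distrib diff_divide_distrib)
  then show ?thesis unfolding lattice_lap_def
    using suminf_add[OF lattice_lap_summable(1)[OF assms(1)] lattice_lap_summable(1)[OF assms(2)]] by simp
qed

lemma lattice_lap_cmult:
  assumes "\<And>x. \<bar>u x\<bar> \<le> B"
  shows "lattice_lap a h (\<lambda>x. r * u x) x = r * lattice_lap a h u x"
proof -
  have "lattice_term a h (\<lambda>x. r * u x) k x = r * lattice_term a h u k x" for k
    by (simp add: lattice_term_def algebra_simps add_divide_distrib diff_divide_distrib)
  then show ?thesis unfolding lattice_lap_def using suminf_mult[OF lattice_lap_summable(1)[OF assms]] by simp
qed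

lemma lattice_lap_diff:
  assumes u: "\<And>x. \<bar>u x\<bar> \<le> B" and v: "\<And>x. \<bar>v x\<bar> \<le> B'"
  shows "lattice_lap a h (\<lambda>x. u x - v x) x = lattice_lap a h u x - lattice_lap a h v x"
proof -
  have "\<bar>-1 * v x\<bar> \<le> B'" for x using v by simp
  from lattice_lap_add[OF u this] lattice_lap_cmult[OF v, of "-1"] show ?thesis by simp
qed

lemma lattice_lap_deriv:
  assumes d: "\<And>x. (u has_real_derivative u1 x) (at x)"
    and u: "\<And>x. \<bar>u x\<bar> \<le> B" and u1: "\<And>x. \<bar>u1 x\<bar> \<le> B'"
  shows "(lattice_lap a h u has_real_derivative lattice_lap a h u1 x) (at x)"
proof -
  have t: "(lattice_term a h u k has_real_derivative lattice_term a h u1 k x) (at x)" for k x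
    unfolding lattice_term_def[abs_def]
    by (intro DERIV_cmult DERIV_cdivide DERIV_add DERIV_diff deriv_shift[OF d] d)
  have "uniformly_convergent_on UNIV (\<lambda>n x. \<Sum>k<n. lattice_term a h u1 k x)"
    by (rule Weierstrass_m_test'[OF _ lattice_lap_majorant])
       (unfold real_norm_def, rule lattice_term_bound[OF u1 h])
  then show ?thesis unfolding lattice_lap_def[abs_def]
    using has_field_derivative_series'(2)[OF convex_UNIV, of "lattice_term a h u" "lattice_term a h u1" 0 x]
      t lattice_lap_summable(1)[OF u] by (simp add: has_field_derivative_at_within)
qed

text \<open>The bound degenerates like \<open>1/h\<close>. It is used at a fixed \<open>h\<close> only, where it shows that the
operator is a bounded perturbation in the continuity method.\<close>
lemma lattice_term_L2:
  assumes u: "H1_pair u u1"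
  shows "sq_integrable (lattice_term a h u k)" "l2norm (lattice_term a h u k) \<le> \<bar>a (Suc k)\<bar> * (2 / h * l2norm u1)"
proof -
  note sq = H1_pairD(1,2)[OF u] and d = H1_pairD(3)[OF u]
  define y where "y = real (Suc k) * h"
  have y: "0 < y" "h \<le> y" using h by (auto simp: y_def)
  have f1: "sq_integrable (\<lambda>x. u (x + y) - u x)" "l2norm (\<lambda>x. u (x + y) - u x) \<le> y * l2norm u1"
    using first_difference_L2[OF d sq(2), of y] y by auto
  have f2: "sq_integrable (\<lambda>x. u x - u (x - y))" "l2norm (\<lambda>x. u x - u (x - y)) \<le> y * l2norm u1"
    using sq_integrable_shift(3,4)[OF f1(1), of y] f1(2) by simp_all
  have eq: "lattice_term a h u k = (\<lambda>x. (a (Suc k) / y\<^sup>2) * ((u (x + y) - u x) - (u x - u (x - y))))"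
    by (rule ext) (simp add: lattice_term_eq[OF y_def])
  have f3: "sq_integrable (\<lambda>x. (u (x + y) - u x) - (u x - u (x - y)))"
    "l2norm (\<lambda>x. (u (x + y) - u x) - (u x - u (x - y))) \<le> 2 * (y * l2norm u1)"
    using sq_integrable_diff[OF f1(1) f2(1)] f1(2) f2(2) by auto
  show "sq_integrable (lattice_term a h u k)" unfolding eq by (rule sq_integrable_cmult(1)[OF f3(1)])
  have "l2norm (lattice_term a h u k) \<le> \<bar>a (Suc k) / y\<^sup>2\<bar> * (2 * (y * l2norm u1))"
    unfolding eq sq_integrable_cmult(2)[OF f3(1)] by (intro mult_left_mono f3(2)) auto
  also have "\<dots> = \<bar>a (Suc k)\<bar> * (2 / y * l2norm u1)" using y by (simp add: power2_eq_square)
  also have "\<dots> \<le> \<bar>a (Suc k)\<bar> * (2 / h * l2norm u1)"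
    using y h by (intro mult_left_mono mult_right_mono frac_le) auto
  finally show "l2norm (lattice_term a h u k) \<le> \<bar>a (Suc k)\<bar> * (2 / h * l2norm u1)" .
qed

lemma lattice_lap_L2:
  assumes u: "H1_pair u u1"
  shows "sq_integrable (lattice_lap a h u)" "l2norm (lattice_lap a h u) \<le> (\<Sum>k. \<bar>a (Suc k)\<bar>) * (2 / h) * l2norm u1"
proof -
  note sup = H1_pair_sup[OF u]
  have s: "summable (\<lambda>k. \<bar>a (Suc k)\<bar> * (2 / h * l2norm u1))" by (intro summable_mult2 summable_weights sa)
  note F = sq_integrable_sums[OF lattice_term_L2[OF u] s lattice_lap_continuous[OF sup H1_pairD(4)[OF u]] lattice_lap_sums[OF sup]]
  show "sq_integrable (lattice_lap a h u)" by (rule F)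
  show "l2norm (lattice_lap a h u) \<le> (\<Sum>k. \<bar>a (Suc k)\<bar>) * (2 / h) * l2norm u1"
    using F(2) suminf_mult2[OF summable_weights[OF sa], symmetric, of "2 / h * l2norm u1"] by simp
qed

lemma lattice_lap_H1:
  assumes u: "H1_pair u u1" and u1: "H1_pair u1 u2"
  shows "H1_pair (lattice_lap a h u) (lattice_lap a h u1)"
  unfolding H1_pair_def
  using lattice_lap_L2(1)[OF u] lattice_lap_L2(1)[OF u1] lattice_lap_deriv[OF H1_pairD(3)[OF u] H1_pair_sup[OF u] H1_pair_sup[OF u1]] by auto

text \<open>Every symmetric difference commutes with the derivative: by parts and by a shift, the integral of
\<open>u(x + y) u'(x)\<close> cancels that of \<open>u(x - y) u'(x)\<close>.\<close>
lemma lattice_lap_skew: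
  assumes u: "H1_pair u u1"
  shows "(LINT x|lborel. lattice_lap a h u x * u1 x) = 0"
proof -
  note sq = H1_pairD(1,2)[OF u] and d = H1_pairD(3)[OF u]
  have term0: "(LINT x|lborel. lattice_term a h u k x * u1 x) = 0" for k
  proof -
    define y where "y = real (Suc k) * h"
    have sh: "sq_integrable (\<lambda>x. u (x + y))" "sq_integrable (\<lambda>x. u1 (x + y))" "sq_integrable (\<lambda>x. u (x - y))"
      using sq by (auto intro: sq_integrable_shift)
    have i: "integrable lborel (\<lambda>x. u (x + y) * u1 x)" "integrable lborel (\<lambda>x. u (x - y) * u1 x)"
      "integrable lborel (\<lambda>x. u x * u1 x)"
      using sh sq by (auto intro: sq_integrable_mult_integrable)
    have p1: "(LINT x|lborel. u1 x * u x) + (LINT x|lborel. u x * u1 x) = 0"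
      by (rule integral_by_parts_sq_integrable[OF sq sq d d])
    have p2: "(LINT x|lborel. u1 x * u (x + y)) + (LINT x|lborel. u x * u1 (x + y)) = 0"
      by (rule integral_by_parts_sq_integrable[OF sq sh(1,2) d deriv_shift(3)[OF d]])
    have p3: "(LINT x|lborel. u (x - y) * u1 x) = (LINT x|lborel. u x * u1 (x + y))"
      using lborel_integral_real_affine[of 1 "\<lambda>x. u (x - y) * u1 x" y] by (simp add: add.commute)
    have eq: "lattice_term a h u k x * u1 x =
       (a (Suc k) / y\<^sup>2) * (u (x + y) * u1 x - 2 * (u x * u1 x) + u (x - y) * u1 x)" for x
      by (simp add: lattice_term_eq[OF y_def] algebra_simps add_divide_distrib)
    have "(LINT x|lborel. u (x + y) * u1 x - 2 * (u x * u1 x) + u (x - y) * u1 x)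
       = (LINT x|lborel. u (x + y) * u1 x) - 2 * (LINT x|lborel. u x * u1 x) + (LINT x|lborel. u (x - y) * u1 x)"
      using i by simp
    also have "\<dots> = 0" using p1 p2 p3 by (simp add: mult.commute)
    finally show ?thesis unfolding eq by simp
  qed
  note sup = H1_pair_sup[OF u]
  have "(\<lambda>k. LINT x|lborel. lattice_term a h u k x * u1 x) sums (LINT x|lborel. (\<Sum>k. lattice_term a h u k x * u1 x))"
  proof (rule sums_integral)
    show "integrable lborel (\<lambda>x. lattice_term a h u k x * u1 x)" for k
      by (rule sq_integrable_mult_integrable[OF lattice_term_L2(1)[OF u] sq(2)])
    show "AE x in lborel. summable (\<lambda>k. norm (lattice_term a h u k x * u1 x))"
      by (intro AE_I2) (auto simp: abs_mult intro!: summable_mult2 lattice_lap_summable(2)[OF sup])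
    show "summable (\<lambda>k. LINT x|lborel. norm (lattice_term a h u k x * u1 x))"
    proof (rule summable_comparison_test')
      show "summable (\<lambda>k. \<bar>a (Suc k)\<bar> * (2 / h * l2norm u1) * l2norm u1)"
        by (intro summable_mult2 summable_weights sa)
      fix k :: nat
      have "(LINT x|lborel. \<bar>lattice_term a h u k x * u1 x\<bar>) \<le> l2norm (lattice_term a h u k) * l2norm u1"
        by (rule l2norm_Cauchy_Schwarz(1)[OF lattice_term_L2(1)[OF u] sq(2)])
      also have "\<dots> \<le> \<bar>a (Suc k)\<bar> * (2 / h * l2norm u1) * l2norm u1"
        by (intro mult_right_mono lattice_term_L2(2)[OF u]) simp
      finally show "norm (LINT x|lborel. norm (lattice_term a h u k x * u1 x)) \<le> \<bar>a (Suc k)\<bar> * (2 / h * l2norm u1) * l2norm u1"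
        by simp
    qed
  qed
  moreover have "(\<Sum>k. lattice_term a h u k x * u1 x) = lattice_lap a h u x * u1 x" for x
    unfolding lattice_lap_def by (rule suminf_mult2[OF lattice_lap_summable(1)[OF sup], symmetric])
  ultimately show ?thesis using term0 sums_unique2[OF _ sums_zero] by simp
qed

text \<open>The normalisation \<open>\<Sum> a\<^sub>k = 1\<close> matches the second derivative, and each of the terms contributes an
error of relative size \<open>kh\<close>.\<close>
lemma lattice_lap_consistency:
  assumes w: "\<And>x. (w has_real_derivative w1 x) (at x)" and w1: "\<And>x. (w1 has_real_derivative w2 x) (at x)"
    and w2: "\<And>x. (w2 has_real_derivative w3 x) (at x)" and w3: "sq_integrable w3"
    and B: "\<And>x. \<bar>w x\<bar> \<le> B" and one: "(\<lambda>k. a (Suc k)) sums 1"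
  shows "sq_integrable (\<lambda>x. lattice_lap a h w x - w2 x)"
    "l2norm (\<lambda>x. lattice_lap a h w x - w2 x) \<le> 2 * h * (\<Sum>k. \<bar>a (Suc k)\<bar> * real (Suc k)) * l2norm w3"
proof -
  define f where "f k x = lattice_term a h w k x - a (Suc k) * w2 x" for k x
  have L2: "sq_integrable (f k)" "l2norm (f k) \<le> \<bar>a (Suc k)\<bar> * real (Suc k) * (2 * h * l2norm w3)" for k
  proof -
    define y where "y = real (Suc k) * h"
    have y: "0 < y" using h by (simp add: y_def)
    have eq: "f k = (\<lambda>x. (a (Suc k) / y\<^sup>2) * (w (x + y) - 2 * w x + w (x - y) - y\<^sup>2 * w2 x))"
    proof
      fix x
      have y2: "(real (Suc k))\<^sup>2 * h\<^sup>2 = y\<^sup>2" by (simp add: y_def power_mult_distrib)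
      have "A * (D / Y) - A * W = A / Y * (D - Y * W)" if "Y \<noteq> 0" for A D W Y :: real
        using that by (simp add: field_simps)
      then show "f k x = (a (Suc k) / y\<^sup>2) * (w (x + y) - 2 * w x + w (x - y) - y\<^sup>2 * w2 x)"
        unfolding f_def lattice_term_def y2 y_def[symmetric] using y by simp
    qed
    note sd = second_difference_consistency[OF w w1 w2 w3 less_imp_le[OF y]]
    show "sq_integrable (f k)" unfolding eq by (rule sq_integrable_cmult(1)[OF sd(1)])
    have "l2norm (f k) \<le> \<bar>a (Suc k) / y\<^sup>2\<bar> * (2 * y ^ 3 * l2norm w3)"
      unfolding eq sq_integrable_cmult(2)[OF sd(1)] by (intro mult_left_mono sd(2)) auto
    also have "\<dots> = \<bar>a (Suc k)\<bar> * real (Suc k) * (2 * h * l2norm w3)"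
    proof -
      have "\<bar>a (Suc k) / y\<^sup>2\<bar> * (2 * y ^ 3 * l2norm w3) = \<bar>a (Suc k)\<bar> * (2 * y * l2norm w3)"
        using y by (simp add: power2_eq_square power3_eq_cube)
      then show ?thesis by (simp add: y_def mult_ac)
    qed
    finally show "l2norm (f k) \<le> \<bar>a (Suc k)\<bar> * real (Suc k) * (2 * h * l2norm w3)" .
  qed
  have s: "summable (\<lambda>k. \<bar>a (Suc k)\<bar> * real (Suc k) * (2 * h * l2norm w3))" by (intro summable_mult2 sa)
  have c: "continuous_on UNIV (\<lambda>x. lattice_lap a h w x - w2 x)"
    by (intro continuous_on_diff lattice_lap_continuous[OF B] has_real_derivative_continuous_on[OF w]
        has_real_derivative_continuous_on[OF w2])
  have sums: "(\<lambda>k. f k x) sums (lattice_lap a h w x - w2 x)" for x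
    unfolding f_def using sums_diff[OF lattice_lap_sums[OF B] sums_mult2[OF one]] by simp
  note F = sq_integrable_sums[OF L2 s c sums]
  show "sq_integrable (\<lambda>x. lattice_lap a h w x - w2 x)" by (rule F)
  show "l2norm (\<lambda>x. lattice_lap a h w x - w2 x) \<le> 2 * h * (\<Sum>k. \<bar>a (Suc k)\<bar> * real (Suc k)) * l2norm w3"
    using F(2) suminf_mult2[OF sa, symmetric, of "2 * h * l2norm w3"] by (simp add: mult_ac)
qed

section \<open>Transport estimate and continuity method\<close>

text \<open>Test the equation with \<open>u'\<close>: the difference operator and the zeroth order term drop out by
antisymmetry. The constant is the same for all \<open>h\<close> and all weights.\<close>
lemma transport_estimate:
  assumes u: "H1_pair u u1" and c: "0 < c"
  shows "sq_integrable (\<lambda>x. \<tau> * lattice_lap a h u x + c * u1 x - u x)"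
    "c * l2norm u1 \<le> l2norm (\<lambda>x. \<tau> * lattice_lap a h u x + c * u1 x - u x)"
proof -
  note sq = H1_pairD(1,2)[OF u] and d = H1_pairD(3)[OF u]
  let ?M = "\<lambda>x. \<tau> * lattice_lap a h u x + c * u1 x - u x"
  show M: "sq_integrable ?M"
    by (intro sq_integrable_diff(1) sq_integrable_add(1) sq_integrable_cmult(1) lattice_lap_L2(1)[OF u] sq)
  have i: "integrable lborel (\<lambda>x. lattice_lap a h u x * u1 x)" "integrable lborel (\<lambda>x. u x * u1 x)"
    "integrable lborel (\<lambda>x. (u1 x)\<^sup>2)"
    using lattice_lap_L2(1)[OF u] sq by (auto intro: sq_integrable_mult_integrable sq_integrableD)
  have p1: "(LINT x|lborel. u1 x * u x) + (LINT x|lborel. u x * u1 x) = 0"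
    by (rule integral_by_parts_sq_integrable[OF sq sq d d])
  have "(LINT x|lborel. ?M x * u1 x) = (LINT x|lborel. \<tau> * (lattice_lap a h u x * u1 x) + c * (u1 x)\<^sup>2 - u x * u1 x)"
    by (intro Bochner_Integration.integral_cong) (auto simp: power2_eq_square algebra_simps)
  also have "\<dots> = \<tau> * (LINT x|lborel. lattice_lap a h u x * u1 x) + c * (LINT x|lborel. (u1 x)\<^sup>2) - (LINT x|lborel. u x * u1 x)"
    using i by simp
  also have "\<dots> = c * (l2norm u1)\<^sup>2"
    using lattice_lap_skew[OF u] p1 by (simp add: l2norm_sq mult.commute)
  finally have "c * (l2norm u1)\<^sup>2 \<le> l2norm ?M * l2norm u1"
    using l2norm_Cauchy_Schwarz(2)[OF M sq(2)] by linarith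
  then have "(c * l2norm u1) * l2norm u1 \<le> l2norm ?M * l2norm u1" by (simp add: power2_eq_square mult_ac)
  then show "c * l2norm u1 \<le> l2norm ?M"
    by (cases "l2norm u1 = 0") (auto simp: mult_le_cancel_right order_less_le)
qed

text \<open>Solvability of \<open>\<tau> D\<^sub>h u + c u' - u = f\<close> in \<open>H\<^sup>1\<close> up to a relative error \<open>\<epsilon>\<close>. With approximate
solutions every stage of the continuity method is a finite iteration, in which the solution keeps the
two derivatives needed to differentiate the equation.\<close>
definition almost_invertible :: "real \<Rightarrow> real \<Rightarrow> real \<Rightarrow> bool" where
  "almost_invertible c \<tau> \<epsilon> \<longleftrightarrow> (\<forall>f f1. H1_pair f f1 \<longrightarrow>
     (\<exists>u u1 u2. H1_pair u u1 \<and> H1_pair u1 u2 \<and>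
       l2norm (\<lambda>x. \<tau> * lattice_lap a h u x + c * u1 x - u x - f x) +
       l2norm (\<lambda>x. \<tau> * lattice_lap a h u1 x + c * u2 x - u1 x - f1 x) \<le> \<epsilon> * (l2norm f + l2norm f1)))"

text \<open>Without the difference operator this is a first order equation with constant coefficients, unstable to
the right and therefore solved from \<open>+\<infinity>\<close> by reflection.\<close>
lemma almost_invertible_0: "0 < c \<Longrightarrow> almost_invertible c 0 0"
  unfolding almost_invertible_def
proof (intro allI impI)
  fix f f1 assume c: "0 < c" and f: "H1_pair f f1"
  have fr: "sq_integrable (\<lambda>x. (- 1 / c) * f (- x))"
    by (intro sq_integrable_cmult(1) sq_integrable_reflect(1) H1_pairD[OF f])
  obtain v where v: "\<And>x. (v has_real_derivative - (1 / c) * v x + (- 1 / c) * f (- x)) (at x)"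
    and vsq: "sq_integrable v"
    using linear_ode_L2[OF continuous_on_const fr, of "1 / c" "1 / c"] c by auto
  define u where "u x = v (- x)" for x
  define u1 where "u1 x = (1 / c) * (u x + f x)" for x
  define u2 where "u2 x = (1 / c) * (u1 x + f1 x)" for x
  have usq: "sq_integrable u" unfolding u_def[abs_def] by (rule sq_integrable_reflect(1)[OF vsq])
  have u1sq: "sq_integrable u1" unfolding u1_def[abs_def]
    by (intro sq_integrable_cmult(1) sq_integrable_add(1) usq H1_pairD[OF f])
  have "(u has_real_derivative (- (1 / c) * v (- x) + (- 1 / c) * f (- (- x))) * - 1) (at x)" for x
    unfolding u_def[abs_def] using DERIV_chain2[OF v DERIV_minus[OF DERIV_ident]] by simp
  then have u: "H1_pair u u1" using usq u1sq unfolding H1_pair_def u1_def u_def by (simp add: algebra_simps)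
  have u1: "H1_pair u1 u2" unfolding u1_def[abs_def] u2_def[abs_def]
    by (intro H1_pair_cmult H1_pair_add u f[unfolded u1_def] u[unfolded u1_def[abs_def]] f)
  have z: "0 * lattice_lap a h u x + c * u1 x - u x - f x = 0" "0 * lattice_lap a h u1 x + c * u2 x - u1 x - f1 x = 0" for x
    using c by (auto simp: u1_def u2_def)
  show "\<exists>u u1 u2. H1_pair u u1 \<and> H1_pair u1 u2 \<and>
       l2norm (\<lambda>x. 0 * lattice_lap a h u x + c * u1 x - u x - f x) +
       l2norm (\<lambda>x. 0 * lattice_lap a h u1 x + c * u2 x - u1 x - f1 x) \<le> 0 * (l2norm f + l2norm f1)"
    by (rule exI[of _ u], rule exI[of _ u1], rule exI[of _ u2], simp only: z, simp add: u u1)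
qed

lemma almost_invertible_mono: "almost_invertible c \<tau> \<epsilon> \<Longrightarrow> \<epsilon> \<le> \<epsilon>' \<Longrightarrow> almost_invertible c \<tau> \<epsilon>'"
  unfolding almost_invertible_def
  by (meson add_nonneg_nonneg l2norm_nonneg mult_right_mono order_trans)

lemma H1_residual:
  assumes u: "H1_pair u u1" and u1: "H1_pair u1 u2" and f: "H1_pair f f1"
  shows "H1_pair (\<lambda>x. \<tau> * lattice_lap a h u x + c * u1 x - u x - f x) (\<lambda>x. \<tau> * lattice_lap a h u1 x + c * u2 x - u1 x - f1 x)"
  by (intro H1_pair_diff H1_pair_add H1_pair_cmult lattice_lap_H1[OF u u1] u u1 f)

text \<open>Solve once more for the residual and subtract.\<close>
lemma almost_invertible_mult:
  assumes 1: "almost_invertible c \<tau> \<epsilon>" and 2: "almost_invertible c \<tau> \<eta>" and \<eta>: "0 \<le> \<eta>"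
  shows "almost_invertible c \<tau> (\<eta> * \<epsilon>)"
  unfolding almost_invertible_def
proof (intro allI impI)
  fix f f1 assume f: "H1_pair f f1"
  obtain u u1 u2 where u: "H1_pair u u1" "H1_pair u1 u2"
    and ur: "l2norm (\<lambda>x. \<tau> * lattice_lap a h u x + c * u1 x - u x - f x) +
       l2norm (\<lambda>x. \<tau> * lattice_lap a h u1 x + c * u2 x - u1 x - f1 x) \<le> \<epsilon> * (l2norm f + l2norm f1)"
    using 1 f unfolding almost_invertible_def by blast
  define r where "r x = \<tau> * lattice_lap a h u x + c * u1 x - u x - f x" for x
  define r1 where "r1 x = \<tau> * lattice_lap a h u1 x + c * u2 x - u1 x - f1 x" for x
  have r: "H1_pair r r1" unfolding r_def[abs_def] r1_def[abs_def] by (rule H1_residual[OF u f])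
  obtain v v1 v2 where v: "H1_pair v v1" "H1_pair v1 v2"
    and vr: "l2norm (\<lambda>x. \<tau> * lattice_lap a h v x + c * v1 x - v x - r x) +
       l2norm (\<lambda>x. \<tau> * lattice_lap a h v1 x + c * v2 x - v1 x - r1 x) \<le> \<eta> * (l2norm r + l2norm r1)"
    using 2 r unfolding almost_invertible_def by blast
  have e: "\<tau> * lattice_lap a h (\<lambda>x. u x - v x) x + c * (u1 x - v1 x) - (u x - v x) - f x
       = - 1 * (\<tau> * lattice_lap a h v x + c * v1 x - v x - r x)"
    "\<tau> * lattice_lap a h (\<lambda>x. u1 x - v1 x) x + c * (u2 x - v2 x) - (u1 x - v1 x) - f1 x
       = - 1 * (\<tau> * lattice_lap a h v1 x + c * v2 x - v1 x - r1 x)" for x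
    unfolding lattice_lap_diff[where u = u and v = v, OF H1_pair_sup[OF u(1)] H1_pair_sup[OF v(1)]]
      lattice_lap_diff[where u = u1 and v = v1, OF H1_pair_sup[OF u(2)] H1_pair_sup[OF v(2)]]
    by (simp_all only: r_def r1_def) (simp_all add: algebra_simps)
  have n: "l2norm (\<lambda>x. - 1 * (\<tau> * lattice_lap a h v x + c * v1 x - v x - r x)) = l2norm (\<lambda>x. \<tau> * lattice_lap a h v x + c * v1 x - v x - r x)"
    "l2norm (\<lambda>x. - 1 * (\<tau> * lattice_lap a h v1 x + c * v2 x - v1 x - r1 x)) = l2norm (\<lambda>x. \<tau> * lattice_lap a h v1 x + c * v2 x - v1 x - r1 x)"
    by (subst sq_integrable_cmult(2)[OF H1_pairD(1)[OF H1_residual[OF v r]]]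
          sq_integrable_cmult(2)[OF H1_pairD(2)[OF H1_residual[OF v r]]]; simp)+
  have "\<eta> * (l2norm r + l2norm r1) \<le> \<eta> * (\<epsilon> * (l2norm f + l2norm f1))"
    using ur \<eta> unfolding r_def[symmetric] r1_def[symmetric] by (intro mult_left_mono) auto
  then have "l2norm (\<lambda>x. \<tau> * lattice_lap a h (\<lambda>x. u x - v x) x + c * (u1 x - v1 x) - (u x - v x) - f x) +
      l2norm (\<lambda>x. \<tau> * lattice_lap a h (\<lambda>x. u1 x - v1 x) x + c * (u2 x - v2 x) - (u1 x - v1 x) - f1 x)
      \<le> \<eta> * \<epsilon> * (l2norm f + l2norm f1)"
    unfolding e n mult.assoc using vr by linarith
  with H1_pair_diff[OF u(1) v(1)] H1_pair_diff[OF u(2) v(2)]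
  show "\<exists>u u1 u2. H1_pair u u1 \<and> H1_pair u1 u2 \<and>
       l2norm (\<lambda>x. \<tau> * lattice_lap a h u x + c * u1 x - u x - f x) +
       l2norm (\<lambda>x. \<tau> * lattice_lap a h u1 x + c * u2 x - u1 x - f1 x) \<le> \<eta> * \<epsilon> * (l2norm f + l2norm f1)"
    by blast
qed

lemma almost_invertible_power:
  assumes "almost_invertible c \<tau> (1 / 2)" shows "almost_invertible c \<tau> ((1 / 2) ^ Suc n)"
proof (induction n)
  case (Suc n)
  from almost_invertible_mult[OF Suc assms] show ?case by simp
qed (use assms in simp)

lemma almost_invertible_all:
  assumes "almost_invertible c \<tau> (1 / 2)" and "0 < \<epsilon>" shows "almost_invertible c \<tau> \<epsilon>"
proof -
  obtain n where "(1 / 2 :: real) ^ n < \<epsilon>" using real_arch_pow_inv[OF \<open>0 < \<epsilon>\<close>, of "1/2"] by auto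
  moreover have "(1 / 2 :: real) ^ Suc n \<le> (1 / 2) ^ n" by simp
  ultimately show ?thesis
    by (intro almost_invertible_mono[OF almost_invertible_power[OF assms(1), of n]]) linarith
qed

text \<open>A solution at \<open>\<tau>\<close> changes the residual at \<open>\<tau> + \<delta>\<close> by \<open>\<delta> D\<^sub>h u\<close>. This is controlled by \<open>u'\<close> alone, hence by the
transport estimate, and the admissible \<open>\<delta>\<close> is the same at every \<open>\<tau>\<close>.\<close>
lemma almost_invertible_step:
  assumes c: "0 < c" and inv: "almost_invertible c \<tau> (1 / 4)" and \<delta>: "0 \<le> \<delta>"
    and small: "\<delta> * ((\<Sum>k. \<bar>a (Suc k)\<bar>) * (2 / h)) * 5 \<le> c"
  shows "almost_invertible c (\<tau> + \<delta>) (1 / 2)"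
  unfolding almost_invertible_def
proof (intro allI impI)
  fix f f1 assume f: "H1_pair f f1"
  obtain u u1 u2 where u: "H1_pair u u1" "H1_pair u1 u2"
    and ur: "l2norm (\<lambda>x. \<tau> * lattice_lap a h u x + c * u1 x - u x - f x) +
       l2norm (\<lambda>x. \<tau> * lattice_lap a h u1 x + c * u2 x - u1 x - f1 x) \<le> 1 / 4 * (l2norm f + l2norm f1)"
    using inv f unfolding almost_invertible_def by blast
  define A where "A = (\<Sum>k. \<bar>a (Suc k)\<bar>) * (2 / h)"
  have A0: "0 \<le> A" unfolding A_def using h suminf_nonneg[OF summable_weights[OF sa]] by simp
  define N where "N = l2norm f + l2norm f1"
  define r where "r x = \<tau> * lattice_lap a h u x + c * u1 x - u x - f x" for x
  define r1 where "r1 x = \<tau> * lattice_lap a h u1 x + c * u2 x - u1 x - f1 x" for x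
  have r: "H1_pair r r1" unfolding r_def[abs_def] r1_def[abs_def] by (rule H1_residual[OF u f])
  have rN: "l2norm r + l2norm r1 \<le> 1 / 4 * N" using ur by (simp add: r_def[abs_def] r1_def[abs_def] N_def)
  have b1: "c * l2norm u1 \<le> l2norm r + l2norm f"
  proof -
    have "(\<lambda>x. \<tau> * lattice_lap a h u x + c * u1 x - u x) = (\<lambda>x. r x + f x)" by (auto simp: r_def)
    then show ?thesis using transport_estimate(2)[OF u(1) c, of \<tau>]
        sq_integrable_add(2)[OF H1_pairD(1)[OF r] H1_pairD(1)[OF f]] by simp
  qed
  have b2: "c * l2norm u2 \<le> l2norm r1 + l2norm f1"
  proof -
    have "(\<lambda>x. \<tau> * lattice_lap a h u1 x + c * u2 x - u1 x) = (\<lambda>x. r1 x + f1 x)" by (auto simp: r1_def)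
    then show ?thesis using transport_estimate(2)[OF u(2) c, of \<tau>]
        sq_integrable_add(2)[OF H1_pairD(2)[OF r] H1_pairD(2)[OF f]] by simp
  qed
  have b: "c * (l2norm u1 + l2norm u2) \<le> 5 / 4 * N" using b1 b2 rN by (simp add: N_def algebra_simps)
  have e: "(\<tau> + \<delta>) * lattice_lap a h u x + c * u1 x - u x - f x = r x + \<delta> * lattice_lap a h u x"
    "(\<tau> + \<delta>) * lattice_lap a h u1 x + c * u2 x - u1 x - f1 x = r1 x + \<delta> * lattice_lap a h u1 x" for x
    by (simp_all add: r_def r1_def algebra_simps)
  have n1: "l2norm (\<lambda>x. r x + \<delta> * lattice_lap a h u x) \<le> l2norm r + \<delta> * (A * l2norm u1)"
    using sq_integrable_add(2)[OF H1_pairD(1)[OF r] sq_integrable_cmult(1)[OF lattice_lap_L2(1)[OF u(1)], of \<delta>]]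
      sq_integrable_cmult(2)[OF lattice_lap_L2(1)[OF u(1)], of \<delta>] mult_left_mono[OF lattice_lap_L2(2)[OF u(1)] \<delta>] \<delta>
    by (simp add: A_def)
  have n2: "l2norm (\<lambda>x. r1 x + \<delta> * lattice_lap a h u1 x) \<le> l2norm r1 + \<delta> * (A * l2norm u2)"
    using sq_integrable_add(2)[OF H1_pairD(2)[OF r] sq_integrable_cmult(1)[OF lattice_lap_L2(1)[OF u(2)], of \<delta>]]
      sq_integrable_cmult(2)[OF lattice_lap_L2(1)[OF u(2)], of \<delta>] mult_left_mono[OF lattice_lap_L2(2)[OF u(2)] \<delta>] \<delta>
    by (simp add: A_def)
  have "5 * (\<delta> * A * (l2norm u1 + l2norm u2)) \<le> c * (l2norm u1 + l2norm u2)"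
    using mult_right_mono[OF small, of "l2norm u1 + l2norm u2"] by (simp add: A_def mult_ac)
  with b have "\<delta> * A * (l2norm u1 + l2norm u2) \<le> 1 / 4 * N" by linarith
  with n1 n2 rN have "l2norm (\<lambda>x. r x + \<delta> * lattice_lap a h u x) + l2norm (\<lambda>x. r1 x + \<delta> * lattice_lap a h u1 x) \<le> 1 / 2 * N"
    by (simp add: algebra_simps)
  then show "\<exists>u u1 u2. H1_pair u u1 \<and> H1_pair u1 u2 \<and>
       l2norm (\<lambda>x. (\<tau> + \<delta>) * lattice_lap a h u x + c * u1 x - u x - f x) +
       l2norm (\<lambda>x. (\<tau> + \<delta>) * lattice_lap a h u1 x + c * u2 x - u1 x - f1 x) \<le> 1 / 2 * (l2norm f + l2norm f1)"
    unfolding N_def[symmetric] e[symmetric] using u by blast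
qed

lemma almost_invertible_1:
  assumes c: "0 < c" and \<epsilon>: "0 < \<epsilon>" shows "almost_invertible c 1 \<epsilon>"
proof -
  define A where "A = (\<Sum>k. \<bar>a (Suc k)\<bar>) * (2 / h)"
  have A0: "0 \<le> A" unfolding A_def using h suminf_nonneg[OF summable_weights[OF sa]] by simp
  obtain N :: nat where N: "5 * A / c + 1 \<le> real N" using real_arch_simple by blast
  have N0: "0 < real N" using N A0 c by (smt (verit) divide_nonneg_pos)
  define \<delta> where "\<delta> = 1 / real N"
  have "5 * A \<le> real N * c" using N c by (simp add: field_simps) 
  then have small: "\<delta> * A * 5 \<le> c" using N0 by (simp add: \<delta>_def field_simps)
  have "almost_invertible c (real n * \<delta>) (1 / 2)" for n :: nat
  proof (induction n)
    case 0
    then show ?case using almost_invertible_mono[OF almost_invertible_0[OF c], of "1/2"] by simp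
  next
    case (Suc n)
    have "almost_invertible c (real n * \<delta> + \<delta>) (1 / 2)"
      using N0 small by (intro almost_invertible_step[OF c almost_invertible_all[OF Suc]]) (auto simp: \<delta>_def A_def)
    then show ?case by (simp add: algebra_simps)
  qed
  from this[of N] have "almost_invertible c 1 (1 / 2)" using N0 by (simp add: \<delta>_def)
  then show ?thesis by (rule almost_invertible_all[OF _ \<epsilon>])
qed

end

section \<open>An approximate right inverse of the linearised lattice operator\<close>

lemma sq_integrable_bound3:
  assumes "sq_integrable f" "l2norm f \<le> A" "sq_integrable g" "l2norm g \<le> B" "sq_integrable k" "l2norm k \<le> D"
  shows "sq_integrable (\<lambda>x. f x + g x + k x)" "l2norm (\<lambda>x. f x + g x + k x) \<le> A + B + D"
  using sq_integrable_add[OF sq_integrable_add(1)[OF assms(1,3)] assms(5)] sq_integrable_add(2)[OF assms(1,3)] assms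
  by auto

text \<open>For the operator \<open>D\<^sub>h + c d + V\<close>. The correction is asked for one \<open>f\<close> at a time, which is how an
iteration consumes it.\<close>
definition approx_right_inverse ::
    "(nat \<Rightarrow> real) \<Rightarrow> real \<Rightarrow> real \<Rightarrow> (real \<Rightarrow> real) \<Rightarrow> real \<Rightarrow> real \<Rightarrow> bool" where
  "approx_right_inverse a h c V C \<epsilon> \<longleftrightarrow> (\<forall>f. sq_integrable f \<longrightarrow>
     (\<exists>v v1. H1_pair v v1 \<and> l2norm v \<le> C * l2norm f \<and> l2norm v1 \<le> C * l2norm f \<and>
        l2norm (\<lambda>x. lattice_lap a h v x + c * v1 x + V x * v x - f x) \<le> \<epsilon> * l2norm f))"

text \<open>With \<open>\<eta> = sqrt h\<close> split \<open>f = y + \<eta> y'\<close>, let \<open>L\<^sub>0 w = y\<close> and let \<open>D\<^sub>h u + c u' - u \<approx> y\<close>, and take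
\<open>v = w + \<eta> u'\<close>. Differentiating the equation of \<open>u\<close> gives
\<open>L\<^sub>h v - f \<approx> (D\<^sub>h w - w'') + \<eta> (1 + V) u'\<close>. The first term is \<open>O(h |w'''|) = O(h / \<eta>)\<close>, as \<open>w\<close> is
only as smooth as \<open>y'\<close> allows; the second is \<open>O(\<eta>)\<close> by the transport estimate. The choice of
\<open>\<eta>\<close> balances the two.\<close>
lemma approximate_right_inverse:
  fixes a :: "nat \<Rightarrow> real" and V V1 :: "real \<Rightarrow> real" and c C0 BV BV1 :: real
  assumes sa: "summable (\<lambda>k. \<bar>a (Suc k)\<bar> * real (Suc k))" and one: "(\<lambda>k. a (Suc k)) sums 1"
    and c: "0 < c"
    and V: "\<And>x. (V has_real_derivative V1 x) (at x)" and V1c: "continuous_on UNIV V1"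
    and BV: "\<And>x. \<bar>V x\<bar> \<le> BV" and BV1: "\<And>x. \<bar>V1 x\<bar> \<le> BV1"
    and C0: "0 < C0" and R0: "L2_right_inverse c V C0"
  obtains C where "0 < C" "\<And>\<epsilon>. 0 < \<epsilon> \<Longrightarrow> \<exists>h0>0. \<forall>h. 0 < h \<and> h < h0 \<longrightarrow>
     approx_right_inverse a h c V C \<epsilon>"
proof -
  have BV0: "0 \<le> BV" "0 \<le> BV1" using BV[of 0] BV1[of 0] by linarith+
  have Vc: "continuous_on UNIV V" by (rule has_real_derivative_continuous_on[OF V])
  define A where "A = (\<Sum>k. \<bar>a (Suc k)\<bar> * real (Suc k))"
  have A0: "0 \<le> A" unfolding A_def by (rule suminf_nonneg[OF sa]) simp
  define C2 where "C2 = 1 + c * C0 + BV * C0"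
  have C2: "0 \<le> C2" unfolding C2_def using c C0 BV0 by simp
  define C3 where "C3 = c * C2 + BV1 * C0 + BV * C0"
  have C3: "0 \<le> C3" unfolding C3_def using c C0 BV0 C2 by simp
  define C4 where "C4 = 2 * A * (2 + C3) + 1 + (1 + BV) * (2 / c)"
  have C4: "0 < C4" unfolding C4_def using A0 C3 BV0 c by (intro add_nonneg_pos add_pos_nonneg) auto
  have C: "0 < C0 + 3 / c" using C0 c by (simp add: add_pos_pos)
  have main: "approx_right_inverse a h c V (C0 + 3 / c) (C4 * sqrt h)" if h: "0 < h" "h \<le> 1" for h
    unfolding approx_right_inverse_def
  proof (intro allI impI)
    fix f assume f: "sq_integrable f"
    define F where "F = l2norm f"
    have F0: "0 \<le> F" by (simp add: F_def)
    define \<eta> where "\<eta> = sqrt h"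
    have \<eta>: "0 < \<eta>" "\<eta> \<le> 1" "h = \<eta> * \<eta>" using h by (auto simp: \<eta>_def)
    have h\<eta>: "h \<le> \<eta>" using \<eta> mult_left_mono[of \<eta> 1 \<eta>] by simp
    (* One-sided smoothing at scale \<eta>: \<eta> y' + y = f. *)
    obtain y where y: "\<And>x. (y has_real_derivative - (1 / \<eta>) * y x + (1 / \<eta>) * f x) (at x)"
      and ysq: "sq_integrable y" and yn: "l2norm y \<le> l2norm (\<lambda>x. (1 / \<eta>) * f x) / (1 / \<eta>)"
      using linear_ode_L2[OF continuous_on_const sq_integrable_cmult(1)[OF f], of "1 / \<eta>" "1 / \<eta>" "1 / \<eta>"] \<eta>
      by auto
    have yF: "l2norm y \<le> F" using yn \<eta> sq_integrable_cmult(2)[OF f, of "1 / \<eta>"] by (simp add: F_def)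
    define y1 where "y1 x = (1 / \<eta>) * (f x - y x)" for x
    have yd: "(y has_real_derivative y1 x) (at x)" for x using y[of x] by (simp add: y1_def algebra_simps)
    have y1sq: "sq_integrable y1" unfolding y1_def[abs_def] by (intro sq_integrable_cmult(1) sq_integrable_diff(1) f ysq)
    have y1F: "l2norm y1 \<le> 2 / \<eta> * F"
    proof -
      have "l2norm y1 = 1 / \<eta> * l2norm (\<lambda>x. f x - y x)"
        unfolding y1_def[abs_def] using sq_integrable_cmult(2)[OF sq_integrable_diff(1)[OF f ysq], of "1 / \<eta>"] \<eta> by simp
      also have "\<dots> \<le> 1 / \<eta> * (F + F)"
        using sq_integrable_diff(2)[OF f ysq] yF \<eta> by (intro mult_left_mono) (auto simp: F_def)
      finally show ?thesis by (simp add: mult.commute)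
    qed
    have yH: "H1_pair y y1" using ysq y1sq yd by (simp add: H1_pair_def)
    (* The smooth part of f is treated by the continuum operator. *)
    obtain w w1 w2 where w: "\<And>x. (w has_real_derivative w1 x) (at x)" "\<And>x. (w1 has_real_derivative w2 x) (at x)"
      and weq: "\<And>x. w2 x + c * w1 x + V x * w x = y x" and wsq: "sq_integrable w" "sq_integrable w1"
      and wn: "l2norm w \<le> C0 * l2norm y" "l2norm w1 \<le> C0 * l2norm y"
      using R0 ysq unfolding L2_right_inverse_def by blast
    have wF: "l2norm w \<le> C0 * F" "l2norm w1 \<le> C0 * F"
      using wn mult_left_mono[OF yF, of C0] C0 by linarith+
    have wH: "H1_pair w w1" using w wsq by (simp add: H1_pair_def)
    have neg_mult: "sq_integrable (\<lambda>x. - U x * z x)" "l2norm (\<lambda>x. - U x * z x) \<le> B * (C0 * F)"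
      if U: "continuous_on UNIV U" "\<And>x. \<bar>U x\<bar> \<le> B" and z: "sq_integrable z" "l2norm z \<le> C0 * F" for U z B
    proof -
      have cU: "continuous_on UNIV (\<lambda>x. - U x)" by (intro continuous_intros U(1))
      have bU: "\<bar>- U x\<bar> \<le> B" for x using U(2)[of x] by simp
      show "sq_integrable (\<lambda>x. - U x * z x)" by (rule sq_integrable_mult_bounded(1)[OF cU z(1) bU])
      have "0 \<le> B" using bU[of 0] by linarith
      have "l2norm (\<lambda>x. - U x * z x) \<le> B * l2norm z" by (rule sq_integrable_mult_bounded(2)[OF cU z(1) bU])
      also have "\<dots> \<le> B * (C0 * F)" using z(2) \<open>0 \<le> B\<close> by (rule mult_left_mono)
      finally show "l2norm (\<lambda>x. - U x * z x) \<le> B * (C0 * F)" .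
    qed
    note mVw = neg_mult[OF Vc BV wsq(1) wF(1)]
    have cw1: "sq_integrable (\<lambda>x. - c * w1 x)" "l2norm (\<lambda>x. - c * w1 x) \<le> c * (C0 * F)"
      using sq_integrable_cmult[OF wsq(2), of "- c"] wF(2) c by auto
    have w2eq: "w2 = (\<lambda>x. y x + - c * w1 x + - V x * w x)" using weq by (auto simp: algebra_simps fun_eq_iff)
    have w2: "sq_integrable w2" "l2norm w2 \<le> C2 * F"
      using sq_integrable_bound3[OF ysq yF cw1 mVw] unfolding w2eq[symmetric] by (auto simp: C2_def algebra_simps)
    define w3 where "w3 x = y1 x + - c * w2 x + (- V1 x * w x + - V x * w1 x)" for x
    have w3d: "(w2 has_real_derivative w3 x) (at x)" for x
    proof -
      have "((\<lambda>x. y x + - c * w1 x + - V x * w x) has_real_derivative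
          y1 x + - c * w2 x + (- V1 x * w x + w1 x * - V x)) (at x)"
        by (intro DERIV_add DERIV_cmult DERIV_mult DERIV_minus yd w V)
      then show ?thesis unfolding w2eq[symmetric] by (simp add: w3_def mult.commute)
    qed
    note V1w = neg_mult[OF V1c BV1 wsq(1) wF(1)] and Vw1 = neg_mult[OF Vc BV wsq(2) wF(2)]
    have pot: "sq_integrable (\<lambda>x. - V1 x * w x + - V x * w1 x)"
      "l2norm (\<lambda>x. - V1 x * w x + - V x * w1 x) \<le> BV1 * (C0 * F) + BV * (C0 * F)"
      using sq_integrable_add[OF V1w(1) Vw1(1)] V1w(2) Vw1(2) by auto
    have cw2: "sq_integrable (\<lambda>x. - c * w2 x)" "l2norm (\<lambda>x. - c * w2 x) \<le> c * (C2 * F)"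
      using sq_integrable_cmult[OF w2(1), of "- c"] w2(2) c by auto
    have w3: "sq_integrable w3" "l2norm w3 \<le> (2 / \<eta> + C3) * F"
      using sq_integrable_bound3[OF y1sq y1F cw2 pot] unfolding w3_def[symmetric]
      by (auto simp: C3_def algebra_simps)
    note cons = lattice_lap_consistency[OF sa h(1) w w3d w3(1) H1_pair_sup[OF wH] one]
    have E1: "l2norm (\<lambda>x. lattice_lap a h w x - w2 x) \<le> 2 * A * (2 + C3) * (\<eta> * F)"
    proof -
      have "l2norm (\<lambda>x. lattice_lap a h w x - w2 x) \<le> 2 * h * A * l2norm w3" using cons(2) by (simp add: A_def)
      also have "\<dots> \<le> 2 * h * A * ((2 / \<eta> + C3) * F)" using w3(2) h A0 by (intro mult_left_mono) auto
      also have "\<dots> = 2 * A * ((2 * \<eta> + C3 * h) * F)" using \<eta> by (simp add: field_simps)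
      also have "\<dots> \<le> 2 * A * ((2 * \<eta> + C3 * \<eta>) * F)"
        using h\<eta> C3 A0 F0 by (intro mult_left_mono mult_right_mono add_left_mono) auto
      finally show ?thesis by (simp add: algebra_simps)
    qed
    (* The rough part \<eta> y' is treated by the lattice operator. *)
    (* This tolerance compensates the factor 1 + 2/\<eta> by which the H1 norm of y exceeds the norm of f. *)
    define \<epsilon> where "\<epsilon> = \<eta> / (\<eta> + 2)"
    have "0 < \<epsilon>" unfolding \<epsilon>_def using \<eta> by simp
    then obtain u u1 u2 where u: "H1_pair u u1" "H1_pair u1 u2"
      and ur: "l2norm (\<lambda>x. 1 * lattice_lap a h u x + c * u1 x - u x - y x) +
         l2norm (\<lambda>x. 1 * lattice_lap a h u1 x + c * u2 x - u1 x - y1 x) \<le> \<epsilon> * (l2norm y + l2norm y1)"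
      using almost_invertible_1[OF sa h(1) c, of \<epsilon>] yH unfolding almost_invertible_def[OF sa h(1)] by blast
    define r where "r x = 1 * lattice_lap a h u x + c * u1 x - u x - y x" for x
    define r1 where "r1 x = 1 * lattice_lap a h u1 x + c * u2 x - u1 x - y1 x" for x
    have r: "H1_pair r r1" unfolding r_def[abs_def] r1_def[abs_def] by (rule H1_residual[OF sa h(1) u yH])
    have rF: "l2norm r + l2norm r1 \<le> F"
    proof -
      have "l2norm r + l2norm r1 \<le> \<epsilon> * (l2norm y + l2norm y1)" using ur by (simp add: r_def[abs_def] r1_def[abs_def])
      also have "\<dots> \<le> \<epsilon> * (F + 2 / \<eta> * F)" using yF y1F \<open>0 < \<epsilon>\<close> by (intro mult_left_mono) auto
      also have "F + 2 / \<eta> * F = (\<eta> + 2) / \<eta> * F" using \<eta> by (simp add: field_simps)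
      also have "\<epsilon> * ((\<eta> + 2) / \<eta> * F) = F" unfolding \<epsilon>_def using \<eta> by simp
      finally show ?thesis .
    qed
    have u1F: "c * l2norm u1 \<le> 2 * F"
    proof -
      have "(\<lambda>x. 1 * lattice_lap a h u x + c * u1 x - u x) = (\<lambda>x. r x + y x)" by (auto simp: r_def)
      then have "c * l2norm u1 \<le> l2norm r + l2norm y"
        using transport_estimate(2)[OF sa h(1) u(1) c, of 1]
          sq_integrable_add(2)[OF H1_pairD(1)[OF r] ysq] by simp
      then show ?thesis using rF yF l2norm_nonneg[of r1] by linarith
    qed
    have u2F: "c * (\<eta> * l2norm u2) \<le> 3 * F"
    proof -
      have "(\<lambda>x. 1 * lattice_lap a h u1 x + c * u2 x - u1 x) = (\<lambda>x. r1 x + y1 x)" by (auto simp: r1_def)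
      then have "c * l2norm u2 \<le> l2norm r1 + l2norm y1"
        using transport_estimate(2)[OF sa h(1) u(2) c, of 1]
          sq_integrable_add(2)[OF H1_pairD(2)[OF r] y1sq] by simp
      also have "\<dots> \<le> F + 2 / \<eta> * F" using rF y1F l2norm_nonneg[of r] by linarith
      finally have "\<eta> * (c * l2norm u2) \<le> \<eta> * (F + 2 / \<eta> * F)" using \<eta> by (intro mult_left_mono) auto
      also have "\<dots> = \<eta> * F + 2 * F" using \<eta> by (simp add: field_simps)
      also have "\<dots> \<le> 1 * F + 2 * F" using \<eta> F0 by (intro add_right_mono mult_right_mono) auto
      finally show ?thesis by (simp add: mult_ac)
    qed
    define v where "v x = w x + \<eta> * u1 x" for x
    define v1 where "v1 x = w1 x + \<eta> * u2 x" for x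
    have vH: "H1_pair v v1" unfolding v_def[abs_def] v1_def[abs_def] by (intro H1_pair_add H1_pair_cmult wH u)
    have vF: "l2norm v \<le> (C0 + 3 / c) * F"
    proof -
      have "l2norm v \<le> l2norm w + \<eta> * l2norm u1" unfolding v_def[abs_def]
        using sq_integrable_add(2)[OF wsq(1) sq_integrable_cmult(1)[OF H1_pairD(2)[OF u(1)], of \<eta>]]
          sq_integrable_cmult(2)[OF H1_pairD(2)[OF u(1)], of \<eta>] \<eta> by simp
      also have "\<dots> \<le> C0 * F + 1 * l2norm u1" using wF \<eta> by (intro add_mono mult_right_mono) auto
      also have "\<dots> \<le> C0 * F + 3 / c * F" using u1F c F0 by (simp add: field_simps)
      finally show ?thesis by (simp add: algebra_simps)
    qed
    have v1F: "l2norm v1 \<le> (C0 + 3 / c) * F"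
    proof -
      have "l2norm v1 \<le> l2norm w1 + \<eta> * l2norm u2" unfolding v1_def[abs_def]
        using sq_integrable_add(2)[OF wsq(2) sq_integrable_cmult(1)[OF H1_pairD(2)[OF u(2)], of \<eta>]]
          sq_integrable_cmult(2)[OF H1_pairD(2)[OF u(2)], of \<eta>] \<eta> by simp
      also have "\<dots> \<le> C0 * F + 3 / c * F" using wF u2F c by (intro add_mono) (auto simp: field_simps)
      finally show ?thesis by (simp add: algebra_simps)
    qed
    have latv: "lattice_lap a h v x = lattice_lap a h w x + \<eta> * lattice_lap a h u1 x" for x
    proof -
      have bu: "\<bar>\<eta> * u1 x\<bar> \<le> \<eta> * (l2norm u1 + l2norm u2)" for x
        using mult_left_mono[OF H1_pair_sup[OF u(2), of x], of \<eta>] \<eta> by (simp add: abs_mult)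
      show ?thesis unfolding v_def[abs_def]
        using lattice_lap_add[OF sa h(1), where u = w and v = "\<lambda>x. \<eta> * u1 x" and x = x, OF H1_pair_sup[OF wH] bu]
          lattice_lap_cmult[OF sa h(1), where u = u1 and x = x and r = \<eta>, OF H1_pair_sup[OF u(2)]] by simp
    qed
    have res: "lattice_lap a h v x + c * v1 x + V x * v x - f x = (lattice_lap a h w x - w2 x) + \<eta> * r1 x + (\<eta> * (1 + V x)) * u1 x" for x
    proof -
      have "\<eta> * y1 x = f x - y x" using \<eta> by (simp add: y1_def)
      moreover have "w2 x = y x - c * w1 x - V x * w x" using weq[of x] by simp
      ultimately show ?thesis unfolding latv v_def v1_def r1_def by (simp add: algebra_simps)
    qed
    have r1F: "l2norm r1 \<le> F" using rF l2norm_nonneg[of r] by linarith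
    have t2: "sq_integrable (\<lambda>x. \<eta> * r1 x)" "l2norm (\<lambda>x. \<eta> * r1 x) \<le> \<eta> * F"
      using sq_integrable_cmult[OF H1_pairD(2)[OF r], of \<eta>] \<eta> r1F by (auto intro: mult_left_mono)
    have t3: "sq_integrable (\<lambda>x. (\<eta> * (1 + V x)) * u1 x)" "l2norm (\<lambda>x. (\<eta> * (1 + V x)) * u1 x) \<le> (1 + BV) * (2 / c) * (\<eta> * F)"
    proof -
      have cV: "continuous_on UNIV (\<lambda>x. \<eta> * (1 + V x))" by (intro continuous_intros Vc)
      have bV: "\<bar>\<eta> * (1 + V x)\<bar> \<le> \<eta> * (1 + BV)" for x
        unfolding abs_mult using BV[of x] \<eta> by (auto intro!: mult_mono)
      note sq1 = H1_pairD(2)[OF u(1)]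
      show "sq_integrable (\<lambda>x. (\<eta> * (1 + V x)) * u1 x)" by (rule sq_integrable_mult_bounded(1)[OF cV sq1 bV])
      have "l2norm (\<lambda>x. (\<eta> * (1 + V x)) * u1 x) \<le> \<eta> * (1 + BV) * l2norm u1"
        by (rule sq_integrable_mult_bounded(2)[OF cV sq1 bV])
      also have "\<dots> \<le> \<eta> * (1 + BV) * (2 / c * F)" using u1F c \<eta> BV0 by (intro mult_left_mono) (auto simp: field_simps)
      finally show "l2norm (\<lambda>x. (\<eta> * (1 + V x)) * u1 x) \<le> (1 + BV) * (2 / c) * (\<eta> * F)" by (simp add: mult_ac)
    qed
    have "l2norm (\<lambda>x. lattice_lap a h v x + c * v1 x + V x * v x - f x) \<le> C4 * \<eta> * F"
      unfolding res using sq_integrable_bound3(2)[OF cons(1) E1 t2 t3] by (simp add: C4_def algebra_simps)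
    then show "\<exists>v v1. H1_pair v v1 \<and> l2norm v \<le> (C0 + 3 / c) * l2norm f \<and> l2norm v1 \<le> (C0 + 3 / c) * l2norm f \<and>
        l2norm (\<lambda>x. lattice_lap a h v x + c * v1 x + V x * v x - f x) \<le> C4 * sqrt h * l2norm f"
      using vH vF v1F unfolding F_def \<eta>_def by blast
  qed
  show thesis
  proof (rule that[OF C], goal_cases)
    case (1 \<epsilon>)
    define h0 where "h0 = min 1 ((\<epsilon> / C4)\<^sup>2)"
    have h0: "0 < h0" using 1 C4 by (simp add: h0_def)
    have "C4 * sqrt h \<le> \<epsilon>" if "0 < h" "h < h0" for h
    proof -
      have "sqrt h \<le> sqrt ((\<epsilon> / C4)\<^sup>2)" using that by (intro real_sqrt_le_mono) (simp add: h0_def)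
      also have "\<dots> = \<epsilon> / C4" using 1 C4 by simp
      finally show ?thesis using C4 by (simp add: field_simps)
    qed
    then have "approx_right_inverse a h c V (C0 + 3 / c) \<epsilon>" if "0 < h" "h < h0" for h
      using main[of h] that mult_right_mono[OF _ l2norm_nonneg, of "C4 * sqrt h" \<epsilon>]
      unfolding approx_right_inverse_def h0_def by (meson less_imp_le min_less_iff_conj order_trans)
    then show ?case using h0 by blast
  qed
qed

section \<open>The Newton iteration\<close>

text \<open>Newton's iteration with the derivative frozen at the continuum front. The step \<open>v\<close> leaves a quarter
of the residual because the inverse is approximate, and at most another quarter because \<open>g'\<close> varies
by at most \<open>\<epsilon> = 1/(4C)\<close> within distance \<open>s\<close> of the front; thus the residuals \<open>(1/2)\<^sup>n e0\<close> are
summable and the iterates stay within \<open>4 C e0 \<le> s\<close>. The residuals converge to 0 in \<open>L\<^sup>2\<close> only, hence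
locally in \<open>L\<^sup>1\<close>, and the limit is identified in the integrated equation.\<close>
lemma lattice_front_from_approximate_inverse:
  fixes a :: "nat \<Rightarrow> real" and g g' \<phi>0 \<phi>1 \<phi>2 \<phi>3 :: "real \<Rightarrow> real" and c C :: real
  assumes sa: "summable (\<lambda>k. \<bar>a (Suc k)\<bar> * real (Suc k))" and one: "(\<lambda>k. a (Suc k)) sums 1"
    and c: "0 < c" and dg: "\<And>x. (g has_real_derivative g' x) (at x)" and g'c: "continuous_on UNIV g'"
    and \<phi>: "\<And>x. (\<phi>0 has_real_derivative \<phi>1 x) (at x)" "\<And>x. (\<phi>1 has_real_derivative \<phi>2 x) (at x)"
      "\<And>x. (\<phi>2 has_real_derivative \<phi>3 x) (at x)"
    and \<phi>3: "sq_integrable \<phi>3" and front: "\<And>x. \<phi>2 x + c * \<phi>1 x + g (\<phi>0 x) = 0"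
    and b: "\<And>x. 0 < \<phi>0 x" "\<And>x. \<phi>0 x < 1"
    and C: "0 < C"
    and inv: "\<exists>h0>0. \<forall>h. 0 < h \<and> h < h0 \<longrightarrow>
     approx_right_inverse a h c (\<lambda>x. g' (\<phi>0 x)) C (1 / 4)"
  shows "\<exists>h0>0. \<forall>h. 0 < h \<and> h < h0 \<longrightarrow> (\<exists>\<phi>.
     (\<forall>x. (\<phi> has_real_derivative - (lattice_lap a h \<phi> x + g (\<phi> x)) / c) (at x)) \<and> (\<forall>x. \<bar>\<phi> x\<bar> \<le> 2) \<and>
     ((\<lambda>x. \<phi> x - \<phi>0 x) \<longlongrightarrow> 0) at_top \<and> ((\<lambda>x. \<phi> x - \<phi>0 x) \<longlongrightarrow> 0) at_bot)"
proof -
  have gc: "continuous_on UNIV g" by (rule has_real_derivative_continuous_on[OF dg])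
  have \<phi>0c: "continuous_on UNIV \<phi>0" by (rule has_real_derivative_continuous_on[OF \<phi>(1)])
  have Vc: "continuous_on UNIV (\<lambda>x. g' (\<phi>0 x))" by (rule continuous_on_compose2[OF g'c \<phi>0c]) simp
  have \<phi>0b: "\<bar>\<phi>0 x\<bar> \<le> 1" for x using b[of x] by simp
  define \<epsilon> where "\<epsilon> = 1 / (4 * C)"
  have \<epsilon>: "0 < \<epsilon>" using C by (simp add: \<epsilon>_def)
  obtain s where s: "0 < s" "s \<le> 1" and su: "\<And>u \<theta>. 0 \<le> u \<Longrightarrow> u \<le> 1 \<Longrightarrow> \<bar>\<theta> - u\<bar> \<le> s \<Longrightarrow> \<bar>g' \<theta> - g' u\<bar> \<le> \<epsilon>"
  proof -
    have "uniformly_continuous_on {-1..2} g'"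
      by (intro compact_uniformly_continuous continuous_on_subset[OF g'c]) auto
    then obtain d where d: "0 < d" "\<And>x y. x \<in> {-1..2} \<Longrightarrow> y \<in> {-1..2} \<Longrightarrow> dist y x < d \<Longrightarrow> dist (g' y) (g' x) < \<epsilon>"
      unfolding uniformly_continuous_on_def using \<epsilon> by metis
    show thesis
    proof (rule that[of "min 1 (d / 2)"])
      fix u \<theta> :: real assume "0 \<le> u" "u \<le> 1" "\<bar>\<theta> - u\<bar> \<le> min 1 (d / 2)"
      then show "\<bar>g' \<theta> - g' u\<bar> \<le> \<epsilon>" using d(1) d(2)[of u \<theta>] by (auto simp: dist_real_def abs_le_iff)
    qed (use d in auto)
  qed
  define A where "A = (\<Sum>k. \<bar>a (Suc k)\<bar> * real (Suc k))"
  have A0: "0 \<le> A" unfolding A_def by (rule suminf_nonneg[OF sa]) simp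
  obtain h1 where h1: "0 < h1" and inv1: "\<And>h f. 0 < h \<Longrightarrow> h < h1 \<Longrightarrow> sq_integrable f \<Longrightarrow>
     \<exists>v v1. H1_pair v v1 \<and> l2norm v \<le> C * l2norm f \<and> l2norm v1 \<le> C * l2norm f \<and>
        l2norm (\<lambda>x. lattice_lap a h v x + c * v1 x + g' (\<phi>0 x) * v x - f x) \<le> (1 / 4) * l2norm f"
    using inv unfolding approx_right_inverse_def by blast
  define h2 where "h2 = s / (4 * C * (2 * A * l2norm \<phi>3 + 1))"
  have den: "0 < 2 * A * l2norm \<phi>3 + 1" using A0 by (simp add: add_nonneg_pos)
  have h2: "0 < h2" unfolding h2_def using s C den by simp
  show ?thesis
  proof (intro exI[of _ "min h1 h2"] conjI allI impI)
    show "0 < min h1 h2" using h1 h2 by simp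
    fix h assume "0 < h \<and> h < min h1 h2"
    then have h: "0 < h" "h < h1" "h < h2" by auto
    (* The residual of the continuum front, by its own equation. *)
    define e0 where "e0 = l2norm (\<lambda>x. lattice_lap a h \<phi>0 x - \<phi>2 x)"
    note cons = lattice_lap_consistency[OF sa h(1) \<phi> \<phi>3 \<phi>0b one]
    have e0: "0 \<le> e0" by (simp add: e0_def)
    have e0s: "4 * C * e0 \<le> s"
    proof -
      have "e0 \<le> h * (2 * A * l2norm \<phi>3)" using cons(2) by (simp add: e0_def A_def mult_ac)
      also have "\<dots> \<le> h2 * (2 * A * l2norm \<phi>3 + 1)" using h A0 h2 by (intro mult_mono) auto
      also have "\<dots> = s / (4 * C)" unfolding h2_def using den C by simp
      finally show ?thesis using C by (simp add: field_simps)
    qed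
    define res where "res w w1 x = lattice_lap a h (\<lambda>x. \<phi>0 x + w x) x + c * (\<phi>1 x + w1 x) + g (\<phi>0 x + w x)"
      for w w1 :: "real \<Rightarrow> real" and x
    define P where "P n z \<longleftrightarrow> H1_pair (fst z) (snd z) \<and> sq_integrable (res (fst z) (snd z)) \<and>
        l2norm (res (fst z) (snd z)) \<le> (1 / 2) ^ n * e0 \<and> (\<forall>x. \<bar>fst z x\<bar> \<le> 4 * C * e0 * (1 - (1 / 2) ^ n))"
      for n :: nat and z :: "(real \<Rightarrow> real) \<times> (real \<Rightarrow> real)"
    define Q where "Q n z z' \<longleftrightarrow> (\<forall>x. \<bar>fst z' x - fst z x\<bar> \<le> 2 * C * e0 * (1 / 2) ^ n)"
      for n :: nat and z z' :: "(real \<Rightarrow> real) \<times> (real \<Rightarrow> real)"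
    have P0: "P 0 (\<lambda>x. 0, \<lambda>x. 0)"
    proof -
      have "res (\<lambda>x. 0) (\<lambda>x. 0) = (\<lambda>x. lattice_lap a h \<phi>0 x - \<phi>2 x)"
      proof
        fix x show "res (\<lambda>x. 0) (\<lambda>x. 0) x = lattice_lap a h \<phi>0 x - \<phi>2 x"
          using front[of x] by (simp add: res_def)
      qed
      then show ?thesis unfolding P_def using cons(1) by (simp add: H1_pair_def e0_def)
    qed
    have step: "\<exists>z'. P (Suc n) z' \<and> Q n z z'" if Pz: "P n z" for n z
    proof -
      obtain w w1 where z: "z = (w, w1)" by (cases z)
      have w: "H1_pair w w1" and rsq: "sq_integrable (res w w1)" and rn: "l2norm (res w w1) \<le> (1 / 2) ^ n * e0"
        and wb: "\<And>x. \<bar>w x\<bar> \<le> 4 * C * e0 * (1 - (1 / 2) ^ n)"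
        using Pz by (auto simp: P_def z)
      define r where "r = res w w1"
      have mr: "sq_integrable (\<lambda>x. - 1 * r x)" "l2norm (\<lambda>x. - 1 * r x) = l2norm r"
        using sq_integrable_cmult[OF rsq, of "-1"] by (auto simp: r_def)
      obtain v v1 where v: "H1_pair v v1" and vn: "l2norm v \<le> C * l2norm r" "l2norm v1 \<le> C * l2norm r"
        and vr: "l2norm (\<lambda>x. lattice_lap a h v x + c * v1 x + g' (\<phi>0 x) * v x - - 1 * r x) \<le> (1 / 4) * l2norm r"
        using inv1[OF h(1,2) mr(1)] unfolding mr(2) by blast
      define q where "q x = lattice_lap a h v x + c * v1 x + g' (\<phi>0 x) * v x - - 1 * r x" for x
      have vs: "\<bar>v x\<bar> \<le> 2 * C * e0 * (1 / 2) ^ n" for x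
      proof -
        have "\<bar>v x\<bar> \<le> 2 * C * l2norm r" using H1_pair_sup[OF v, of x] vn by linarith
        also have "\<dots> \<le> 2 * C * ((1 / 2) ^ n * e0)" using rn C by (intro mult_left_mono) (auto simp: r_def)
        finally show ?thesis by (simp add: mult_ac)
      qed
      have wvb: "\<bar>w x + v x\<bar> \<le> 4 * C * e0 * (1 - (1 / 2) ^ Suc n)" for x
      proof -
        have "\<bar>w x + v x\<bar> \<le> 4 * C * e0 * (1 - (1 / 2) ^ n) + 2 * C * e0 * (1 / 2) ^ n"
          using wb[of x] vs[of x] by linarith
        also have "\<dots> = 4 * C * e0 * (1 - (1 / 2) ^ Suc n)" by (simp add: algebra_simps)
        finally show ?thesis .
      qed
      have le_s: "4 * C * e0 * (1 - (1 / 2) ^ m) \<le> s" for m :: nat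
      proof -
        have "4 * C * e0 * (1 - (1 / 2) ^ m) \<le> 4 * C * e0 * 1" using C e0 by (intro mult_left_mono) auto
        then show ?thesis using e0s by simp
      qed
      have ws: "\<bar>w x\<bar> \<le> s" "\<bar>w x + v x\<bar> \<le> s" for x
        using wb[of x] wvb[of x] le_s[of n] le_s[of "Suc n"] by linarith+
      define N where "N x = g (\<phi>0 x + (w x + v x)) - g (\<phi>0 x + w x) - g' (\<phi>0 x) * v x" for x
      have Nb: "\<bar>N x\<bar> \<le> \<epsilon> * \<bar>v x\<bar>" for x
      proof -
        (* The remainder is an increment of ?f, whose slope is small near the front. *)
        let ?f = "\<lambda>t. g t - g' (\<phi>0 x) * t"
        let ?S = "{\<phi>0 x - s..\<phi>0 x + s}"
        have "norm (?f (\<phi>0 x + (w x + v x)) - ?f (\<phi>0 x + w x)) \<le> \<epsilon> * norm ((\<phi>0 x + (w x + v x)) - (\<phi>0 x + w x))"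
        proof (rule field_differentiable_bound[where S = ?S and f' = "\<lambda>t. g' t - g' (\<phi>0 x) * 1"])
          fix t assume t: "t \<in> ?S"
          show "(?f has_real_derivative g' t - g' (\<phi>0 x) * 1) (at t within ?S)"
            by (intro DERIV_diff DERIV_cmult DERIV_ident has_field_derivative_at_within[OF dg])
          show "norm (g' t - g' (\<phi>0 x) * 1) \<le> \<epsilon>"
            using su[of "\<phi>0 x" t] b[of x] t by (auto simp: abs_le_iff)
        qed (use ws[of x] in \<open>auto simp: abs_le_iff\<close>)
        then show ?thesis by (simp add: N_def algebra_simps)
      qed
      have Nc: "continuous_on UNIV N"
        unfolding N_def
        by (intro continuous_intros continuous_on_compose2[OF gc] \<phi>0c Vc H1_pairD(4)[OF w] H1_pairD(4)[OF v]) auto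
      have N: "sq_integrable N" "l2norm N \<le> 1 / 4 * l2norm r"
      proof -
        note D = sq_integrable_dominated[OF Nc H1_pairD(1)[OF v] less_imp_le[OF \<epsilon>] Nb]
        show "sq_integrable N" by (rule D)
        have "l2norm N \<le> \<epsilon> * (C * l2norm r)" using D(2) vn(1) \<epsilon> by (meson less_imp_le mult_left_mono order_trans)
        also have "\<dots> = 1 / 4 * l2norm r" using C by (simp add: \<epsilon>_def)
        finally show "l2norm N \<le> 1 / 4 * l2norm r" .
      qed
      have qsq: "sq_integrable q"
      proof -
        have Vb: "\<bar>g' (\<phi>0 x)\<bar> \<le> \<bar>g' 0\<bar> + \<bar>g' 1\<bar> + (SUP u\<in>{0..1}. \<bar>g' u\<bar>)" for x
        proof -
          have "bdd_above ((\<lambda>u. \<bar>g' u\<bar>) ` {0..1})"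
            by (intro bounded_imp_bdd_above compact_imp_bounded compact_continuous_image continuous_intros
                continuous_on_subset[OF g'c]) auto
          then have "\<bar>g' (\<phi>0 x)\<bar> \<le> (SUP u\<in>{0..1}. \<bar>g' u\<bar>)"
            using b[of x] by (intro cSUP_upper) auto
          then show ?thesis by linarith
        qed
        show ?thesis unfolding q_def[abs_def]
          by (intro sq_integrable_diff(1) sq_integrable_add(1) sq_integrable_cmult(1) lattice_lap_L2(1)[OF sa h(1) v]
              H1_pairD(2)[OF v] sq_integrable_mult_bounded(1)[OF Vc H1_pairD(1)[OF v] Vb] rsq[folded r_def])
      qed
      have eq: "res (\<lambda>x. w x + v x) (\<lambda>x. w1 x + v1 x) = (\<lambda>x. q x + N x)"
      proof
        fix x
        have bw: "\<bar>\<phi>0 x + w x\<bar> \<le> 1 + s" for x using \<phi>0b[of x] ws(1)[of x] by linarith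
        have "lattice_lap a h (\<lambda>x. (\<phi>0 x + w x) + v x) x = lattice_lap a h (\<lambda>x. \<phi>0 x + w x) x + lattice_lap a h v x"
          by (rule lattice_lap_add[OF sa h(1) bw vs])
        then show "res (\<lambda>x. w x + v x) (\<lambda>x. w1 x + v1 x) x = q x + N x"
          by (simp add: res_def q_def r_def N_def algebra_simps)
      qed
      have "l2norm (\<lambda>x. q x + N x) \<le> (1 / 2) ^ Suc n * e0"
      proof -
        have "l2norm (\<lambda>x. q x + N x) \<le> l2norm q + l2norm N" by (rule sq_integrable_add(2)[OF qsq N(1)])
        also have "\<dots> \<le> 1 / 2 * l2norm r" using vr N(2) unfolding q_def[symmetric] by linarith
        also have "\<dots> \<le> 1 / 2 * ((1 / 2) ^ n * e0)" using rn by (simp add: r_def)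
        finally show ?thesis by simp
      qed
      then have "P (Suc n) (\<lambda>x. w x + v x, \<lambda>x. w1 x + v1 x)"
        unfolding P_def fst_conv snd_conv eq using H1_pair_add[OF w v] sq_integrable_add(1)[OF qsq N(1)] wvb by blast
      moreover have "Q n z (\<lambda>x. w x + v x, \<lambda>x. w1 x + v1 x)" unfolding Q_def z using vs by simp
      ultimately show ?thesis by blast
    qed
    obtain Z where Z: "\<And>n. P n (Z n)" "\<And>n. Q n (Z n) (Z (Suc n))"
      using dependent_nat_choice[of P Q] P0 step by blast
    define W where "W n = fst (Z n)" for n
    define W1 where "W1 n = snd (Z n)" for n
    have W: "H1_pair (W n) (W1 n)" "sq_integrable (res (W n) (W1 n))" "l2norm (res (W n) (W1 n)) \<le> (1 / 2) ^ n * e0" for n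
      using Z(1)[of n] by (auto simp: P_def W_def W1_def)
    have Ws: "\<bar>W n x\<bar> \<le> s" for n x
    proof -
      have "4 * C * e0 * (1 - (1 / 2) ^ n) \<le> 4 * C * e0 * 1" using C e0 by (intro mult_left_mono) auto
      then show ?thesis using Z(1)[of n] e0s unfolding P_def W_def by (auto intro: order_trans)
    qed
    have W00: "W 0 x = 0" for x using Z(1)[of 0] by (simp add: P_def W_def)
    have Wd: "\<bar>W (Suc n) x - W n x\<bar> \<le> 2 * C * e0 * (1 / 2) ^ n" for n x
      using Z(2)[of n] by (simp add: Q_def W_def)
    define w where "w x = (\<Sum>n. W (Suc n) x - W n x)" for x
    have "uniform_limit UNIV (\<lambda>n x. \<Sum>k<n. W (Suc k) x - W k x) w sequentially"
      unfolding w_def[abs_def]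
      by (rule Weierstrass_m_test[where M = "\<lambda>n. 2 * C * e0 * (1 / 2) ^ n"])
         (use Wd in \<open>auto intro!: summable_mult summable_geometric\<close>)
    moreover have "(\<Sum>k<n. W (Suc k) x - W k x) = W n x" for n x
      using sum_lessThan_telescope[of "\<lambda>k. W k x" n] W00 by simp
    ultimately have Wlim: "uniform_limit UNIV W w sequentially" by simp
    have near: "\<exists>N. \<forall>n\<ge>N. \<forall>x. \<bar>W n x - w x\<bar> < e" if "0 < e" for e
      using Wlim that unfolding uniform_limit_iff by (auto simp: eventually_sequentially dist_real_def)
    have wc: "continuous_on UNIV w"
      by (rule uniform_limit_theorem[OF _ Wlim]) (auto simp: H1_pairD(4)[OF W(1)])
    have wptw: "(\<lambda>n. W n x) \<longlonglongrightarrow> w x" for x using tendsto_uniform_limitI[OF Wlim] by simp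
    have wb: "\<bar>w x\<bar> \<le> s" for x
      by (rule LIMSEQ_le_const2[OF tendsto_rabs[OF wptw]]) (use Ws in auto)
    have w0: "(w \<longlongrightarrow> 0) F" if W0: "\<And>n. (W n \<longlongrightarrow> 0) F" for F
    proof (rule tendstoI)
      fix e :: real assume e: "0 < e"
      then obtain n where n: "\<And>x. \<bar>W n x - w x\<bar> < e / 2" using near[of "e/2"] by auto
      have "\<forall>\<^sub>F x in F. dist (W n x) 0 < e / 2" using W0[of n] e by (intro tendstoD) auto
      then show "\<forall>\<^sub>F x in F. dist (w x) 0 < e"
      proof eventually_elim
        case (elim x)
        then have "\<bar>w x\<bar> < e" using n[of x] unfolding dist_real_def by linarith
        then show ?case by (simp add: dist_real_def)
      qed
    qed
    define \<psi> where "\<psi> x = \<phi>0 x + w x" for x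
    define H where "H x = lattice_lap a h \<psi> x + g (\<psi> x)" for x
    have \<psi>b: "\<bar>\<psi> x\<bar> \<le> 2" for x using \<phi>0b[of x] wb[of x] s by (simp add: \<psi>_def)
    have \<psi>c: "continuous_on UNIV \<psi>" unfolding \<psi>_def by (intro continuous_intros \<phi>0c wc)
    have Hc: "continuous_on UNIV H" unfolding H_def
      by (intro continuous_on_add lattice_lap_continuous[OF sa h(1) \<psi>b \<psi>c] continuous_on_compose2[OF gc \<psi>c]) auto
    have Hd: "(antideriv H has_real_derivative H x) (at x)" for x by (rule antideriv_deriv[OF Hc])
    define S where "S = (\<Sum>k. \<bar>a (Suc k)\<bar>)"
    have S0: "0 \<le> S" unfolding S_def by (rule suminf_nonneg[OF summable_weights[OF sa]]) simp
    obtain Lg where Lg: "0 \<le> Lg" "\<And>p q. \<bar>p\<bar> \<le> 2 \<Longrightarrow> \<bar>q\<bar> \<le> 2 \<Longrightarrow> \<bar>g p - g q\<bar> \<le> Lg * \<bar>p - q\<bar>"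
    proof -
      have "bounded (g' ` {-2..2})"
        by (intro compact_imp_bounded compact_continuous_image continuous_on_subset[OF g'c]) auto
      then obtain L where "\<forall>y\<in>g' ` {-2..2}. norm y \<le> L" unfolding bounded_iff by blast
      then have L: "\<And>t. t \<in> {-2..2} \<Longrightarrow> norm (g' t) \<le> L" by blast
      show thesis
      proof (rule that[of L])
        show "0 \<le> L" using L[of 0] norm_ge_zero[of "g' 0"] by auto
        fix p q :: real assume "\<bar>p\<bar> \<le> 2" "\<bar>q\<bar> \<le> 2"
        then have "norm (g p - g q) \<le> L * norm (p - q)"
          by (intro field_differentiable_bound[of "{-2..2}" g g'] has_field_derivative_at_within[OF dg] L) auto
        then show "\<bar>g p - g q\<bar> \<le> L * \<bar>p - q\<bar>" by simp
      qed
    qed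
    (* The integrated equation of the limit profile. *)
    have key: "c * (\<psi> x - \<psi> 0) + antideriv H x = 0" for x
    proof (rule ccontr)
      define d where "d = c * (\<psi> x - \<psi> 0) + antideriv H x"
      assume "\<not> c * (\<psi> x - \<psi> 0) + antideriv H x = 0"
      then have d: "0 < \<bar>d\<bar>" by (simp add: d_def)
      define M where "M = S * (4 / h\<^sup>2) + Lg"
      have M0: "0 \<le> M" unfolding M_def using S0 Lg(1) by simp
      have est: "\<bar>c * (\<psi> x - \<psi> 0) + antideriv H x\<bar> \<le> c * (2 * e) + sqrt \<bar>x\<bar> * ((1 / 2) ^ n * e0) + M * e * \<bar>x\<bar>"
        if e: "\<And>x. \<bar>W n x - w x\<bar> \<le> e" for n e
      proof -
        define \<psi>n where "\<psi>n x = \<phi>0 x + W n x" for x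
        define r where "r = res (W n) (W1 n)"
        have rc: "continuous_on UNIV r" using sq_integrableD(1)[OF W(2)[of n]] by (simp add: r_def)
        have dn: "(\<psi>n has_real_derivative \<phi>1 y + W1 n y) (at y)" for y
          unfolding \<psi>n_def[abs_def] by (intro DERIV_add \<phi>(1) H1_pairD(3)[OF W(1)])
        define E where "E y = c * (\<phi>1 y + W1 n y) + H y - r y" for y
        have \<psi>nb: "\<bar>\<psi>n y\<bar> \<le> 2" for y using \<phi>0b[of y] Ws[of n y] s by (simp add: \<psi>n_def)
        have Eb: "norm (E y) \<le> M * e" for y
        proof -
          have db: "\<bar>\<psi> y - \<psi>n y\<bar> \<le> e" for y using e[of y] by (simp add: \<psi>_def \<psi>n_def abs_minus_commute)
          have "E y = lattice_lap a h (\<lambda>x. \<psi> x - \<psi>n x) y + (g (\<psi> y) - g (\<psi>n y))"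
            using lattice_lap_diff[OF sa h(1), where u = \<psi> and v = \<psi>n and x = y, OF \<psi>b \<psi>nb]
            by (simp add: E_def H_def r_def res_def \<psi>n_def[abs_def])
          moreover have "\<bar>lattice_lap a h (\<lambda>x. \<psi> x - \<psi>n x) y\<bar> \<le> S * (4 * e / h\<^sup>2)"
            unfolding S_def by (rule lattice_lap_summable(3)[OF sa h(1) db])
          moreover have "\<bar>g (\<psi> y) - g (\<psi>n y)\<bar> \<le> Lg * e"
            using Lg(2)[OF \<psi>b \<psi>nb, of y y] mult_left_mono[OF db[of y] Lg(1)] by linarith
          ultimately show ?thesis by (simp add: M_def algebra_simps)
        qed
        define Y where "Y y = c * \<psi>n y + antideriv H y - antideriv r y" for y
        have Yd: "(Y has_real_derivative E y) (at y)" for y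
          unfolding Y_def[abs_def] E_def by (intro DERIV_diff DERIV_add DERIV_cmult dn Hd antideriv_deriv rc)
        have "norm (Y x - Y 0) \<le> M * e * norm (x - 0)"
          by (rule field_differentiable_bound[OF convex_UNIV has_field_derivative_at_within[OF Yd] Eb]) auto
        moreover have "\<bar>antideriv r x - antideriv r 0\<bar> \<le> sqrt \<bar>x - 0\<bar> * l2norm r"
          by (rule antideriv_sq_increment_le[OF _ antideriv_deriv[OF rc]]) (use W(2)[of n] in \<open>simp add: r_def\<close>)
        moreover have "sqrt \<bar>x - 0\<bar> * l2norm r \<le> sqrt \<bar>x\<bar> * ((1 / 2) ^ n * e0)"
          using W(3)[of n] by (simp add: r_def mult_left_mono)
        moreover have "\<bar>c * (\<psi> x - \<psi> 0) - c * (\<psi>n x - \<psi>n 0)\<bar> \<le> c * (2 * e)"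
        proof -
          have "c * (\<psi> x - \<psi> 0) - c * (\<psi>n x - \<psi>n 0) = c * ((w x - W n x) - (w 0 - W n 0))"
            by (simp add: \<psi>_def \<psi>n_def algebra_simps)
          moreover have "\<bar>(w x - W n x) - (w 0 - W n 0)\<bar> \<le> 2 * e" using e[of x] e[of 0] by linarith
          ultimately show ?thesis using c by (simp add: abs_mult)
        qed
        moreover have "c * (\<psi> x - \<psi> 0) + antideriv H x
            = (c * (\<psi> x - \<psi> 0) - c * (\<psi>n x - \<psi>n 0)) + (Y x - Y 0) + (antideriv r x - antideriv r 0)"
          by (simp add: Y_def algebra_simps)
        ultimately show ?thesis by (simp add: abs_le_iff)
      qed
      define e where "e = \<bar>d\<bar> / (4 * (2 * c + M * \<bar>x\<bar> + 1))"
      have q: "0 < 2 * c + M * \<bar>x\<bar> + 1" using c M0 by (intro add_pos_pos add_pos_nonneg) auto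
      have e: "0 < e" unfolding e_def using d q by simp
      obtain N where N: "\<And>n x. n \<ge> N \<Longrightarrow> \<bar>W n x - w x\<bar> < e" using near[OF e] by blast
      have "(\<lambda>n. sqrt \<bar>x\<bar> * ((1 / 2) ^ n * e0)) \<longlonglongrightarrow> sqrt \<bar>x\<bar> * (0 * e0)"
        by (intro tendsto_intros LIMSEQ_realpow_zero) auto
      then have "\<forall>\<^sub>F n in sequentially. sqrt \<bar>x\<bar> * ((1 / 2) ^ n * e0) < \<bar>d\<bar> / 4"
        using d by (intro order_tendstoD(2)) auto
      then obtain N' where N': "\<And>n. n \<ge> N' \<Longrightarrow> sqrt \<bar>x\<bar> * ((1 / 2) ^ n * e0) < \<bar>d\<bar> / 4"
        by (auto simp: eventually_sequentially)
      define n where "n = max N N'"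
      have "\<bar>d\<bar> \<le> c * (2 * e) + sqrt \<bar>x\<bar> * ((1 / 2) ^ n * e0) + M * e * \<bar>x\<bar>"
        unfolding d_def by (rule est) (use N[of n] in \<open>auto simp: n_def intro: less_imp_le\<close>)
      also have "\<dots> \<le> e * (2 * c + M * \<bar>x\<bar> + 1) + \<bar>d\<bar> / 4"
        using N'[of n] e by (simp add: n_def algebra_simps)
      also have "e * (2 * c + M * \<bar>x\<bar> + 1) = \<bar>d\<bar> / 4"
      proof -
        have "t / (4 * r) * r = t / 4" if "0 < r" for r t :: real using that by simp
        then show ?thesis unfolding e_def using q by blast
      qed
      finally show False using d by simp
    qed
    have \<psi>eq: "\<psi> = (\<lambda>x. \<psi> 0 - antideriv H x / c)"
    proof
      fix x show "\<psi> x = \<psi> 0 - antideriv H x / c" using key[of x] c by (simp add: field_simps)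
    qed
    have "(\<psi> has_real_derivative 0 - H x / c) (at x)" for x
      by (subst \<psi>eq) (intro DERIV_diff DERIV_const DERIV_cdivide Hd)
    note \<psi>H = this
    have \<psi>d: "(\<psi> has_real_derivative - (lattice_lap a h \<psi> x + g (\<psi> x)) / c) (at x)" for x
    proof -
      have "0 - y / c = - y / c" for y :: real by simp
      then show ?thesis using \<psi>H[of x] unfolding H_def by presburger
    qed
    have "(\<lambda>x. \<psi> x - \<phi>0 x) = w" by (auto simp: \<psi>_def)
    moreover have "(w \<longlongrightarrow> 0) at_top"
      by (rule w0) (rule sq_integrable_tendsto_0_at_top(1)[OF H1_pairD(1,2,3)[OF W(1)]])
    moreover have "(w \<longlongrightarrow> 0) at_bot"
      by (rule w0) (rule sq_integrable_tendsto_0_at_bot[OF H1_pairD(1,2,3)[OF W(1)]])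
    ultimately show "\<exists>\<phi>. (\<forall>x. (\<phi> has_real_derivative - (lattice_lap a h \<phi> x + g (\<phi> x)) / c) (at x)) \<and> (\<forall>x. \<bar>\<phi> x\<bar> \<le> 2) \<and>
     ((\<lambda>x. \<phi> x - \<phi>0 x) \<longlongrightarrow> 0) at_top \<and> ((\<lambda>x. \<phi> x - \<phi>0 x) \<longlongrightarrow> 0) at_bot"
      using \<psi>d \<psi>b by (intro exI[of _ \<psi>]) simp
  qed
qed

section \<open>Smoothness of the profile\<close>

text \<open>Functions with \<open>k\<close> continuous derivatives that are bounded, together with the function. Boundedness is
what lets the infinite series be differentiated termwise, and recursion on the derivative makes closure
properties provable by induction.\<close>
primrec bounded_C :: "nat \<Rightarrow> (real \<Rightarrow> real) \<Rightarrow> bool" where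
  "bounded_C 0 f \<longleftrightarrow> continuous_on UNIV f \<and> (\<exists>B. \<forall>x. \<bar>f x\<bar> \<le> B)"
| "bounded_C (Suc k) f \<longleftrightarrow> (\<exists>B. \<forall>x. \<bar>f x\<bar> \<le> B) \<and> (\<exists>f'. (\<forall>x. (f has_real_derivative f' x) (at x)) \<and> bounded_C k f')"

lemma bounded_C_SucI:
  "(\<And>x. \<bar>f x\<bar> \<le> B) \<Longrightarrow> (\<And>x. (f has_real_derivative f' x) (at x)) \<Longrightarrow> bounded_C k f' \<Longrightarrow> bounded_C (Suc k) f"
  by auto

lemma bounded_C_bounded: "bounded_C k f \<Longrightarrow> \<exists>B. \<forall>x. \<bar>f x\<bar> \<le> B"
  by (cases k) auto

lemma bounded_C_mono: "bounded_C (Suc k) f \<Longrightarrow> bounded_C k f"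
proof (induction k arbitrary: f)
  case 0
  then show ?case using has_real_derivative_continuous_on by auto
next
  case (Suc k)
  from Suc.prems obtain f' where f': "\<forall>x. (f has_real_derivative f' x) (at x)" "bounded_C (Suc k) f'"
    by (auto simp del: bounded_C.simps(1) simp: bounded_C.simps(2)[of "Suc k" f])
  then have "bounded_C k f'" using Suc.IH by blast
  then show ?case using f'(1) bounded_C_bounded[OF Suc.prems] by auto
qed

lemma bounded_C_add: "bounded_C k f \<Longrightarrow> bounded_C k g \<Longrightarrow> bounded_C k (\<lambda>x. f x + g x)"
proof (induction k arbitrary: f g)
  case 0
  then obtain B B' where "\<forall>x. \<bar>f x\<bar> \<le> B" "\<forall>x. \<bar>g x\<bar> \<le> B'" by auto
  then have "\<forall>x. \<bar>f x + g x\<bar> \<le> B + B'" by (meson abs_triangle_ineq add_mono order_trans)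
  then show ?case using 0 by (auto intro: continuous_on_add)
next
  case (Suc k)
  obtain B B' where "\<forall>x. \<bar>f x\<bar> \<le> B" "\<forall>x. \<bar>g x\<bar> \<le> B'" using Suc.prems by auto
  then have "\<forall>x. \<bar>f x + g x\<bar> \<le> B + B'" by (meson abs_triangle_ineq add_mono order_trans)
  moreover obtain f' g' where "\<forall>x. (f has_real_derivative f' x) (at x)" "bounded_C k f'"
    "\<forall>x. (g has_real_derivative g' x) (at x)" "bounded_C k g'" using Suc.prems by auto
  ultimately show ?case using Suc.IH[of f' g'] by (auto intro!: exI[of _ "\<lambda>x. f' x + g' x"] DERIV_add)
qed

lemma bounded_product:
  fixes f g :: "real \<Rightarrow> real"
  assumes "\<forall>x. \<bar>f x\<bar> \<le> B" "\<forall>x. \<bar>g x\<bar> \<le> B'"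
  shows "\<forall>x. \<bar>f x * g x\<bar> \<le> B * B'"
proof
  fix x
  have "0 \<le> B" using assms(1) abs_ge_zero[of "f 0"] by (meson order_trans)
  then show "\<bar>f x * g x\<bar> \<le> B * B'" unfolding abs_mult using assms by (intro mult_mono) auto
qed

lemma bounded_C_mult: "bounded_C k f \<Longrightarrow> bounded_C k g \<Longrightarrow> bounded_C k (\<lambda>x. f x * g x)"
proof (induction k arbitrary: f g)
  case 0
  then obtain B B' where "\<forall>x. \<bar>f x\<bar> \<le> B" "\<forall>x. \<bar>g x\<bar> \<le> B'" by auto
  then have "\<forall>x. \<bar>f x * g x\<bar> \<le> B * B'" by (rule bounded_product)
  then show ?case using 0 by (auto intro: continuous_on_mult)
next
  case (Suc k)
  obtain B B' where "\<forall>x. \<bar>f x\<bar> \<le> B" "\<forall>x. \<bar>g x\<bar> \<le> B'" using Suc.prems by auto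
  then have "\<forall>x. \<bar>f x * g x\<bar> \<le> B * B'" by (rule bounded_product)
  moreover obtain f' g' where d: "\<forall>x. (f has_real_derivative f' x) (at x)" "bounded_C k f'"
    "\<forall>x. (g has_real_derivative g' x) (at x)" "bounded_C k g'" using Suc.prems by auto
  moreover have "bounded_C k (\<lambda>x. f' x * g x + g' x * f x)"
    using Suc.IH[OF d(2) bounded_C_mono[OF Suc.prems(2)]] Suc.IH[OF d(4) bounded_C_mono[OF Suc.prems(1)]] by (rule bounded_C_add)
  moreover have "((\<lambda>x. f x * g x) has_real_derivative f' x * g x + g' x * f x) (at x)" for x
    using d by (intro DERIV_mult) auto
  ultimately show ?case by (intro bounded_C_SucI[of "\<lambda>x. f x * g x" "B * B'" "\<lambda>x. f' x * g x + g' x * f x"]) auto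
qed

lemma bounded_C_const: "bounded_C k (\<lambda>x. r)"
proof (induction k arbitrary: r)
  case (Suc k)
  show ?case using Suc[of 0] by (auto intro!: exI[of _ "\<lambda>x. 0"] exI[of _ "\<bar>r\<bar>"])
qed auto

lemma bounded_C_lat:
  assumes sa: "summable (\<lambda>k. \<bar>a (Suc k)\<bar> * real (Suc k))" and h: "0 < h"
  shows "bounded_C k f \<Longrightarrow> bounded_C k (lattice_lap a h f)"
proof (induction k arbitrary: f)
  case 0
  then obtain B where B: "\<And>x. \<bar>f x\<bar> \<le> B" by auto
  have "\<forall>x. \<bar>lattice_lap a h f x\<bar> \<le> (\<Sum>k. \<bar>a (Suc k)\<bar>) * (4 * B / h\<^sup>2)" using lattice_lap_summable(3)[where u = f, OF sa h B] by blast
  moreover have "continuous_on UNIV (lattice_lap a h f)" using lattice_lap_continuous[where u = f, OF sa h B] 0 by simp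
  ultimately show ?case unfolding bounded_C.simps by blast
next
  case (Suc k)
  then obtain B f' where B: "\<And>x. \<bar>f x\<bar> \<le> B" and f': "\<And>x. (f has_real_derivative f' x) (at x)" "bounded_C k f'" by auto
  obtain B' where B': "\<And>x. \<bar>f' x\<bar> \<le> B'" using bounded_C_bounded[OF f'(2)] by auto
  have "\<forall>x. (lattice_lap a h f has_real_derivative lattice_lap a h f' x) (at x)" using lattice_lap_deriv[where u = f and ?u1.0 = f', OF sa h f'(1) B B'] by blast
  moreover have "\<forall>x. \<bar>lattice_lap a h f x\<bar> \<le> (\<Sum>k. \<bar>a (Suc k)\<bar>) * (4 * B / h\<^sup>2)" using lattice_lap_summable(3)[where u = f, OF sa h B] by blast
  ultimately show ?case using Suc.IH[OF f'(2)] unfolding bounded_C.simps by blast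
qed

lemma C_k_Suc: "C_k (Suc k) f \<longleftrightarrow> f differentiable_on UNIV \<and> C_k k (deriv f)"
  unfolding C_k_def by (auto simp: funpow_Suc_right less_Suc_eq_0_disj simp del: funpow.simps(2))

lemma C_k_continuous: "C_k k f \<Longrightarrow> continuous_on UNIV f"
  by (cases k) (auto simp: C_k_Suc differentiable_imp_continuous_on, simp add: C_k_def)

lemma C_k_SucD:
  assumes "C_k (Suc k) f"
  shows "(f has_real_derivative deriv f x) (at x)" "C_k k (deriv f)"
proof -
  have "f differentiable (at x)" using assms by (auto simp: C_k_Suc differentiable_on_def)
  then show "(f has_real_derivative deriv f x) (at x)"
    by (metis DERIV_deriv_iff_real_differentiable)
  show "C_k k (deriv f)" using assms by (simp add: C_k_Suc)
qed

lemma bounded_C_imp_C_k: "bounded_C k f \<Longrightarrow> C_k k f"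
proof (induction k arbitrary: f)
  case 0
  then show ?case by (simp add: C_k_def)
next
  case (Suc k)
  then obtain f' where f': "\<And>x. (f has_real_derivative f' x) (at x)" "bounded_C k f'" by auto
  have "deriv f = f'" using f'(1) DERIV_imp_deriv by blast
  moreover have "f differentiable_on UNIV"
    using f'(1) unfolding differentiable_on_def real_differentiable_def by blast
  ultimately show ?case using Suc.IH[OF f'(2)] by (simp add: C_k_Suc)
qed

lemma bounded_C_compose: "C_k k g \<Longrightarrow> bounded_C k f \<Longrightarrow> bounded_C k (\<lambda>x. g (f x))"
proof (induction k arbitrary: g)
  have bd: "\<exists>B. \<forall>x. \<bar>g (f x)\<bar> \<le> B" if g: "continuous_on UNIV g" and f: "\<forall>x. \<bar>f x\<bar> \<le> B'" for g :: "real \<Rightarrow> real" and B'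
  proof -
    have "bounded (g ` {-B'..B'})"
      by (intro compact_imp_bounded compact_continuous_image continuous_on_subset[OF g]) auto
    then obtain B where "\<forall>y\<in>g ` {-B'..B'}. norm y \<le> B" unfolding bounded_iff by blast
    then show ?thesis using f by (intro exI[of _ B]) (auto simp: abs_le_iff minus_le_iff)
  qed
  {
    case 0
    then show ?case using bd[of g] C_k_continuous[of 0 g] by (auto intro: continuous_on_compose2)
  next
    case (Suc k)
    from Suc.prems obtain f' where f': "\<And>x. (f has_real_derivative f' x) (at x)" "bounded_C k f'" by auto
    have d: "((\<lambda>x. g (f x)) has_real_derivative deriv g (f x) * f' x) (at x)" for x
      by (rule DERIV_chain2[OF C_k_SucD(1)[OF Suc.prems(1)] f'(1)])
    have "bounded_C k (\<lambda>x. deriv g (f x) * f' x)"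
      by (rule bounded_C_mult[OF Suc.IH[OF C_k_SucD(2)[OF Suc.prems(1)] bounded_C_mono[OF Suc.prems(2)]] f'(2)])
    moreover have "\<exists>B. \<forall>x. \<bar>g (f x)\<bar> \<le> B"
      using bd[of g] C_k_continuous[OF Suc.prems(1)] bounded_C_bounded[OF Suc.prems(2)] by blast
    ultimately show ?case using bounded_C_SucI[OF _ d] by blast
  }
qed

text \<open>The right-hand side of \<open>c \<phi>' = - D\<^sub>h \<phi> - g(\<phi>)\<close> is as smooth as \<open>\<phi>\<close>, so each application of the equation
gains a derivative until the smoothness of \<open>g\<close> is exhausted.\<close>
lemma lattice_profile_regularity:
  assumes sa: "summable (\<lambda>k. \<bar>a (Suc k)\<bar> * real (Suc k))" and h: "0 < h"
    and g: "C_k K g" and \<phi>: "\<And>x. (\<phi> has_real_derivative - (lattice_lap a h \<phi> x + g (\<phi> x)) / c) (at x)"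
    and B: "\<And>x. \<bar>\<phi> x\<bar> \<le> B"
  shows "C_k (K + 1) \<phi>"
proof -
  have gk: "C_k k g" if "k \<le> K" for k
  proof -
    have "continuous_on UNIV ((deriv ^^ k) g)"
    proof (cases "k = K")
      case False
      then have "(deriv ^^ k) g differentiable_on UNIV" using g that by (auto simp: C_k_def)
      then show ?thesis by (rule differentiable_imp_continuous_on)
    qed (use g in \<open>auto simp: C_k_def\<close>)
    then show ?thesis using g that by (auto simp: C_k_def)
  qed
  have "k \<le> K + 1 \<Longrightarrow> bounded_C k \<phi>" for k
  proof (induction k)
    case 0
    then show ?case using has_real_derivative_continuous_on[OF \<phi>] B by auto
  next
    case (Suc k)
    then have IH: "bounded_C k \<phi>" and k: "k \<le> K" by auto
    have "bounded_C k (\<lambda>x. (- 1 / c) * (lattice_lap a h \<phi> x + g (\<phi> x)))"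
      by (rule bounded_C_mult[OF bounded_C_const bounded_C_add[OF bounded_C_lat[OF sa h IH] bounded_C_compose[OF gk[OF k] IH]]])
    moreover have "(- 1 / c) * y = - y / c" for y :: real by simp
    then have "(\<phi> has_real_derivative (- 1 / c) * (lattice_lap a h \<phi> x + g (\<phi> x))) (at x)" for x
      using \<phi> by presburger
    ultimately show ?case by (intro bounded_C_SucI[OF B])
  qed
  from this[of "K + 1"] show ?thesis by (intro bounded_C_imp_C_k) (simp del: bounded_C.simps)
qed

section \<open>Travelling waves of the lattice equation\<close>

lemma travelling_wave_solves_lattice_eq:
  assumes sa: "summable (\<lambda>k. \<bar>a (Suc k)\<bar> * real (Suc k))" and h: "0 < h" and c: "c \<noteq> 0"
    and \<phi>: "\<And>x. (\<phi> has_real_derivative - (lattice_lap a h \<phi> x + g (\<phi> x)) / c) (at x)"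
    and B: "\<And>x. \<bar>\<phi> x\<bar> \<le> B"
  shows "solves_lattice_eq a h g (\<lambda>j t. \<phi> (of_int j * h - c * t))"
  unfolding solves_lattice_eq_def
proof (intro allI impI conjI)
  fix t :: real and j :: int
  let ?x = "of_int j * h - c * t"
  have eq: "coupling_term a h (\<lambda>i. \<phi> (of_int i * h - c * t)) j (Suc k) = lattice_term a h \<phi> k ?x" for k
  proof -
    have e: "of_int (j + int (Suc k)) * h - c * t = ?x + real (Suc k) * h"
      "of_int (j - int (Suc k)) * h - c * t = ?x - real (Suc k) * h" by (simp_all add: algebra_simps)
    show ?thesis unfolding coupling_term_def lattice_term_def e ..
  qed
  show "summable (\<lambda>k. coupling_term a h (\<lambda>i. \<phi> (of_int i * h - c * t)) j (Suc k))"
    unfolding eq by (rule lattice_lap_summable(1)[OF sa h B])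
  have "((\<lambda>t. of_int j * h - c * t) has_real_derivative 0 - c * 1) (at t)"
    by (intro DERIV_diff DERIV_const DERIV_cmult DERIV_ident)
  then have "((\<lambda>t. \<phi> (of_int j * h - c * t)) has_real_derivative - (lattice_lap a h \<phi> ?x + g (\<phi> ?x)) / c * (0 - c * 1)) (at t)"
    by (rule DERIV_chain2[OF \<phi>])
  moreover have "- y / c * (0 - c * 1) = y" for y using c by simp
  ultimately have "((\<lambda>t. \<phi> (of_int j * h - c * t)) has_real_derivative lattice_lap a h \<phi> ?x + g (\<phi> ?x)) (at t)"
    by metis
  then show "((\<lambda>t. \<phi> (of_int j * h - c * t)) has_real_derivative
        (\<Sum>k. coupling_term a h (\<lambda>i. \<phi> (of_int i * h - c * t)) j (Suc k)) + g (\<phi> ?x)) (at t)"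
    unfolding eq lattice_lap_def .
qed

theorem theorem4:
  fixes K :: nat and g :: "real \<Rightarrow> real" and a :: "nat \<Rightarrow> real" and c :: real
  assumes "K \<ge> 2"
    and "C_k K g"
    and "consecutive_zeros g 0 1"
    and "concave_on {0..1} g"
    and "deriv g 1 < 0" and "0 < deriv g 0"
    and "\<exists>C>0. \<exists>\<rho>. 0 < \<rho> \<and> \<rho> < 1 \<and> (\<forall>k\<ge>1. \<bar>a k\<bar> \<le> C * \<rho> ^ k)"
    and "(\<lambda>k. a (Suc k)) sums 1"
    and "c > 2 * sqrt (deriv g 0)"
  shows "\<exists>h\<^sub>0>0. \<forall>h. 0 < h \<and> h < h\<^sub>0 \<longrightarrow>
           (\<exists>\<phi> :: real \<Rightarrow> real.
              C_k (K + 1) \<phi> \<and>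
              (\<phi> \<longlongrightarrow> 1) at_bot \<and>
              (\<phi> \<longlongrightarrow> 0) at_top \<and>
              solves_lattice_eq a h g (\<lambda>j t. \<phi> (of_int j * h - c * t)))"
proof -
  note one = assms(8)
  obtain k where K: "K = Suc (Suc k)" using assms(1) by (metis add_2_eq_Suc le_Suc_ex)
  define g' where "g' = deriv g"
  define g'' where "g'' = deriv g'"
  have dg: "(g has_real_derivative g' x) (at x)" for x
    unfolding g'_def using C_k_SucD(1) assms(2) K by blast
  have Cg': "C_k (Suc k) g'" unfolding g'_def using C_k_SucD(2) assms(2) K by blast
  have dg': "(g' has_real_derivative g'' x) (at x)" for x
    unfolding g''_def by (rule C_k_SucD(1)[OF Cg'])
  have g''c: "continuous_on UNIV g''" unfolding g''_def by (rule C_k_continuous[OF C_k_SucD(2)[OF Cg']])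
  have g'c: "continuous_on UNIV g'" by (rule C_k_continuous[OF Cg'])
  have gc: "continuous_on UNIV g" by (rule C_k_continuous[OF assms(2)])
  have g1: "g' 1 < 0" and g0: "0 < g' 0" and cg: "2 * sqrt (g' 0) < c" using assms by (auto simp: g'_def)
  have c: "0 < c" using cg g0 by (smt (verit) real_sqrt_gt_zero)
  have z: "g 0 = 0" "g 1 = 0" "\<And>x. 0 < x \<Longrightarrow> x < 1 \<Longrightarrow> g x \<noteq> 0"
    using assms(3) by (auto simp: consecutive_zeros_def)
  have sa: "summable (\<lambda>k. \<bar>a (Suc k)\<bar> * real (Suc k))"
  proof -
    obtain D \<rho> where D: "0 < D" "0 < \<rho>" "\<rho> < 1" "\<And>k. k \<ge> 1 \<Longrightarrow> \<bar>a k\<bar> \<le> D * \<rho> ^ k" using assms(7) by blast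
    have "(\<lambda>n. real (Suc n) * \<rho> ^ n) sums (1 / (1 - \<rho>)\<^sup>2)" using geometric_deriv_sums[of \<rho>] D by simp
    then have s: "summable (\<lambda>n. D * \<rho> * (real (Suc n) * \<rho> ^ n))" by (intro summable_mult) (rule sums_summable)
    show ?thesis
    proof (rule summable_comparison_test'[OF s])
      fix n :: nat
      have "\<bar>a (Suc n)\<bar> * real (Suc n) \<le> (D * \<rho> ^ Suc n) * real (Suc n)" using D(4)[of "Suc n"] by (intro mult_right_mono) auto
      then show "norm (\<bar>a (Suc n)\<bar> * real (Suc n)) \<le> D * \<rho> * (real (Suc n) * \<rho> ^ n)"
        by (simp add: mult_ac)
    qed
  qed
  have slope: "g' 1 \<le> g' u" "g' u \<le> g' 0" if "0 \<le> u" "u \<le> 1" for u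
    by (rule concave_unit_interval_bounds(1,2)[OF dg g'c assms(4) z(1,2) _ g0 that]; rule z(3); assumption)+
  have ghalf: "0 < g (1 / 2)"
    by (rule concave_unit_interval_bounds(3)[OF dg g'c assms(4) z(1,2) _ g0]; rule z(3); assumption)
  define \<mu> where "\<mu> = 2 * g (1 / 2)"
  define \<Lambda> where "\<Lambda> = 2 * max (g' 0) (- g' 1)"
  have \<mu>: "0 < \<mu>" using ghalf by (simp add: \<mu>_def)
  have \<mu>g: "\<mu> * (u * (1 - u)) \<le> g u" if "0 \<le> u" "u \<le> 1" for u unfolding \<mu>_def
    by (rule concave_unit_interval_bounds(4)[OF dg g'c assms(4) z(1,2) _ g0 that]; rule z(3); assumption)
  have \<Lambda>: "0 < \<Lambda>" using g0 by (simp add: \<Lambda>_def)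
  have \<Lambda>g: "g u \<le> \<Lambda> * (u * (1 - u))" if "0 \<le> u" "u \<le> 1" for u unfolding \<Lambda>_def
    by (rule concave_unit_interval_bounds(5)[OF dg g'c assms(4) z(1,2) _ g0 that]; rule z(3); assumption)
  obtain \<phi> \<rho> \<kappa> R where \<kappa>: "0 < \<kappa>" "\<And>x. \<kappa> \<le> \<rho> x" and R: "\<And>x. \<rho> x \<le> R"
    and b: "\<And>x. 0 < \<phi> x" "\<And>x. \<phi> x < 1" and half: "\<phi> 0 = 1 / 2"
    and \<phi>: "\<And>x. (\<phi> has_real_derivative - (g (\<phi> x) * \<rho> x)) (at x)"
    and \<rho>: "\<And>x. (\<rho> has_real_derivative g' (\<phi> x) * (\<rho> x)\<^sup>2 - c * \<rho> x + 1) (at x)"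
    and lim: "(\<phi> \<longlongrightarrow> 1) at_bot" "(\<phi> \<longlongrightarrow> 0) at_top"
  proof -
    show thesis
      by (rule front_exists[OF gc g'c slope \<mu> \<mu>g \<Lambda>g g1 g0 cg]; (assumption | (rule that; assumption)))
  qed
  have \<rho>0: "0 < \<rho> x" for x using \<kappa>(1) \<kappa>(2)[of x] by linarith
  have \<rho>c: "continuous_on UNIV \<rho>" by (rule has_real_derivative_continuous_on[OF \<rho>])
  have \<phi>c: "continuous_on UNIV \<phi>" by (rule has_real_derivative_continuous_on[OF \<phi>])
  define p where "p x = g (\<phi> x) * \<rho> x" for x
  have \<phi>p: "(\<phi> has_real_derivative - p x) (at x)" for x using \<phi>[of x] by (simp add: p_def)
  have g\<phi>: "((\<lambda>x. g (\<phi> x)) has_real_derivative g' (\<phi> x) * - p x) (at x)" for x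
    by (rule DERIV_chain2[OF dg \<phi>p])
  have pd: "(p has_real_derivative g (\<phi> x) - c * p x) (at x)" for x
    unfolding p_def[abs_def] by (rule front_slope_deriv[OF dg \<phi> \<rho>])
  have pc: "continuous_on UNIV p" by (rule has_real_derivative_continuous_on[OF pd])
  have p0: "0 \<le> p x" for x
  proof -
    have "0 \<le> \<mu> * (\<phi> x * (1 - \<phi> x))" using \<mu> b[of x] by simp
    then have "0 \<le> g (\<phi> x)" using \<mu>g[of "\<phi> x"] b[of x] by linarith
    then show ?thesis using \<rho>0[of x] by (simp add: p_def)
  qed
  have pB: "p x \<le> \<Lambda> * R" for x
  proof -
    have "g (\<phi> x) \<le> \<Lambda> * (\<phi> x * (1 - \<phi> x))" using \<Lambda>g b[of x] by simp
    also have "\<dots> \<le> \<Lambda> * (1 * 1)" using b[of x] \<Lambda> by (intro mult_left_mono mult_mono) auto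
    finally show ?thesis unfolding p_def using R[of x] \<rho>0[of x] \<Lambda> by (intro mult_mono) auto
  qed
  have psq: "sq_integrable p" by (rule front_slope_sq_integrable[OF \<phi>p pc b p0 pB])
  have gsq: "sq_integrable (\<lambda>x. g (\<phi> x))"
  proof -
    have "continuous_on UNIV (\<lambda>x. 1 / \<rho> x)" using \<rho>0 by (intro continuous_intros \<rho>c) (metis less_irrefl)
    moreover have "\<bar>1 / \<rho> x\<bar> \<le> 1 / \<kappa>" for x using \<kappa>(1) \<kappa>(2)[of x] \<rho>0[of x] by (simp add: frac_le)
    ultimately have "sq_integrable (\<lambda>x. 1 / \<rho> x * p x)" by (intro sq_integrable_mult_bounded(1) psq)
    moreover have "1 / \<rho> x * p x = g (\<phi> x)" for x using \<rho>0[of x] by (simp add: p_def)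
    ultimately show ?thesis by simp
  qed
  define V1 where "V1 x = g'' (\<phi> x) * - p x" for x
  have V: "((\<lambda>x. g' (\<phi> x)) has_real_derivative V1 x) (at x)" for x
    unfolding V1_def by (rule DERIV_chain2[OF dg' \<phi>p])
  have bd: "\<exists>B. \<forall>x. \<bar>f (\<phi> x)\<bar> \<le> B" if "continuous_on UNIV f" for f :: "real \<Rightarrow> real"
  proof -
    have "bounded (f ` {0..1})"
      by (intro compact_imp_bounded compact_continuous_image continuous_on_subset[OF that]) auto
    then obtain B where "\<forall>y\<in>f ` {0..1}. norm y \<le> B" unfolding bounded_iff by blast
    then show ?thesis using b by (intro exI[of _ B]) (auto simp: less_imp_le)
  qed
  obtain BV where BV: "\<And>x. \<bar>g' (\<phi> x)\<bar> \<le> BV" using bd[OF g'c] by blast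
  obtain B2 where B2: "\<And>x. \<bar>g'' (\<phi> x)\<bar> \<le> B2" using bd[OF g''c] by blast
  have V1c: "continuous_on UNIV V1" unfolding V1_def
    by (intro continuous_intros continuous_on_compose2[OF g''c \<phi>c] pc) auto
  have BV1: "\<bar>V1 x\<bar> \<le> B2 * (\<Lambda> * R)" for x
    unfolding V1_def abs_mult using B2[of x] p0[of x] pB[of x] by (intro mult_mono) auto
  have gVp: "sq_integrable (\<lambda>x. g' (\<phi> x) * p x)"
    by (rule sq_integrable_mult_bounded(1)[OF has_real_derivative_continuous_on[OF V] psq BV])
  obtain C0 where C0: "0 < C0" and R0: "L2_right_inverse c (\<lambda>x. g' (\<phi> x)) C0"
  proof -
    show thesis
      by (rule linearised_front_right_inverse[OF dg \<mu> \<mu>g \<Lambda>g \<kappa> R b half \<phi> \<rho>]; (assumption | (rule that; assumption)))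
  qed
  obtain C where C: "0 < C" and inv: "\<And>\<epsilon>. 0 < \<epsilon> \<Longrightarrow> \<exists>h0>0. \<forall>h. 0 < h \<and> h < h0 \<longrightarrow>
     approx_right_inverse a h c (\<lambda>x. g' (\<phi> x)) C \<epsilon>"
  proof -
    show thesis
      by (rule approximate_right_inverse[OF sa one c V V1c BV BV1 C0 R0]; (assumption | (rule that; assumption)))
  qed
  define \<phi>2 where "\<phi>2 x = - (g (\<phi> x) - c * p x)" for x
  define \<phi>3 where "\<phi>3 x = - (g' (\<phi> x) * - p x - c * (g (\<phi> x) - c * p x))" for x
  have d1: "((\<lambda>x. - p x) has_real_derivative \<phi>2 x) (at x)" for x
    unfolding \<phi>2_def by (intro DERIV_minus pd)
  have d2: "(\<phi>2 has_real_derivative \<phi>3 x) (at x)" for x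
    unfolding \<phi>2_def[abs_def] \<phi>3_def by (intro DERIV_minus DERIV_diff DERIV_cmult g\<phi> pd)
  have \<phi>3sq: "sq_integrable \<phi>3"
  proof -
    have "\<phi>3 = (\<lambda>x. g' (\<phi> x) * p x + c * (g (\<phi> x) - c * p x))" by (auto simp: \<phi>3_def)
    then show ?thesis
      by (simp only:) (intro sq_integrable_add(1) sq_integrable_cmult(1) sq_integrable_diff(1) gVp gsq psq)
  qed
  have front: "\<phi>2 x + c * - p x + g (\<phi> x) = 0" for x by (simp add: \<phi>2_def)
  obtain h0 where h0: "0 < h0" and sol: "\<And>h. 0 < h \<Longrightarrow> h < h0 \<Longrightarrow> \<exists>\<psi>.
     (\<forall>x. (\<psi> has_real_derivative - (lattice_lap a h \<psi> x + g (\<psi> x)) / c) (at x)) \<and> (\<forall>x. \<bar>\<psi> x\<bar> \<le> 2) \<and>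
     ((\<lambda>x. \<psi> x - \<phi> x) \<longlongrightarrow> 0) at_top \<and> ((\<lambda>x. \<psi> x - \<phi> x) \<longlongrightarrow> 0) at_bot"
    using lattice_front_from_approximate_inverse[OF sa one c dg g'c \<phi>p d1 d2 \<phi>3sq front b C inv] by auto
  show ?thesis
  proof (intro exI[of _ h0] conjI h0 allI impI)
    fix h assume h: "0 < h \<and> h < h0"
    then obtain \<psi> where \<psi>: "\<And>x. (\<psi> has_real_derivative - (lattice_lap a h \<psi> x + g (\<psi> x)) / c) (at x)"
      and \<psi>b: "\<And>x. \<bar>\<psi> x\<bar> \<le> 2" and top: "((\<lambda>x. \<psi> x - \<phi> x) \<longlongrightarrow> 0) at_top" and bot: "((\<lambda>x. \<psi> x - \<phi> x) \<longlongrightarrow> 0) at_bot"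
      using sol[of h] by blast
    have "C_k (K + 1) \<psi>" using lattice_profile_regularity[OF sa _ assms(2) \<psi> \<psi>b] h by blast
    moreover have "(\<psi> \<longlongrightarrow> 1) at_bot" using tendsto_add[OF bot lim(1)] by simp
    moreover have "(\<psi> \<longlongrightarrow> 0) at_top" using tendsto_add[OF top lim(2)] by simp
    moreover have "solves_lattice_eq a h g (\<lambda>j t. \<psi> (of_int j * h - c * t))"
      using travelling_wave_solves_lattice_eq[OF sa _ _ \<psi> \<psi>b] h c by simp
    ultimately show "\<exists>\<phi>. C_k (K + 1) \<phi> \<and> (\<phi> \<longlongrightarrow> 1) at_bot \<and> (\<phi> \<longlongrightarrow> 0) at_top \<and>
        solves_lattice_eq a h g (\<lambda>j t. \<phi> (of_int j * h - c * t))" by blast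
  qed
qed

end
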